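(* Let $G$ be a locally compact Polish group. For every measure-preserving action of $G$ on a standard probability space $(X,\mu)$ and for every dense subgroup $H\subset G$, the orbit full group $[\mathcal R_H]$ is dense in $[\mathcal R_G]$ for the topology of convergence in measure on $[\mathcal R_G]$.
   Context: A standard probability space $(X,\mu)$ is a standard Borel space $X$ with a non-atomic Borel probability measure $\mu$. A measure-preserving action of a Polish group $G$ on $(X,\mu)$ is a group action whose action map $G\times X\to X$ is Borel and such that $\mu(gA)=\mu(A)$ for every $g\in G$ and every Borel $A\subseteq X$. $\mathrm{Aut}(X,\mu)$ is the group of measure-preserving Borel bijections of $(X,\mu)$, two of them being identified if they coincide on a full measure set. Orbit full groups: for a subgroup $H\le G$ (in particular $H=G$), $[\mathcal R_H]:=\{T\in\mathrm{Aut}(X,\mu): T(x)\in H\cdot x \text{ for every } x\in X\}$ (up to null sets). Topology of convergence in measure on $[\mathcal R_G]$: let $d_G$ be a compatible, right-invariant, bounded metric on $G$, let $\mathrm L^0(X,\mu,G)$ be the space of measurable functions $X\to G$ (up to equality a.e.), with the metric $\tilde d_G(f,g)=\int_X d_G(f(x),g(x))\,d\mu(x)$; its topology (convergence in measure) only depends on the topology of $G$. For $f\in \mathrm L^0(X,\mu,G)$ let $\Phi(f)(x)=f(x)x$, and let $\widetilde{[\mathcal R_G]}:=\Phi^{-1}([\mathcal R_G])$, with the topology induced from $\mathrm L^0(X,\mu,G)$. The topology of convergence in measure on $[\mathcal R_G]$ is the quotient topology induced by $\Phi:\widetilde{[\mathcal R_G]}\to[\mathcal R_G]$; it is a Polish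 group topology. *)

theory Defs
  imports "HOL-Probability.Probability"
begin

definition standard_borel :: "'x measure \<Rightarrow> bool" where
  "standard_borel M \<longleftrightarrow>
     (\<exists>S. completely_metrizable_space S \<and> second_countable S \<and> topspace S = space M \<and>
          sets M = sigma_sets (topspace S) {U. openin S U})"

definition non_atomic :: "'x measure \<Rightarrow> bool" where
  "non_atomic M \<longleftrightarrow>
     (\<forall>A\<in>sets M. 0 < emeasure M A \<longrightarrow>
        (\<exists>B\<in>sets M. B \<subseteq> A \<and> 0 < emeasure M B \<and> emeasure M B < emeasure M A))"

definition standard_probability_space :: "'x measure \<Rightarrow> bool" where
  "standard_probability_space M \<longleftrightarrow> prob_space M \<and> standard_borel M \<and> non_atomic M"

text \<open>Groups are written additively, as \<^class>\<open>group_add\<close> is the library's type class of (not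
  necessarily commutative) groups that comes with a topological version.\<close>

definition add_subgroup :: "'g::group_add set \<Rightarrow> bool" where
  "add_subgroup H \<longleftrightarrow> 0 \<in> H \<and> (\<forall>g\<in>H. \<forall>h\<in>H. g + h \<in> H) \<and> (\<forall>g\<in>H. - g \<in> H)"

text \<open>The group is second countable, so the product sigma-algebra below is the Borel
  sigma-algebra of the product.\<close>

definition mp_action ::
    "'x measure \<Rightarrow> ('g::{topological_group_add, polish_space} \<Rightarrow> 'x \<Rightarrow> 'x) \<Rightarrow> bool" where
  "mp_action M act \<longleftrightarrow>
     (\<lambda>(g, x). act g x) \<in> measurable (borel \<Otimes>\<^sub>M M) M \<and>
     (\<forall>x\<in>space M. act 0 x = x) \<and>
     (\<forall>g h. \<forall>x\<in>space M. act (g + h) x = act g (act h x)) \<and>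
     (\<forall>g. \<forall>A\<in>sets M. emeasure M (act g ` A) = emeasure M A)"

definition orbit :: "('g \<Rightarrow> 'x \<Rightarrow> 'x) \<Rightarrow> 'g set \<Rightarrow> 'x \<Rightarrow> 'x set" where
  "orbit act H x = (\<lambda>h. act h x) ` H"

definition ae_rel :: "'x measure \<Rightarrow> 'y measure \<Rightarrow> (('x \<Rightarrow> 'y) \<times> ('x \<Rightarrow> 'y)) set" where
  "ae_rel M N = {(f, g). f \<in> measurable M N \<and> g \<in> measurable M N \<and> (AE x in M. f x = g x)}"

definition L0 :: "'x measure \<Rightarrow> 'y measure \<Rightarrow> ('x \<Rightarrow> 'y) set set" where
  "L0 M N = measurable M N // ae_rel M N"

text \<open>Measurability of the inverse is automatic on a standard Borel space (Lusin--Souslin).\<close>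

definition mp_bijections :: "'x measure \<Rightarrow> ('x \<Rightarrow> 'x) set" where
  "mp_bijections M =
     {T \<in> measurable M M. bij_betw T (space M) (space M) \<and>
        the_inv_into (space M) T \<in> measurable M M \<and> distr M M T = M}"

text \<open>An element of \<open>Aut(X, \<mu>)\<close> is a class in \<open>L0 M M\<close> that contains a measure-preserving
  bijection: classes are taken among all measurable self-maps, so that the map \<open>orbit_map\<close> below,
  which is defined on all of \<open>L0 M borel\<close>, takes its values among the same kind of classes.\<close>

definition Aut :: "'x measure \<Rightarrow> ('x \<Rightarrow> 'x) set set" where
  "Aut M = {C \<in> L0 M M. C \<inter> mp_bijections M \<noteq> {}}"

definition full_group ::
    "'x measure \<Rightarrow> ('g \<Rightarrow> 'x \<Rightarrow> 'x) \<Rightarrow> 'g set \<Rightarrow> ('x \<Rightarrow> 'x) set set" where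
  "full_group M act H =
     {C \<in> Aut M. \<exists>T \<in> C \<inter> mp_bijections M. \<forall>x\<in>space M. T x \<in> orbit act H x}"

text \<open>The metric \<open>d\<close> integrated over \<open>M\<close>; the integral does not depend on the representatives
  (lemma \<open>L0_dist_eq\<close> below). The value outside \<open>L0 M borel\<close> is a dummy: the locale
  \<^locale>\<open>Metric_space\<close> asks for nonnegativity and symmetry on the whole type.\<close>

definition L0_dist ::
    "'x measure \<Rightarrow> ('y::topological_space \<Rightarrow> 'y \<Rightarrow> real) \<Rightarrow> ('x \<Rightarrow> 'y) set \<Rightarrow> ('x \<Rightarrow> 'y) set \<Rightarrow> real"
  where
  "L0_dist M d C D =
     (if C \<in> L0 M borel \<and> D \<in> L0 M borel
      then the_elem (\<Union>f\<in>C. \<Union>g\<in>D. {\<integral>x. d (f x) (g x) \<partial>M}) else 0)"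

definition L0_topology ::
    "'x measure \<Rightarrow> ('y::topological_space \<Rightarrow> 'y \<Rightarrow> real) \<Rightarrow> ('x \<Rightarrow> 'y) set topology" where
  "L0_topology M d = Metric_space.mtopology (L0 M borel) (L0_dist M d)"

text \<open>The map \<open>\<Phi>\<close>, \<open>\<Phi>(f)(x) = f(x) x\<close>, on classes.\<close>

definition orbit_map ::
    "'x measure \<Rightarrow> ('g \<Rightarrow> 'x \<Rightarrow> 'x) \<Rightarrow> ('x \<Rightarrow> 'g) set \<Rightarrow> ('x \<Rightarrow> 'x) set" where
  "orbit_map M act C = {T \<in> measurable M M. \<exists>f\<in>C. AE x in M. T x = act (f x) x}"

definition full_group_lift ::
    "'x measure \<Rightarrow> ('g::topological_space \<Rightarrow> 'x \<Rightarrow> 'x) \<Rightarrow> ('x \<Rightarrow> 'g) set set" where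
  "full_group_lift M act = {C \<in> L0 M borel. orbit_map M act C \<in> full_group M act UNIV}"

definition quotient_topology :: "'a topology \<Rightarrow> ('a \<Rightarrow> 'b) \<Rightarrow> 'b set \<Rightarrow> 'b topology" where
  "quotient_topology X f Y = topology (\<lambda>U. U \<subseteq> Y \<and> openin X {x \<in> topspace X. f x \<in> U})"

definition conv_in_measure_topology ::
    "'x measure \<Rightarrow> ('g::topological_space \<Rightarrow> 'x \<Rightarrow> 'x) \<Rightarrow> ('g \<Rightarrow> 'g \<Rightarrow> real) \<Rightarrow>
     ('x \<Rightarrow> 'x) set topology" where
  "conv_in_measure_topology M act d =
     quotient_topology (subtopology (L0_topology M d) (full_group_lift M act))
       (orbit_map M act) (full_group M act UNIV)"

lemma openin_quotient_topology:
  "openin (quotient_topology X f Y) U \<longleftrightarrow> U \<subseteq> Y \<and> openin X {x \<in> topspace X. f x \<in> U}"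
proof -
  have "istopology (\<lambda>U. U \<subseteq> Y \<and> openin X {x \<in> topspace X. f x \<in> U})"
    unfolding istopology_def
  proof (intro conjI allI impI)
    fix S T
    assume S: "S \<subseteq> Y \<and> openin X {x \<in> topspace X. f x \<in> S}"
      and T: "T \<subseteq> Y \<and> openin X {x \<in> topspace X. f x \<in> T}"
    show "S \<inter> T \<subseteq> Y" using S by blast
    have "{x \<in> topspace X. f x \<in> S \<inter> T} =
        {x \<in> topspace X. f x \<in> S} \<inter> {x \<in> topspace X. f x \<in> T}" by blast
    then show "openin X {x \<in> topspace X. f x \<in> S \<inter> T}" using S T by auto
  next
    fix \<K> assume K: "\<forall>K\<in>\<K>. K \<subseteq> Y \<and> openin X {x \<in> topspace X. f x \<in> K}"
    then show "\<Union>\<K> \<subseteq> Y" by blast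
    have "{x \<in> topspace X. f x \<in> \<Union>\<K>} = (\<Union>K\<in>\<K>. {x \<in> topspace X. f x \<in> K})" by blast
    then show "openin X {x \<in> topspace X. f x \<in> \<Union>\<K>}" using K by auto
  qed
  then show ?thesis by (simp add: quotient_topology_def topology_inverse')
qed

lemma topspace_quotient_topology:
  assumes "\<And>x. x \<in> topspace X \<Longrightarrow> f x \<in> Y"
  shows "topspace (quotient_topology X f Y) = Y"
proof -
  have "{x \<in> topspace X. f x \<in> Y} = topspace X" using assms by blast
  then have "openin (quotient_topology X f Y) Y" by (simp add: openin_quotient_topology)
  moreover have "topspace (quotient_topology X f Y) \<subseteq> Y"
    using openin_quotient_topology[of X f Y] openin_topspace by blast
  ultimately show ?thesis using openin_subset by blast
qed

lemma topspace_conv_in_measure_topology: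
  "topspace (conv_in_measure_topology M act d) = full_group M act UNIV"
  unfolding conv_in_measure_topology_def
  by (rule topspace_quotient_topology) (auto simp: full_group_lift_def)

lemma equiv_ae_rel: "equiv (measurable M N) (ae_rel M N)"
proof (rule equivI)
  show "ae_rel M N \<subseteq> measurable M N \<times> measurable M N" by (auto simp: ae_rel_def)
  show "refl_on (measurable M N) (ae_rel M N)" by (auto simp: refl_on_def ae_rel_def)
  show "sym (ae_rel M N)"
    by (rule symI) (auto simp: ae_rel_def elim: AE_mp)
  show "trans (ae_rel M N)"
  proof (rule transI)
    fix f g h assume fg: "(f, g) \<in> ae_rel M N" and gh: "(g, h) \<in> ae_rel M N"
    then have "AE x in M. f x = g x" "AE x in M. g x = h x" by (auto simp: ae_rel_def)
    then have "AE x in M. f x = h x" by eventually_elim simp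
    then show "(f, h) \<in> ae_rel M N" using fg gh by (auto simp: ae_rel_def)
  qed
qed

lemma L0_dist_eq:
  fixes d :: "'y::second_countable_topology \<Rightarrow> 'y \<Rightarrow> real"
  assumes cont: "continuous_on UNIV (\<lambda>p. d (fst p) (snd p))"
    and C: "C \<in> L0 M borel" and D: "D \<in> L0 M borel" and f: "f \<in> C" and g: "g \<in> D"
  shows "L0_dist M d C D = (\<integral>x. d (f x) (g x) \<partial>M)"
proof -
  have meas: "(\<lambda>x. d (u x) (v x)) \<in> borel_measurable M"
    if "u \<in> borel_measurable M" "v \<in> borel_measurable M" for u v
    using borel_measurable_continuous_Pair[OF that cont] .
  have "(\<integral>x. d (f' x) (g' x) \<partial>M) = (\<integral>x. d (f x) (g x) \<partial>M)" if "f' \<in> C" "g' \<in> D" for f' g'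
  proof -
    have "(f', f) \<in> ae_rel M borel" "(g', g) \<in> ae_rel M borel"
      using C D f g that equiv_ae_rel quotient_eq_iff unfolding L0_def by metis+
    then have *: "f' \<in> borel_measurable M" "f \<in> borel_measurable M" "AE x in M. f' x = f x"
      "g' \<in> borel_measurable M" "g \<in> borel_measurable M" "AE x in M. g' x = g x"
      by (auto simp: ae_rel_def)
    have "AE x in M. d (f' x) (g' x) = d (f x) (g x)"
      using *(3,6) by eventually_elim simp
    then show ?thesis using * by (intro integral_cong_AE meas)
  qed
  then have "(\<Union>f'\<in>C. \<Union>g'\<in>D. {\<integral>x. d (f' x) (g' x) \<partial>M}) = {\<integral>x. d (f x) (g x) \<partial>M}"
    using f g by blast
  then show ?thesis using C D by (simp add: L0_dist_def)
qed

lemma continuous_on_compatible_metric: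
  assumes "Metric_space UNIV d" and top: "Metric_space.mtopology UNIV d = euclidean"
  shows "continuous_on UNIV (\<lambda>p. d (fst p) (snd p))"
proof -
  interpret Metric_space UNIV d by fact
  have "((\<lambda>p. d (fst p) (snd p)) \<longlongrightarrow> d (fst (a, b)) (snd (a, b))) (at (a, b))" for a b
    unfolding tendsto_iff
  proof (intro allI impI)
    fix e :: real assume "0 < e"
    have op: "open (mball c (e/2))" for c
      using openin_mball[of c "e/2"] unfolding top by simp
    have "eventually (\<lambda>p. p \<in> mball a (e/2) \<times> mball b (e/2)) (at (a, b))"
      using \<open>0 < e\<close> by (intro eventually_at_in_open' open_Times op) auto
    then show "eventually (\<lambda>p. dist (d (fst p) (snd p)) (d (fst (a, b)) (snd (a, b))) < e) (at (a, b))"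
    proof eventually_elim
      case (elim p)
      obtain u v where p: "p = (u, v)" by force
      have *: "d a u < e/2" "d b v < e/2" using elim p by auto
      have "d u v \<le> d u a + d a v" "d a v \<le> d a b + d b v" "d a b \<le> d a u + d u b"
        "d u b \<le> d u v + d v b" by (simp_all add: triangle)
      have "\<bar>d u v - d a b\<bar> < e"
        using * \<open>d u v \<le> d u a + d a v\<close> \<open>d a v \<le> d a b + d b v\<close> \<open>d a b \<le> d a u + d u b\<close>
          \<open>d u b \<le> d u v + d v b\<close> unfolding commute[of u a] commute[of v b] by linarith
      then show ?case by (simp add: p dist_real_def)
    qed
  qed
  then show ?thesis by (auto simp: continuous_on_def)
qed

lemma Metric_space_L0_dist:
  fixes d :: "'y::second_countable_topology \<Rightarrow> 'y \<Rightarrow> real"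
  assumes "prob_space M"
    and d: "Metric_space UNIV d" and top: "Metric_space.mtopology UNIV d = euclidean"
    and B: "\<And>g h. d g h \<le> B"
  shows "Metric_space (L0 M borel) (L0_dist M d)"
proof -
  interpret prob_space M by fact
  interpret d: Metric_space UNIV d by fact
  note cont = continuous_on_compatible_metric[OF d top]
  note eq = L0_dist_eq[OF cont]
  have rep: "\<exists>f. f \<in> C \<and> f \<in> borel_measurable M" if "C \<in> L0 M borel" for C :: "('a \<Rightarrow> 'y) set"
    using that unfolding L0_def by (auto elim!: quotientE simp: ae_rel_def)
  have int: "integrable M (\<lambda>x. d (u x) (v x))"
    if "u \<in> borel_measurable M" "v \<in> borel_measurable M" for u v
    using borel_measurable_continuous_Pair[OF that cont] B
    by (intro integrable_const_bound[where B = B]) auto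
  show ?thesis
  proof
    fix C D :: "('a \<Rightarrow> 'y) set"
    show "0 \<le> L0_dist M d C D"
    proof (cases "C \<in> L0 M borel \<and> D \<in> L0 M borel")
      case True
      then obtain f g where "f \<in> C" "g \<in> D" using rep by meson
      then show ?thesis using True by (simp add: eq[of C M D f g] integral_nonneg_AE)
    qed (auto simp: L0_dist_def)
    show "L0_dist M d C D = L0_dist M d D C"
    proof (cases "C \<in> L0 M borel \<and> D \<in> L0 M borel")
      case True
      then obtain f g where "f \<in> C" "g \<in> D" using rep by meson
      then show ?thesis using True by (simp add: eq[of C M D f g] eq[of D M C g f] d.commute)
    qed (auto simp: L0_dist_def)
  next
    fix C D :: "('a \<Rightarrow> 'y) set"
    assume C: "C \<in> L0 M borel" and D: "D \<in> L0 M borel"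
    obtain f g where f: "f \<in> C" "f \<in> borel_measurable M" and g: "g \<in> D" "g \<in> borel_measurable M"
      using rep C D by meson
    have "L0_dist M d C D = 0 \<longleftrightarrow> (AE x in M. d (f x) (g x) = 0)"
      unfolding eq[OF C D f(1) g(1)]
      by (rule integral_nonneg_eq_0_iff_AE[OF int[OF f(2) g(2)]]) simp
    also have "\<dots> \<longleftrightarrow> (f, g) \<in> ae_rel M borel" using f g by (simp add: ae_rel_def)
    also have "\<dots> \<longleftrightarrow> C = D"
      using quotient_eq_iff[OF equiv_ae_rel _ _ f(1) g(1)] C D by (simp add: L0_def)
    finally show "L0_dist M d C D = 0 \<longleftrightarrow> C = D" .
  next
    fix C D E :: "('a \<Rightarrow> 'y) set"
    assume L: "C \<in> L0 M borel" "D \<in> L0 M borel" "E \<in> L0 M borel"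
    obtain f g h where f: "f \<in> C" "f \<in> borel_measurable M" and g: "g \<in> D" "g \<in> borel_measurable M"
      and h: "h \<in> E" "h \<in> borel_measurable M"
      using rep L by meson
    have "(\<integral>x. d (f x) (h x) \<partial>M) \<le> (\<integral>x. d (f x) (g x) + d (g x) (h x) \<partial>M)"
      by (intro integral_mono Bochner_Integration.integrable_add int f g h) (auto simp: d.triangle)
    also have "\<dots> = (\<integral>x. d (f x) (g x) \<partial>M) + (\<integral>x. d (g x) (h x) \<partial>M)"
      by (intro Bochner_Integration.integral_add int f g h)
    finally show "L0_dist M d C E \<le> L0_dist M d C D + L0_dist M d D E"
      by (simp only: eq[OF L(1) L(2) f(1) g(1)] eq[OF L(2) L(3) g(1) h(1)] eq[OF L(1) L(3) f(1) h(1)])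
  qed
qed

end

theory Submission
  imports Defs
begin

text \<open>Write $T \in [\mathcal R_G]$ as \<open>T x = act (f x) x\<close> with \<open>f\<close> measurable
(\<open>ex_measurable_cocycle\<close>). Neighbourhoods of \<open>T\<close> are then described by maps
\<open>x \<mapsto> act (h x) x\<close> with \<open>h\<close> close to \<open>f\<close> in measure, so the task is to find such an \<open>h\<close> with values
in \<open>H\<close> for which the resulting map is a measure-preserving bijection. Let \<open>\<Gamma>\<close> be a countable dense
subgroup of \<open>H\<close>. Choosing \<open>h x \<in> \<Gamma>\<close> near \<open>f x\<close> pointwise is easy, but the resulting map need not be
injective; what is needed is a matching of \<open>X\<close> with itself in which \<open>x\<close> may be matched with
\<open>act q x\<close> whenever \<open>q \<in> \<Gamma>\<close> and \<open>d q (f x) < r\<close>. A partial matching of this kind is called a transport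
of radius \<open>r\<close> below. In finite measure every transport extends to a bijection, almost everywhere,
once the condition on the distance is dropped (\<open>ex_mp_bijection_extending\<close>), and as \<open>d\<close> is bounded the
extension costs little if the transport is defined on all but a small set. So the theorem reduces to
transports of arbitrarily small radius whose domain has measure close to 1
(\<open>ex_close_transport\<close>).

A greedy choice (\<open>greedy_extension\<close>) produces a transport of radius \<open>r\<close> that cannot be enlarged. Let \<open>R\<close>
be the set of points left without an image, and \<open>S\<close> the set of points left without a preimage. No
\<open>q \<in> \<Gamma>\<close> with \<open>d q (f x) < r\<close> carries a point \<open>x \<in> R\<close> into \<open>S\<close>, but \<open>R\<close> need not be small. Two ideas
make it small.

The first is Becker's notion of a suitable action. Integrate over \<open>g\<close> with respect to Haar measure:
as the action is continuous in measure (\<open>act_continuous\<close>) and \<open>\<Gamma>\<close> is dense, for almost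
every \<open>x \<in> R\<close> the set of those \<open>g\<close> near \<open>0\<close> that carry \<open>T x\<close> into \<open>S\<close> is Haar null
(\<open>null_bad_of_maximal\<close>). By invariance of Haar measure this property survives when \<open>T x\<close> is replaced by a
point that is reached from it by a small group element, however that element was chosen
(\<open>retrace_bad\<close>), and a set with this property meets \<open>S\<close> in a null set
(\<open>null_bad_imp_null_inter\<close>). Hence short measurable moves cannot carry a non-null part of \<open>T R\<close> into
\<open>S\<close>. This is where local compactness enters.

The second is an augmenting path argument. Take a transport \<open>P\<close> of radius \<open>r / n\<close> and extend it greedily to
\<open>P'\<close> of radius \<open>r\<close>. Starting from a point \<open>T x\<close> with \<open>x\<close> outside the domain of \<open>P'\<close>, go to the point that
\<open>P\<close> matches with \<open>T x\<close>, apply \<open>T\<close>, and repeat. One step moves by less than \<open>r / n\<close>, so for \<open>n\<close>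
steps the path avoids the points that \<open>P'\<close> does not reach, and it can only be interrupted at the points that \<open>P'\<close>
reaches and \<open>P\<close> does not. The sets of points visited at times \<open>0, \<dots>, n\<close> are pairwise disjoint. If \<open>\<rho>\<close> is
the measure of the complement of the domain of \<open>P'\<close> and \<open>\<delta>\<close> the measure gained from \<open>P\<close> to \<open>P'\<close>, this gives
\<open>(n + 1) * (\<rho> - n * \<delta>) \<le> 1\<close> (\<open>remainder_bound\<close>). The best measure that transports of radius
\<open>r\<close> achieve is monotone in \<open>r\<close>, so it is nearly constant for small \<open>r\<close>; for fixed \<open>n\<close>
one can therefore make \<open>\<delta>\<close> as small as needed, and a large \<open>n\<close> then forces \<open>\<rho>\<close> to be small.

Haar measure is constructed from the covering numbers of the right-invariant metric. Averaging over it also gives the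
continuity of the action in measure, and functions on \<open>X\<close> that are continuous along orbits and separate
points, from which the measurable cocycle \<open>f\<close> is selected.\<close>

section \<open>Covering numbers and an invariant content\<close>

text \<open>The group carries \<open>d\<close> besides the complete metric \<open>dist\<close> of its type class; both induce its topology, but invariance is
assumed of \<open>d\<close> alone.\<close>

locale lc_group_metric = Metric_space UNIV d
  for d :: "'g::{topological_group_add, polish_space} \<Rightarrow> 'g \<Rightarrow> real" +
  assumes mtopology_eq: "mtopology = euclidean"
    and right_inv: "d (g + k) (h + k) = d g h"
    and lc: "locally_compact_space (euclidean :: 'g topology)"
begin

lemma open_mball: "open (mball x r)"
  using openin_mball[of x r] unfolding mtopology_eq by simp

lemma mball_in_open: "open U \<Longrightarrow> x \<in> U \<Longrightarrow> \<exists>r>0. mball x r \<subseteq> U"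
  using openin_mtopology[of U] unfolding mtopology_eq by auto

lemma translate_eq_vimage: "(\<lambda>x. x + c) ` A = (\<lambda>x. x + - c) -` A" for c :: 'g
proof (intro set_eqI iffI)
  fix x assume "x \<in> (\<lambda>x. x + - c) -` A"
  moreover have "x = (x + - c) + c" by (simp add: add.assoc)
  ultimately show "x \<in> (\<lambda>x. x + c) ` A" by blast
qed (auto simp: add.assoc)

lemma open_translate: "open A \<Longrightarrow> open ((\<lambda>x. x + c) ` A)" for c :: 'g
  unfolding translate_eq_vimage by (intro open_vimage continuous_intros)

lemma compact_translate: "compact A \<Longrightarrow> compact ((\<lambda>x. x + c) ` A)" for c :: 'g
  by (intro compact_continuous_image continuous_intros)

lemma mball_translate: "(\<lambda>x. x + c) ` mball x r = mball (x + c) r"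
proof -
  have "d x (y + - c) = d (x + c) y" for y
    using right_inv[of x c "y + - c"] by (simp add: add.assoc)
  then show ?thesis unfolding translate_eq_vimage by auto
qed

lemma ex_compact_nbhd: "\<exists>K U. open U \<and> compact K \<and> (0::'g) \<in> U \<and> U \<subseteq> K"
proof -
  have "\<exists>U K. open U \<and> compact K \<and> (0::'g) \<in> U \<and> U \<subseteq> K"
    using lc unfolding locally_compact_space_def by simp
  then show ?thesis by blast
qed

text \<open>Compactness, applied to the translates of \<open>U\<close> that take \<open>u\<close> to the points of \<open>K\<close>. It allows
covering numbers of compact sets to be compared with each other.\<close>

lemma finite_translates_cover:
  fixes K :: "'g set"
  assumes "compact K" "open U" "u \<in> U"
  shows "\<exists>C. finite C \<and> K \<subseteq> (\<Union>c\<in>C. (\<lambda>x. x + c) ` U)"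
proof -
  have "K \<subseteq> (\<Union>k\<in>K. (\<lambda>x. x + (- u + k)) ` U)"
  proof
    fix k assume "k \<in> K"
    moreover have "k = u + (- u + k)" by (simp add: add.assoc[symmetric])
    ultimately show "k \<in> (\<Union>k\<in>K. (\<lambda>x. x + (- u + k)) ` U)" using assms(3) by blast
  qed
  then obtain D where "D \<subseteq> K" "finite D" "K \<subseteq> (\<Union>k\<in>D. (\<lambda>x. x + (- u + k)) ` U)"
    by (rule compactE_image[OF assms(1), rotated]) (auto intro: open_translate assms)
  then show ?thesis by (intro exI[of _ "(\<lambda>k. - u + k) ` D"]) simp
qed

text \<open>The metric \<open>d\<close> need not be the class metric \<open>dist\<close>, so the gap is found from a finite cover by
\<open>d\<close>-balls. It makes covering numbers additive on disjoint compact sets at all fine scales.\<close>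

lemma disjoint_compact_gap:
  fixes K :: "'g set"
  assumes "compact K" "compact L" "K \<inter> L = {}"
  shows "\<exists>r>0. \<forall>a\<in>K. \<forall>b\<in>L. r \<le> d a b"
proof -
  have "\<exists>r>0. mball k (2 * r) \<subseteq> - L" if "k \<in> K" for k
  proof -
    have "open (- L)" using assms(2) compact_imp_closed by blast
    moreover have "k \<in> - L" using assms(3) that by blast
    ultimately obtain r where "r > 0" "mball k r \<subseteq> - L" using mball_in_open by metis
    then show ?thesis by (intro exI[of _ "r / 2"]) simp
  qed
  then obtain R where R: "\<And>k. k \<in> K \<Longrightarrow> R k > 0 \<and> mball k (2 * R k) \<subseteq> - L" by metis
  have "K \<subseteq> (\<Union>k\<in>K. mball k (R k))" using R by auto
  then obtain D where D: "D \<subseteq> K" "finite D" "K \<subseteq> (\<Union>k\<in>D. mball k (R k))"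
    by (rule compactE_image[OF assms(1), rotated]) (auto intro: open_mball)
  define r where "r = Min (insert 1 (R ` D))"
  have "r > 0" unfolding r_def using D R by auto
  moreover have "r \<le> d a b" if ab: "a \<in> K" "b \<in> L" for a b
  proof -
    obtain k where k: "k \<in> D" "a \<in> mball k (R k)" using D(3) ab(1) by (meson UN_E subsetD)
    have "b \<notin> mball k (2 * R k)" using R[of k] D(1) k(1) ab by blast
    then have "2 * R k \<le> d k b" by simp
    moreover have "d k b \<le> d k a + d a b" by (rule triangle) auto
    moreover have "r \<le> R k" unfolding r_def using k D by auto
    ultimately show ?thesis using k by auto
  qed
  ultimately show ?thesis by blast
qed

text \<open>The number of \<open>d\<close>-balls of radius \<open>1 / Suc n\<close> needed to cover a set; \<open>\<infinity>\<close> if no finite number suffices.\<close>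

definition cov :: "nat \<Rightarrow> 'g set \<Rightarrow> ennreal" where
  "cov n A = (INF C\<in>{C. finite C \<and> A \<subseteq> (\<Union>x\<in>C. mball x (1 / Suc n))}. of_nat (card C))"

lemma cov_le: "finite C \<Longrightarrow> A \<subseteq> (\<Union>x\<in>C. mball x (1 / Suc n)) \<Longrightarrow> cov n A \<le> of_nat (card C)"
  unfolding cov_def by (rule INF_lower) auto

lemma cov_ge:
  assumes "\<And>C. finite C \<Longrightarrow> A \<subseteq> (\<Union>x\<in>C. mball x (1 / Suc n)) \<Longrightarrow> z \<le> of_nat (card C)"
  shows "z \<le> cov n A"
  unfolding cov_def by (rule INF_greatest) (use assms in auto)

lemma cov_mono: "A \<subseteq> B \<Longrightarrow> cov n A \<le> cov n B"
  by (rule cov_ge, rule cov_le) auto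

lemma cov_attained:
  assumes "cov n A \<noteq> \<infinity>"
  shows "\<exists>C. finite C \<and> A \<subseteq> (\<Union>x\<in>C. mball x (1 / Suc n)) \<and> cov n A = of_nat (card C)"
proof -
  let ?S = "{C. finite C \<and> A \<subseteq> (\<Union>x\<in>C. mball x (1 / Suc n))}"
  have "?S \<noteq> {}"
  proof
    assume "?S = {}"
    then have "cov n A = top" unfolding cov_def by (simp only: image_empty Inf_empty)
    with assms show False by simp
  qed
  then obtain C0 where C0: "C0 \<in> ?S" by blast
  obtain C where C: "C \<in> ?S" "\<And>D. D \<in> ?S \<Longrightarrow> card C \<le> card D"
    using ex_has_least_nat[where P = "\<lambda>C. C \<in> ?S" and m = card, OF C0] by blast
  have "of_nat (card C) \<le> cov n A"
    by (rule cov_ge, rule of_nat_mono, rule C(2)) simp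
  moreover have "cov n A \<le> of_nat (card C)" by (rule cov_le) (use C(1) in auto)
  ultimately show ?thesis using C(1) by (intro exI[of _ C]) auto
qed

lemma cov_Un: "cov n (A \<union> B) \<le> cov n A + cov n B"
proof (cases "cov n A = \<infinity> \<or> cov n B = \<infinity>")
  case False
  then obtain C D where C: "finite C" "A \<subseteq> (\<Union>x\<in>C. mball x (1 / Suc n))" "cov n A = of_nat (card C)"
    and D: "finite D" "B \<subseteq> (\<Union>x\<in>D. mball x (1 / Suc n))" "cov n B = of_nat (card D)"
    using cov_attained by meson
  have "cov n (A \<union> B) \<le> of_nat (card (C \<union> D))"
    by (rule cov_le) (use C D in auto)
  also have "\<dots> \<le> of_nat (card C + card D)" by (intro of_nat_mono card_Un_le)
  finally show ?thesis using C D by simp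
qed auto

text \<open>Balls of a right-invariant metric are right translates of each other, so a translated cover is a cover of the same size.\<close>

lemma cov_translate_le: "cov n ((\<lambda>x. x + c) ` A) \<le> cov n A"
proof (rule cov_ge)
  fix C assume C: "finite C" "A \<subseteq> (\<Union>x\<in>C. mball x (1 / Suc n))"
  have "(\<lambda>x. x + c) ` A \<subseteq> (\<Union>x\<in>C. mball (x + c) (1 / Suc n))"
    using C(2) unfolding mball_translate[symmetric] by blast
  then have "cov n ((\<lambda>x. x + c) ` A) \<le> of_nat (card ((\<lambda>x. x + c) ` C))"
    by (intro cov_le) (use C in auto)
  also have "card ((\<lambda>x. x + c) ` C) = card C" by (rule card_image) (auto simp: inj_on_def)
  finally show "cov n ((\<lambda>x. x + c) ` A) \<le> of_nat (card C)" .
qed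

lemma cov_translate: "cov n ((\<lambda>x. x + c) ` A) = cov n A"
proof (rule antisym[OF cov_translate_le])
  have "A = (\<lambda>x. x + - c) ` (\<lambda>x. x + c) ` A" by (simp add: image_image add.assoc)
  then show "cov n A \<le> cov n ((\<lambda>x. x + c) ` A)" using cov_translate_le by metis
qed

text \<open>No ball of radius \<open>1 / Suc n\<close> meets two sets at distance at least \<open>2 / Suc n\<close>, so a cover of the union
splits into covers of the two parts.\<close>

lemma cov_separated:
  assumes r: "\<And>a b. a \<in> A \<Longrightarrow> b \<in> B \<Longrightarrow> r \<le> d a b" and n: "2 / Suc n \<le> r"
  shows "cov n A + cov n B \<le> cov n (A \<union> B)"
proof (rule cov_ge)
  fix C assume C: "finite C" "A \<union> B \<subseteq> (\<Union>x\<in>C. mball x (1 / Suc n))"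
  let ?C = "\<lambda>A. {x \<in> C. mball x (1 / Suc n) \<inter> A \<noteq> {}}"
  have disj: "?C A \<inter> ?C B = {}"
  proof (rule ccontr)
    assume "?C A \<inter> ?C B \<noteq> {}"
    then obtain x a b where x: "a \<in> A" "b \<in> B" "d x a < 1 / Suc n" "d x b < 1 / Suc n" by auto
    have "d a b \<le> d a x + d x b" by (rule triangle) auto
    then have "d a b < 1 / Suc n + 1 / Suc n" using x commute[of a x] by linarith
    then have "d a b < 2 / Suc n" by simp
    then show False using r[OF x(1,2)] n by linarith
  qed
  have le: "cov n D \<le> of_nat (card (?C D))" if D: "D \<subseteq> A \<union> B" for D
  proof -
    have fin: "finite (?C D)" by (rule finite_subset[OF _ C(1)]) blast
    have "D \<subseteq> (\<Union>x\<in>?C D. mball x (1 / Suc n))"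
    proof
      fix a assume a: "a \<in> D"
      then have "a \<in> (\<Union>x\<in>C. mball x (1 / Suc n))" using subsetD[OF C(2)] subsetD[OF D] by metis
      then obtain x where "x \<in> C" "a \<in> mball x (1 / Suc n)" by (rule UN_E)
      then show "a \<in> (\<Union>x\<in>?C D. mball x (1 / Suc n))" using a by blast
    qed
    then show ?thesis by (rule cov_le[OF fin])
  qed
  have "cov n A + cov n B \<le> of_nat (card (?C A)) + of_nat (card (?C B))"
    by (intro add_mono le) simp_all
  also have "\<dots> = of_nat (card (?C A \<union> ?C B))"
    by (subst card_Un_disjoint[OF _ _ disj]) (auto intro: finite_subset[OF _ C(1)])
  also have "\<dots> \<le> of_nat (card C)"
    by (intro of_nat_mono card_mono) (use C(1) in auto)
  finally show "cov n A + cov n B \<le> of_nat (card C)" .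
qed

lemma cov_finite: "compact K \<Longrightarrow> cov n K < \<infinity>"
proof -
  assume "compact K"
  then obtain C where C: "finite C" "K \<subseteq> (\<Union>c\<in>C. (\<lambda>x. x + c) ` mball 0 (1 / Suc n))"
    using finite_translates_cover[OF _ open_mball, of K 0 0 "1 / Suc n"] by auto
  have "cov n K \<le> of_nat (card C)"
    using C unfolding mball_translate by (intro cov_le) simp_all
  also have "\<dots> < \<infinity>" by (simp add: of_nat_less_top)
  finally show ?thesis .
qed

lemma cov_pos: "A \<noteq> {} \<Longrightarrow> 0 < cov n A"
proof -
  assume "A \<noteq> {}"
  have "1 \<le> cov n A"
  proof (rule cov_ge)
    fix C assume C: "finite C" "A \<subseteq> (\<Union>x\<in>C. mball x (1 / Suc n))"
    then have "C \<noteq> {}" using \<open>A \<noteq> {}\<close> by blast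
    then have "1 \<le> card C" using C(1) by (simp add: Suc_le_eq card_gt_0_iff)
    then show "1 \<le> (of_nat (card C) :: ennreal)" using of_nat_mono[of 1 "card C"] by simp
  qed
  then show ?thesis using zero_less_one order_less_le_trans by blast
qed

lemma cov_UN_le:
  assumes "finite C"
  shows "cov n (\<Union>c\<in>C. (\<lambda>x. x + c) ` A) \<le> of_nat (card C) * cov n A"
  using assms
proof (induction C)
  case empty
  have "cov n {} \<le> of_nat (card ({} :: 'g set))" by (rule cov_le) auto
  then show ?case by simp
next
  case (insert c C)
  have "cov n (\<Union>c\<in>insert c C. (\<lambda>x. x + c) ` A) \<le> cov n A + cov n (\<Union>c\<in>C. (\<lambda>x. x + c) ` A)"
    using cov_Un[of n "(\<lambda>x. x + c) ` A"] by (simp add: cov_translate)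
  also have "\<dots> \<le> cov n A + of_nat (card C) * cov n A" by (intro add_mono insert.IH order_refl)
  also have "\<dots> = of_nat (card (insert c C)) * cov n A"
    using insert.hyps by (simp add: distrib_right)
  finally show ?case .
qed

text \<open>Haar's construction. The covering numbers at scale \<open>1 / Suc n\<close>, normalised by that of a fixed compact neighbourhood
of \<open>0\<close>, are monotone, subadditive and right-invariant, and additive on disjoint compact sets once \<open>n\<close> is large.
By Tychonoff's theorem these functions of a set have a cluster point as \<open>n\<close> grows, and each of the
properties is a closed condition on finitely many values.\<close>

lemma ex_invariant_content:
  "\<exists>\<nu>::'g set \<Rightarrow> ennreal.
     (\<forall>A B. A \<subseteq> B \<longrightarrow> \<nu> A \<le> \<nu> B) \<and> (\<forall>A B. \<nu> (A \<union> B) \<le> \<nu> A + \<nu> B) \<and>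
     (\<forall>A c. \<nu> ((\<lambda>x. x + c) ` A) = \<nu> A) \<and>
     (\<forall>A B. compact A \<longrightarrow> compact B \<longrightarrow> A \<inter> B = {} \<longrightarrow> \<nu> A + \<nu> B \<le> \<nu> (A \<union> B)) \<and>
     (\<forall>K. compact K \<longrightarrow> \<nu> K < \<infinity>) \<and>
     (\<forall>K U. compact K \<longrightarrow> open U \<longrightarrow> U \<noteq> {} \<longrightarrow> U \<subseteq> K \<longrightarrow> 0 < \<nu> K)"
proof -
  obtain K0 U0 where K0: "open U0" "compact K0" "(0::'g) \<in> U0" "U0 \<subseteq> K0" using ex_compact_nbhd by blast
  have "K0 \<noteq> {}" using K0(3,4) by blast
  then have pos0: "cov n K0 \<noteq> 0" "cov n K0 \<noteq> \<infinity>" for n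
    using cov_pos[of K0 n] cov_finite[OF K0(2), of n] by simp_all
  define w where "w n = inverse (cov n K0)" for n
  have w1: "cov n K0 * w n = 1" for n
    unfolding w_def using pos0[of n] by (metis divide_ennreal_def ennreal_divide_self infinity_ennreal_def top.not_eq_extremum)
  define \<rho> where "\<rho> n A = cov n A * w n" for n and A
  have "compact (UNIV :: ('g set \<Rightarrow> ennreal) set)"
  proof -
    have "compact_space (product_topology (\<lambda>_::'g set. euclidean :: ennreal topology) UNIV)"
      unfolding compact_space_product_topology using compact_UNIV[where 'a = ennreal]
      by (simp add: compact_space_def compactin_euclidean_iff)
    then show ?thesis
      by (simp add: euclidean_product_topology compact_space_def compactin_euclidean_iff)
  qed
  moreover have "filtermap \<rho> sequentially \<noteq> bot" by (simp add: filtermap_bot_iff)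
  ultimately obtain \<nu> where \<nu>: "inf (nhds \<nu>) (filtermap \<rho> sequentially) \<noteq> bot"
    by (auto simp: compact_filter)
  \<comment> \<open>Along \<open>F\<close> every coordinate converges to that of \<open>\<nu>\<close>, and whatever holds for large \<open>n\<close> holds eventually.\<close>
  define F where "F = inf (nhds \<nu>) (filtermap \<rho> sequentially)"
  have F: "F \<noteq> bot" using \<nu> F_def by simp
  have ev: "eventually P F" if "eventually (\<lambda>n. P (\<rho> n)) sequentially" for P
    by (rule filter_leD[of F "filtermap \<rho> sequentially"])
      (use that in \<open>auto simp: F_def eventually_filtermap\<close>)
  have lim: "((\<lambda>r. r A) \<longlongrightarrow> \<nu> A) F" for A
  proof (rule topological_tendstoI)
    fix S assume S: "open S" "\<nu> A \<in> S"
    have "open ((\<lambda>r::'g set \<Rightarrow> ennreal. r A) -` S)"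
      by (intro open_vimage S continuous_on_product_coordinates)
    then have "eventually (\<lambda>r. r A \<in> S) (nhds \<nu>)" using S unfolding eventually_nhds by auto
    then show "eventually (\<lambda>r. r A \<in> S) F" by (rule filter_leD[rotated]) (simp add: F_def)
  qed
  note le = tendsto_le[OF F]
  have mono: "\<nu> A \<le> \<nu> B" if "A \<subseteq> B" for A B
    by (rule le[OF lim lim], rule ev) (use that in \<open>simp add: \<rho>_def mult_right_mono cov_mono\<close>)
  have Un: "\<nu> (A \<union> B) \<le> \<nu> A + \<nu> B" for A B
    by (rule le[OF tendsto_add[OF lim lim] lim], rule ev)
      (simp add: \<rho>_def mult_right_mono cov_Un distrib_right[symmetric])
  have tr: "\<nu> ((\<lambda>x. x + c) ` A) = \<nu> A" for A c
    by (intro antisym; rule le[OF lim lim], rule ev) (auto simp: \<rho>_def cov_translate)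
  have sep: "\<nu> A + \<nu> B \<le> \<nu> (A \<union> B)" if AB: "compact A" "compact B" "A \<inter> B = {}" for A B
  proof -
    obtain r where r: "r > 0" "\<forall>a\<in>A. \<forall>b\<in>B. r \<le> d a b" using disjoint_compact_gap[OF AB] by blast
    have "eventually (\<lambda>n. 2 / Suc n < r) sequentially"
      by (rule order_tendstoD(2)[OF _ r(1)]) (rule LIMSEQ_Suc[OF lim_const_over_n])
    then have "eventually (\<lambda>n. \<rho> n A + \<rho> n B \<le> \<rho> n (A \<union> B)) sequentially"
    proof eventually_elim
      case (elim n)
      then have "cov n A + cov n B \<le> cov n (A \<union> B)"
        using r(2) by (intro cov_separated[of A B r]) auto
      then show ?case
        unfolding \<rho>_def distrib_right[symmetric] by (rule mult_right_mono) simp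
    qed
    then show ?thesis by (intro le[OF lim tendsto_add[OF lim lim]] ev)
  qed
  have bound: "\<nu> (\<Union>c\<in>C. (\<lambda>x. x + c) ` A) \<le> of_nat (card C) * \<nu> A" if "finite C" for C A
  proof -
    have "\<nu> (\<Union>c\<in>C. (\<lambda>x. x + c) ` A) \<le> (\<Sum>c\<in>C. \<nu> A)" using that
    proof (induction C)
      case empty
      have "cov n {} = 0" for n using cov_UN_le[of "{}" n "{}"] by simp
      then show ?case by (intro le[OF tendsto_const lim] ev) (simp add: \<rho>_def)
    next
      case (insert c C)
      have "\<nu> (\<Union>c\<in>insert c C. (\<lambda>x. x + c) ` A) \<le> \<nu> A + \<nu> (\<Union>c\<in>C. (\<lambda>x. x + c) ` A)"
        using Un[of "(\<lambda>x. x + c) ` A"] by (simp add: tr)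
      also have "\<dots> \<le> \<nu> A + (\<Sum>c\<in>C. \<nu> A)" by (intro add_mono insert.IH order_refl)
      finally show ?case using insert.hyps by (simp del: sum_constant)
    qed
    then show ?thesis by simp
  qed
  \<comment> \<open>The normalisation keeps the cluster point from being identically 0 or infinite.\<close>
  have one: "\<nu> K0 = 1"
    by (intro antisym; rule le[OF lim tendsto_const] le[OF tendsto_const lim], rule ev)
      (auto simp: \<rho>_def w1)
  have fin: "\<nu> K < \<infinity>" if K: "compact K" for K
  proof -
    obtain C where C: "finite C" "K \<subseteq> (\<Union>c\<in>C. (\<lambda>x. x + c) ` U0)"
      using finite_translates_cover[OF K K0(1,3)] by blast
    have "\<nu> K \<le> \<nu> (\<Union>c\<in>C. (\<lambda>x. x + c) ` K0)" by (rule mono) (use C K0(4) in blast)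
    also have "\<dots> \<le> of_nat (card C) * \<nu> K0" by (rule bound[OF C(1)])
    also have "\<dots> < \<infinity>" by (simp add: one of_nat_less_top)
    finally show ?thesis .
  qed
  have pos: "0 < \<nu> K" if K: "compact K" "open U" "U \<noteq> {}" "U \<subseteq> K" for K U
  proof (rule ccontr)
    assume "\<not> 0 < \<nu> K"
    then have z: "\<nu> K = 0" by (simp add: zero_less_iff_neq_zero)
    obtain C where C: "finite C" "K0 \<subseteq> (\<Union>c\<in>C. (\<lambda>x. x + c) ` U)"
      using finite_translates_cover[OF K0(2) K(2)] K(3) by blast
    have "\<nu> K0 \<le> \<nu> (\<Union>c\<in>C. (\<lambda>x. x + c) ` K)" by (rule mono) (use C K(4) in blast)
    also have "\<dots> \<le> of_nat (card C) * \<nu> K" by (rule bound[OF C(1)])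
    finally show False by (simp add: one z)
  qed
  show ?thesis
  proof (intro exI[of _ \<nu>] conjI allI impI, goal_cases)
    case 1 then show ?case by (rule mono)
  next
    case 2 show ?case by (rule Un)
  next
    case 3 show ?case by (rule tr)
  next
    case 4 then show ?case by (rule sep)
  next
    case 5 then show ?case by (rule fin)
  next
    case (6 K U) then show ?case by (rule pos)
  qed
qed

end

section \<open>Haar measure\<close>

text \<open>The parts of \<open>K\<close> outside \<open>U\<close> and outside \<open>V\<close> are disjoint and closed; open sets that separate them
are removed from \<open>K\<close>.\<close>

lemma compact_split_open_cover:
  fixes K :: "'a::metric_space set"
  assumes K: "compact K" and U: "open U" and V: "open V" and sub: "K \<subseteq> U \<union> V"
  obtains L N where "compact L" "compact N" "L \<subseteq> U" "N \<subseteq> V" "K = L \<union> N"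
proof -
  have "closed (K - U)" "closed (K - V)" using K U V by (simp_all add: closed_Diff compact_imp_closed)
  moreover have "(K - U) \<inter> (K - V) = {}" using sub by blast
  ultimately obtain A B where AB: "open A" "open B" "K - U \<subseteq> A" "K - V \<subseteq> B" "A \<inter> B = {}"
    using t4_space by meson
  show thesis
  proof
    show "compact (K - A)" "compact (K - B)" using K AB by (simp_all add: compact_diff)
    show "K - A \<subseteq> U" "K - B \<subseteq> V" "K = (K - A) \<union> (K - B)" using AB by blast+
  qed
qed

text \<open>A right-invariant content on compact sets, as produced above; \<open>\<nu>\<close> is a function of arbitrary sets, but additivity is
required for disjoint compact sets.\<close>

locale invariant_content = lc_group_metric d
  for d :: "'g::{topological_group_add, polish_space} \<Rightarrow> 'g \<Rightarrow> real" +
  fixes \<nu> :: "'g set \<Rightarrow> ennreal"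
  assumes content_mono: "A \<subseteq> B \<Longrightarrow> \<nu> A \<le> \<nu> B"
    and content_Un: "\<nu> (A \<union> B) \<le> \<nu> A + \<nu> B"
    and content_translate: "\<nu> ((\<lambda>x. x + c) ` A) = \<nu> A"
    and content_disjoint: "compact A \<Longrightarrow> compact B \<Longrightarrow> A \<inter> B = {} \<Longrightarrow> \<nu> A + \<nu> B \<le> \<nu> (A \<union> B)"
    and content_finite: "compact K \<Longrightarrow> \<nu> K < \<infinity>"
    and content_pos: "compact K \<Longrightarrow> open U \<Longrightarrow> U \<noteq> {} \<Longrightarrow> U \<subseteq> K \<Longrightarrow> 0 < \<nu> K"
begin

definition inner :: "'g set \<Rightarrow> ennreal" where
  "inner U = (SUP K\<in>{K. compact K \<and> K \<subseteq> U}. \<nu> K)"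

definition outer :: "'g set \<Rightarrow> ennreal" where
  "outer A = (INF U\<in>{U. open U \<and> A \<subseteq> U}. inner U)"

lemma inner_ge: "compact K \<Longrightarrow> K \<subseteq> U \<Longrightarrow> \<nu> K \<le> inner U"
  unfolding inner_def by (rule SUP_upper) simp

lemma inner_le: "(\<And>K. compact K \<Longrightarrow> K \<subseteq> U \<Longrightarrow> \<nu> K \<le> z) \<Longrightarrow> inner U \<le> z"
  unfolding inner_def by (rule SUP_least) simp

lemma outer_le: "open U \<Longrightarrow> A \<subseteq> U \<Longrightarrow> outer A \<le> inner U"
  unfolding outer_def by (rule INF_lower) simp

lemma outer_ge: "(\<And>U. open U \<Longrightarrow> A \<subseteq> U \<Longrightarrow> z \<le> inner U) \<Longrightarrow> z \<le> outer A"
  unfolding outer_def by (rule INF_greatest) simp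

lemma inner_mono: "U \<subseteq> V \<Longrightarrow> inner U \<le> inner V"
  by (rule inner_le, rule inner_ge) auto

lemma outer_mono: "A \<subseteq> B \<Longrightarrow> outer A \<le> outer B"
  by (rule outer_ge, rule outer_le) auto

lemma outer_open: "open U \<Longrightarrow> outer U = inner U"
  by (intro antisym outer_le outer_ge inner_mono) auto

lemma inner_empty: "inner {} = 0"
proof -
  have "\<nu> {} + \<nu> {} \<le> \<nu> {}" using content_disjoint[of "{}" "{}"] by simp
  moreover have "\<nu> {} < top" using content_finite[of "{}"] by simp
  ultimately have "\<nu> {} = 0" by (cases "\<nu> {}") (auto simp: ennreal_plus[symmetric] simp del: ennreal_plus)
  then show ?thesis by (intro antisym inner_le) auto
qed

lemma outer_empty: "outer {} = 0"
  by (simp add: outer_open inner_empty)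

lemma inner_Un:
  assumes "open U" "open V"
  shows "inner (U \<union> V) \<le> inner U + inner V"
proof (rule inner_le)
  fix K assume "compact K" "K \<subseteq> U \<union> V"
  then obtain L N where "compact L" "compact N" "L \<subseteq> U" "N \<subseteq> V" "K = L \<union> N"
    using compact_split_open_cover assms by metis
  then show "\<nu> K \<le> inner U + inner V"
    using content_Un[of L N] by (metis add_mono inner_ge order_trans)
qed

lemma inner_UN_lessThan:
  fixes U :: "nat \<Rightarrow> 'g set"
  assumes "\<And>i. open (U i)"
  shows "inner (\<Union>i<n. U i) \<le> (\<Sum>i<n. inner (U i))"
proof (induction n)
  case (Suc n)
  have "inner (\<Union>i<Suc n. U i) = inner ((\<Union>i<n. U i) \<union> U n)"
    by (simp add: lessThan_Suc Un_commute)
  also have "\<dots> \<le> inner (\<Union>i<n. U i) + inner (U n)"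
    by (intro inner_Un open_UN assms ballI)
  also have "\<dots> \<le> (\<Sum>i<n. inner (U i)) + inner (U n)" by (intro add_right_mono Suc.IH)
  finally show ?case by simp
qed (simp add: inner_empty)

text \<open>A compact set inside the union already lies in a finite union.\<close>

lemma inner_UN:
  fixes U :: "nat \<Rightarrow> 'g set"
  assumes "\<And>i. open (U i)"
  shows "inner (\<Union>i. U i) \<le> (\<Sum>i. inner (U i))"
proof (rule inner_le)
  fix K assume K: "compact K" "K \<subseteq> (\<Union>i. U i)"
  then obtain D where D: "finite D" "K \<subseteq> (\<Union>i\<in>D. U i)"
    using compactE_image[of K UNIV U] assms by metis
  obtain n where n: "D \<subseteq> {..<n}" using D(1) finite_nat_iff_bounded by blast
  have "\<nu> K \<le> inner (\<Union>i<n. U i)" by (rule inner_ge) (use K D n in blast)+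
  also have "\<dots> \<le> (\<Sum>i<n. inner (U i))" by (rule inner_UN_lessThan[OF assms])
  also have "\<dots> \<le> (\<Sum>i. inner (U i))" by (rule sum_le_suminf) auto
  finally show "\<nu> K \<le> (\<Sum>i. inner (U i))" .
qed

lemma outer_approx: "outer A < z \<Longrightarrow> \<exists>U. open U \<and> A \<subseteq> U \<and> inner U < z"
  unfolding outer_def INF_less_iff by auto

text \<open>Countable subadditivity of the outer measure: cover each \<open>A i\<close> by an open set with an error of \<open>e / 2 ^ Suc i\<close>.\<close>

lemma outer_UN:
  fixes A :: "nat \<Rightarrow> 'g set"
  shows "outer (\<Union>i. A i) \<le> (\<Sum>i. outer (A i))"
proof (rule ennreal_le_epsilon)
  fix e :: real assume e: "0 < e" and fin: "(\<Sum>i. outer (A i)) < top"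
  then have "\<And>i. outer (A i) < outer (A i) + ennreal e * ennreal ((1/2) ^ Suc i)"
    by (auto simp add: less_top ennreal_mult[symmetric] dest!: ennreal_suminf_lessD)
  then have "\<forall>i. \<exists>U. open U \<and> A i \<subseteq> U \<and> inner U < outer (A i) + ennreal e * ennreal ((1/2) ^ Suc i)"
    using outer_approx by blast
  then obtain U where U: "\<And>i. open (U i)" "\<And>i. A i \<subseteq> U i"
      "\<And>i. inner (U i) < outer (A i) + ennreal e * ennreal ((1/2) ^ Suc i)"
    by metis
  have "outer (\<Union>i. A i) \<le> inner (\<Union>i. U i)"
    by (rule outer_le) (use U in \<open>auto intro!: open_UN\<close>)
  also have "\<dots> \<le> (\<Sum>i. inner (U i))" by (rule inner_UN[OF U(1)])
  also have "\<dots> \<le> (\<Sum>i. outer (A i) + ennreal e * ennreal ((1/2) ^ Suc i))"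
    by (intro suminf_le less_imp_le U(3)) auto
  also have "\<dots> = (\<Sum>i. outer (A i)) + (\<Sum>i. ennreal e * ennreal ((1/2) ^ Suc i))"
    by (subst suminf_add[symmetric]) auto
  also have "\<dots> = (\<Sum>i. outer (A i)) + e"
    unfolding ennreal_suminf_cmult
    by (subst suminf_ennreal_eq[OF zero_le_power power_half_series]) auto
  finally show "outer (\<Union>i. A i) \<le> (\<Sum>i. outer (A i)) + ennreal e" .
qed

lemma outer_Un: "outer (A \<union> B) \<le> outer A + outer B"
  using outer_UN[of "binaryset A B"] suminf_binaryset_eq[of outer A B, OF outer_empty]
  by (simp add: UN_binaryset_eq)

lemma outer_translate_le: "outer ((\<lambda>x. x + c) ` A) \<le> outer A"
proof (rule outer_ge)
  fix U assume U: "open U" "A \<subseteq> U"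
  have "outer ((\<lambda>x. x + c) ` A) \<le> inner ((\<lambda>x. x + c) ` U)"
    by (rule outer_le) (use U open_translate in auto)
  also have "\<dots> \<le> inner U"
  proof (rule inner_le)
    fix K assume K: "compact K" "K \<subseteq> (\<lambda>x. x + c) ` U"
    have "\<nu> K = \<nu> ((\<lambda>x. x + - c) ` K)" by (rule content_translate[symmetric])
    also have "\<dots> \<le> inner U"
    proof (intro inner_ge compact_translate K(1))
      show "(\<lambda>x. x + - c) ` K \<subseteq> U" using K(2) by (auto simp: add.assoc)
    qed
    finally show "\<nu> K \<le> inner U" .
  qed
  finally show "outer ((\<lambda>x. x + c) ` A) \<le> inner U" .
qed

lemma outer_translate: "outer ((\<lambda>x. x + c) ` A) = outer A"
proof (rule antisym[OF outer_translate_le])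
  have "A = (\<lambda>x. x + - c) ` (\<lambda>x. x + c) ` A" by (simp add: image_image add.assoc)
  then show "outer A \<le> outer ((\<lambda>x. x + c) ` A)" using outer_translate_le by metis
qed

text \<open>Caratheodory measurability of an open set \<open>U\<close>. For an open \<open>V\<close> that contains the test set, exhaust \<open>U \<inter> V\<close> by a
compact \<open>K\<close> and then \<open>V - K\<close> by a compact \<open>L\<close>; the content is superadditive on the disjoint sets \<open>K\<close> and \<open>L\<close>.\<close>

lemma open_in_lambda_system:
  assumes U: "open U"
  shows "U \<in> lambda_system UNIV UNIV outer"
proof -
  have "outer (U \<inter> A) + outer ((UNIV - U) \<inter> A) \<le> outer A" for A
  proof (rule outer_ge)
    fix V assume V: "open V" "A \<subseteq> V"
    let ?S = "{K. compact K \<and> K \<subseteq> U \<inter> V}"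
    have "outer (U \<inter> A) + outer ((UNIV - U) \<inter> A) \<le> inner (U \<inter> V) + outer (V - U)"
      by (intro add_mono outer_le outer_mono) (use U V in auto)
    also have "\<dots> = (SUP K\<in>?S. \<nu> K + outer (V - U))"
      unfolding inner_def by (rule ennreal_SUP_add_left[symmetric]) auto
    also have "\<dots> \<le> inner V"
    proof (rule SUP_least)
      fix K assume K: "K \<in> ?S"
      let ?L = "{L. compact L \<and> L \<subseteq> V - K}"
      have "\<nu> K + outer (V - U) \<le> \<nu> K + inner (V - K)"
        by (intro add_left_mono outer_le) (use K V in \<open>auto intro: open_Diff compact_imp_closed\<close>)
      also have "\<dots> = (SUP L\<in>?L. \<nu> K + \<nu> L)"
        unfolding inner_def by (rule ennreal_SUP_add_right) auto
      also have "\<dots> \<le> inner V"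
      proof (rule SUP_least)
        fix L assume L: "L \<in> ?L"
        have "\<nu> K + \<nu> L \<le> \<nu> (K \<union> L)" by (rule content_disjoint) (use K L in auto)
        also have "\<dots> \<le> inner V" by (rule inner_ge) (use K L in \<open>auto intro: compact_Un\<close>)
        finally show "\<nu> K + \<nu> L \<le> inner V" .
      qed
      finally show "\<nu> K + outer (V - U) \<le> inner V" .
    qed
    finally show "outer (U \<inter> A) + outer ((UNIV - U) \<inter> A) \<le> inner V" .
  qed
  moreover have "outer A \<le> outer (U \<inter> A) + outer ((UNIV - U) \<inter> A)" for A
    using outer_Un[of "U \<inter> A" "(UNIV - U) \<inter> A"] by (simp add: Int_Un_distrib2[symmetric])
  ultimately show ?thesis by (auto simp: lambda_system_def intro: antisym)
qed

definition haar :: "'g measure" where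
  "haar = measure_of UNIV (sets borel) outer"

lemma sets_haar [measurable_cong, simp]: "sets haar = sets borel"
  unfolding haar_def using sets.space_closed[of "borel :: 'g measure"] sets.sigma_sets_eq[of "borel :: 'g measure"]
  by (simp add: sets_measure_of_conv)

lemma space_haar [simp]: "space haar = UNIV"
  unfolding haar_def by (simp add: space_measure_of_conv)

lemma emeasure_haar: "A \<in> sets borel \<Longrightarrow> emeasure haar A = outer A"
proof -
  assume A: "A \<in> sets borel"
  let ?L = "lambda_system UNIV UNIV outer"
  interpret P: sigma_algebra UNIV "UNIV :: 'g set set" using sigma_algebra_Pow[of UNIV] by simp
  have "outer_measure_space UNIV outer"
    unfolding outer_measure_space_def positive_def increasing_def countably_subadditive_def
    using outer_empty outer_mono outer_UN by blast
  then have L: "measure_space UNIV ?L outer" by (rule P.caratheodory_lemma)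
  then interpret L: sigma_algebra UNIV ?L by (simp add: measure_space_def)
  have "sets borel \<subseteq> ?L"
  proof -
    have "sigma_sets UNIV {S. open S} \<subseteq> ?L"
      by (rule L.sigma_sets_subset) (use open_in_lambda_system in auto)
    then show ?thesis by (simp add: borel_def)
  qed
  then have "countably_additive (sets borel) outer"
    using L unfolding measure_space_def countably_additive_def by blast
  moreover have "positive (sets borel) outer" by (simp add: positive_def outer_empty)
  moreover have "sigma_algebra UNIV (sets (borel :: 'g measure))"
    using sets.sigma_algebra_axioms[of "borel :: 'g measure"] by simp
  ultimately show ?thesis
    unfolding haar_def using A by (intro emeasure_measure_of_sigma) auto
qed

lemma haar_properties:
  "\<forall>A\<in>sets borel. \<forall>c. emeasure haar ((\<lambda>x. x + c) -` A) = emeasure haar A"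
  "open U \<Longrightarrow> U \<noteq> {} \<Longrightarrow> 0 < emeasure haar U"
  "compact K \<Longrightarrow> emeasure haar K < \<infinity>"
  "A \<in> sets borel \<Longrightarrow> emeasure haar A < \<infinity> \<Longrightarrow> 0 < e \<Longrightarrow>
     \<exists>U. open U \<and> A \<subseteq> U \<and> emeasure haar (U - A) < ennreal e"
proof -
  show "\<forall>A\<in>sets borel. \<forall>c. emeasure haar ((\<lambda>x. x + c) -` A) = emeasure haar A"
  proof (intro ballI allI)
    fix A :: "'g set" and c assume A: "A \<in> sets borel"
    have "(\<lambda>x. x + c) -` A = (\<lambda>x. x + c) -` A \<inter> space borel" by simp
    also have "\<dots> \<in> sets borel" by (rule measurable_sets[OF _ A]) simp
    finally have "emeasure haar ((\<lambda>x. x + c) -` A) = outer ((\<lambda>x. x + - c) ` A)"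
      using translate_eq_vimage[of "- c" A] by (simp add: emeasure_haar)
    also have "\<dots> = emeasure haar A" using A by (simp add: emeasure_haar outer_translate del: add_uminus_conv_diff)
    finally show "emeasure haar ((\<lambda>x. x + c) -` A) = emeasure haar A" .
  qed
next
  assume U: "open U" "U \<noteq> {}"
  then obtain u where u: "u \<in> U" by blast
  obtain K0 U0 where K0: "open U0" "compact K0" "(0::'g) \<in> U0" "U0 \<subseteq> K0" using ex_compact_nbhd by blast
  let ?K = "(\<lambda>x. x + u) ` K0" and ?U = "(\<lambda>x. x + u) ` U0"
  have "u \<in> U \<inter> ?U" using K0(3) u by force
  moreover have "open (U \<inter> ?U)" using U K0 open_translate by blast
  ultimately obtain r where r: "r > 0" "mball u r \<subseteq> U \<inter> ?U" using mball_in_open by blast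
  let ?C = "?K \<inter> {y. d u y \<le> r / 2}"
  have "closed {y. d u y \<le> r / 2}"
  proof -
    have "mcball u (r/2) = {y. d u y \<le> r / 2}" by (auto simp: mcball_def)
    then show ?thesis using closedin_mcball[of u "r/2"] unfolding mtopology_eq by simp
  qed
  then have C: "compact ?C" using K0(2) by (intro compact_Int_closed compact_translate)
  have CU: "?C \<subseteq> U" using r by (auto simp: subset_eq)
  have "mball u (r / 2) \<subseteq> mball u r" by (rule mball_subset_concentric) (use r in simp)
  then have "mball u (r / 2) \<subseteq> ?K" using r(2) K0(4) by blast
  then have "mball u (r / 2) \<subseteq> ?C" by auto
  have "u \<in> mball u (r / 2)" using r(1) by simp
  then have "mball u (r / 2) \<noteq> {}" by blast
  then have "0 < \<nu> ?C" using \<open>mball u (r / 2) \<subseteq> ?C\<close> by (rule content_pos[OF C open_mball])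
  then have "0 < inner U" using inner_ge[OF C CU] by (metis order_less_le_trans)
  then show "0 < emeasure haar U" using U by (simp add: emeasure_haar outer_open)
next
  assume K: "compact K"
  obtain K0 U0 where K0: "open U0" "compact K0" "(0::'g) \<in> U0" "U0 \<subseteq> K0" using ex_compact_nbhd by blast
  obtain C where C: "finite C" "K \<subseteq> (\<Union>c\<in>C. (\<lambda>x. x + c) ` U0)"
    using finite_translates_cover[OF K K0(1,3)] by blast
  let ?V = "\<Union>c\<in>C. (\<lambda>x. x + c) ` U0" and ?L = "\<Union>c\<in>C. (\<lambda>x. x + c) ` K0"
  have V: "open ?V" using K0(1) by (intro open_UN ballI open_translate)
  have L: "compact ?L" using K0(2) C(1) by (intro compact_UN compact_translate) 
  have VL: "?V \<subseteq> ?L" using K0(4) by blast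
  have "outer K \<le> inner ?V" by (rule outer_le[OF V C(2)])
  also have "\<dots> \<le> \<nu> ?L"
    by (rule inner_le, rule content_mono) (erule subset_trans[OF _ VL])
  also have "\<dots> < \<infinity>" by (rule content_finite[OF L])
  finally show "emeasure haar K < \<infinity>" using K by (simp add: emeasure_haar compact_imp_closed)
next
  assume A: "A \<in> sets borel" "emeasure haar A < \<infinity>" "0 < e"
  then have "outer A < emeasure haar A + ennreal e"
    by (auto simp: emeasure_haar less_top)
  then obtain U where U: "open U" "A \<subseteq> U" "inner U < emeasure haar A + ennreal e"
    using outer_approx by blast
  have "emeasure haar (U - A) = emeasure haar U - emeasure haar A"
    by (rule emeasure_Diff) (use A U in auto)
  also have "\<dots> < ennreal e"
  proof -
    obtain a where a: "emeasure haar A = ennreal a" "0 \<le> a"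
      using A(2) by (cases "emeasure haar A") auto
    have "inner U < ennreal (a + e)" using U(3) a A(3) by simp
    then obtain u where u: "inner U = ennreal u" "0 \<le> u" by (cases "inner U") auto
    have "u < a + e" using \<open>inner U < ennreal (a + e)\<close> u by (simp add: ennreal_less_iff)
    then show ?thesis using U(1) a u A(3)
      by (simp add: emeasure_haar outer_open ennreal_minus ennreal_lessI)
  qed
  finally show "\<exists>U. open U \<and> A \<subseteq> U \<and> emeasure haar (U - A) < ennreal e" using U by blast
qed

end

section \<open>Continuity of translation\<close>

lemma tendsto_0_ennrealI:
  assumes "\<And>e::real. 0 < e \<Longrightarrow> eventually (\<lambda>n. f n < ennreal e) F"
  shows "(f \<longlongrightarrow> (0::ennreal)) F"
proof (rule order_tendstoI)
  fix y :: ennreal assume "0 < y"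
  then obtain z where z: "0 < z" "z < y" using dense by blast
  then obtain e where e: "z = ennreal e" "0 \<le> e" by (cases z) auto
  then have "0 < e" using z by (simp add: ennreal_less_zero_iff)
  then show "eventually (\<lambda>n. f n < y) F"
    using assms[of e] z e by (auto elim!: eventually_mono)
qed auto

text \<open>The radius \<open>r0\<close> is recorded because continuity of translation is used on the ball of radius \<open>r0\<close> and needs room around it.\<close>

locale haar_group = lc_group_metric d
  for d :: "'g::{topological_group_add, polish_space} \<Rightarrow> 'g \<Rightarrow> real" +
  fixes hm :: "'g measure" and r0 :: real
  assumes sets_hm [measurable_cong, simp]: "sets hm = sets borel"
    and hm_translate: "A \<in> sets borel \<Longrightarrow> emeasure hm ((\<lambda>x. x + c) -` A) = emeasure hm A"
    and hm_open_pos: "open U \<Longrightarrow> U \<noteq> {} \<Longrightarrow> 0 < emeasure hm U"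
    and r0_pos: "0 < r0"
    and hm_ball: "emeasure hm (mball 0 (2 * r0)) < \<infinity>"
    and hm_outer_regular: "A \<in> sets borel \<Longrightarrow> emeasure hm A < \<infinity> \<Longrightarrow> 0 < e \<Longrightarrow>
      \<exists>U. open U \<and> A \<subseteq> U \<and> emeasure hm (U - A) < ennreal e"
    and sigma_finite_hm: "sigma_finite_measure hm"

text \<open>Countably many translates of a ball of finite measure cover the group, whence \<open>\<sigma>\<close>-finiteness.\<close>

lemma (in lc_group_metric) ex_haar_group: "\<exists>hm r0. haar_group d hm r0"
proof -
  obtain \<nu> :: "'g set \<Rightarrow> ennreal" where *:
      "\<forall>A B. A \<subseteq> B \<longrightarrow> \<nu> A \<le> \<nu> B" "\<forall>A B. \<nu> (A \<union> B) \<le> \<nu> A + \<nu> B"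
      "\<forall>A c. \<nu> ((\<lambda>x. x + c) ` A) = \<nu> A"
      "\<forall>A B. compact A \<longrightarrow> compact B \<longrightarrow> A \<inter> B = {} \<longrightarrow> \<nu> A + \<nu> B \<le> \<nu> (A \<union> B)"
      "\<forall>K. compact K \<longrightarrow> \<nu> K < \<infinity>"
      "\<forall>K U. compact K \<longrightarrow> open U \<longrightarrow> U \<noteq> {} \<longrightarrow> U \<subseteq> K \<longrightarrow> 0 < \<nu> K"
    using ex_invariant_content by (elim exE conjE)
  interpret invariant_content d \<nu>
  proof
    show "0 < \<nu> K" if "compact K" "open U" "U \<noteq> {}" "U \<subseteq> K" for K U
      using *(6)[rule_format, OF that] .
  qed (use * in simp_all)
  obtain K U where K: "open U" "compact K" "(0::'g) \<in> U" "U \<subseteq> K" using ex_compact_nbhd by blast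
  obtain r where r: "r > 0" "mball 0 r \<subseteq> U" using mball_in_open[OF K(1,3)] by blast
  have fin: "emeasure haar (mball 0 r) < \<infinity>"
  proof -
    have "emeasure haar (mball 0 r) \<le> emeasure haar K"
      by (rule emeasure_mono) (use r K in \<open>auto intro: borel_closed compact_imp_closed\<close>)
    also have "\<dots> < \<infinity>" by (rule haar_properties(3)[OF K(2)])
    finally show ?thesis .
  qed
  have sf: "sigma_finite_measure haar"
  proof
    obtain D :: "'g set" where D: "countable D" "\<And>X. open X \<Longrightarrow> X \<noteq> {} \<Longrightarrow> \<exists>d\<in>D. d \<in> X"
      using countable_dense_setE by blast
    have ball: "emeasure haar (mball q r) = emeasure haar (mball 0 r)" for q
    proof -
      have "(\<lambda>x. x + - q) -` mball 0 r = mball q r"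
        using translate_eq_vimage[of q "mball 0 r"] mball_translate[of q 0 r] by simp
      then show ?thesis
        using haar_properties(1) open_mball[of 0 r] by (metis borel_open)
    qed
    have fin': "emeasure haar (mball q r) \<noteq> \<infinity>" for q using fin unfolding ball[of q] by simp
    have "(\<Union>q\<in>D. mball q r) = UNIV"
    proof (rule UNIV_eq_I[symmetric])
      fix x
      have "x \<in> mball x r" using r by simp
      then obtain q where "q \<in> D" "q \<in> mball x r" using D(2)[OF open_mball] by blast
      then show "x \<in> (\<Union>q\<in>D. mball q r)" by (auto simp: commute)
    qed
    then show "\<exists>A. countable A \<and> A \<subseteq> sets haar \<and> \<Union> A = space haar \<and> (\<forall>a\<in>A. emeasure haar a \<noteq> \<infinity>)"
      using D(1) fin' open_mball
      by (intro exI[of _ "(\<lambda>q. mball q r) ` D"]) (auto simp: less_top)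
  qed
  have "haar_group d haar (r / 2)"
  proof (intro haar_group.intro haar_group_axioms.intro)
    show "lc_group_metric d" by (rule lc_group_metric_axioms)
    show "sets haar = sets borel" by simp
    show "emeasure haar ((\<lambda>x. x + c) -` A) = emeasure haar A" if "A \<in> sets borel" for A c
      using haar_properties(1) that by blast
    show "0 < emeasure haar U" if "open U" "U \<noteq> {}" for U
      using haar_properties(2) that by blast
    show "0 < r / 2" using r(1) by simp
    show "emeasure haar (mball 0 (2 * (r / 2))) < \<infinity>" using fin by simp
    show "\<exists>U. open U \<and> A \<subseteq> U \<and> emeasure haar (U - A) < ennreal e"
      if "A \<in> sets borel" "emeasure haar A < \<infinity>" "0 < e" for A e
      using haar_properties(4) that by blast
    show "sigma_finite_measure haar" by (rule sf)
  qed
  then show ?thesis by blast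
qed

context haar_group
begin

lemma space_hm [simp]: "space hm = UNIV"
  using sets_eq_imp_space_eq[OF sets_hm] by simp

abbreviation "U0 \<equiv> mball 0 r0"

lemma translate_vimage_borel [measurable]: "A \<in> sets borel \<Longrightarrow> {h. h + g \<in> A} \<in> sets borel" for g :: 'g
proof -
  assume A: "A \<in> sets borel"
  have "(\<lambda>h. h + g) -` A \<inter> space borel \<in> sets borel" by (rule measurable_sets[OF _ A]) simp
  then show ?thesis by (simp add: vimage_def)
qed

lemma hm_translate_Collect: "A \<in> sets borel \<Longrightarrow> emeasure hm {h. h + g \<in> A} = emeasure hm A"
  using hm_translate[of A g] by (simp add: vimage_def)

lemma borel_mball [measurable]: "mball x r \<in> sets borel"
  by (intro borel_open open_mball)

lemma hm_U0: "0 < emeasure hm U0" "emeasure hm U0 < \<infinity>"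
proof -
  show "0 < emeasure hm U0" using r0_pos by (intro hm_open_pos open_mball) (auto intro!: exI[of _ 0])
  have "emeasure hm U0 \<le> emeasure hm (mball 0 (2 * r0))"
    by (intro emeasure_mono mball_subset_concentric) (use r0_pos in auto)
  then show "emeasure hm U0 < \<infinity>" using hm_ball by (rule order.strict_trans1)
qed

text \<open>For an open set, \<open>h \<in> O'\<close> implies that \<open>h + g n \<in> O'\<close> eventually, so the points that leave \<open>O'\<close> have small measure by
dominated convergence. As translation preserves the measure of \<open>O'\<close>, as much enters \<open>O'\<close> as leaves it.\<close>

lemma translation_continuity_open:
  fixes g :: "nat \<Rightarrow> 'g"
  assumes O: "open O'" and fin: "emeasure hm O' < \<infinity>" and g: "g \<longlonglongrightarrow> 0"
  shows "(\<lambda>n. emeasure hm {h. (h + g n \<in> O') \<noteq> (h \<in> O')}) \<longlonglongrightarrow> 0"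
proof -
  let ?E = "\<lambda>n. {h. h \<in> O' \<and> \<not> h + g n \<in> O'}"
  have O_b [measurable]: "O' \<in> sets borel" using O by simp
  have E [measurable]: "?E n \<in> sets borel" for n by measurable
  have "(\<lambda>n. \<integral>\<^sup>+h. indicator (?E n) h \<partial>hm) \<longlonglongrightarrow> (\<integral>\<^sup>+h. 0 \<partial>hm)"
  proof (rule nn_integral_dominated_convergence[where w = "indicator O'"])
    show "AE h in hm. (\<lambda>n. indicator (?E n) h) \<longlonglongrightarrow> (0::ennreal)"
    proof (rule AE_I2)
      fix h
      have "eventually (\<lambda>n. h \<in> O' \<longrightarrow> h + g n \<in> O') sequentially"
      proof (cases "h \<in> O'")
        case True
        have "(\<lambda>n. h + g n) \<longlonglongrightarrow> h + 0" by (intro tendsto_intros g)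
        then have "eventually (\<lambda>n. h + g n \<in> O') sequentially"
          using O True by (intro topological_tendstoD[of _ "h + 0"]) auto
        then show ?thesis by (rule eventually_mono) simp
      qed simp
      then have "eventually (\<lambda>n. indicator (?E n) h = (0::ennreal)) sequentially"
        by (rule eventually_mono) simp
      then show "(\<lambda>n. indicator (?E n) h) \<longlonglongrightarrow> (0::ennreal)" by (rule tendsto_eventually)
    qed
    show "(\<integral>\<^sup>+h. indicator O' h \<partial>hm) < \<infinity>" using fin by simp
  qed (auto simp: indicator_def)
  then have lim: "(\<lambda>n. emeasure hm (?E n)) \<longlonglongrightarrow> 0" by simp
  have "emeasure hm {h. (h + g n \<in> O') \<noteq> (h \<in> O')} = emeasure hm (?E n) + emeasure hm (?E n)" for n
  proof -
    let ?O = "{h. h + g n \<in> O'}"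
    have "emeasure hm (O' \<inter> ?O) \<le> emeasure hm O'" by (rule emeasure_mono) auto
    then have finI: "emeasure hm (O' \<inter> ?O) \<noteq> \<infinity>" using fin by (auto simp: top_unique)
    have "{h. (h + g n \<in> O') \<noteq> (h \<in> O')} = (O' - ?O) \<union> (?O - O')" by auto
    also have "emeasure hm \<dots> = emeasure hm (O' - ?O) + emeasure hm (?O - O')"
      by (rule plus_emeasure[symmetric]) auto
    also have "emeasure hm (?O - O') = emeasure hm ?O - emeasure hm (O' \<inter> ?O)"
      using emeasure_Diff[of hm "O' \<inter> ?O" ?O] finI by (simp add: Diff_Int)
    also have "\<dots> = emeasure hm O' - emeasure hm (O' \<inter> ?O)" by (simp add: hm_translate_Collect)
    also have "\<dots> = emeasure hm (O' - ?O)"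
      using emeasure_Diff[of hm "O' \<inter> ?O" O'] finI by (simp add: Diff_Int)
    also have "O' - ?O = ?E n" by auto
    finally show ?thesis .
  qed
  then show ?thesis using tendsto_add[OF lim lim] by simp
qed

text \<open>Outer regularity reduces a Borel set to an open one.\<close>

lemma translation_continuity:
  fixes g :: "nat \<Rightarrow> 'g"
  assumes B: "B \<in> sets borel" and fin: "emeasure hm B < \<infinity>" and g: "g \<longlonglongrightarrow> 0"
  shows "(\<lambda>n. emeasure hm {h. (h + g n \<in> B) \<noteq> (h \<in> B)}) \<longlonglongrightarrow> 0"
proof (rule tendsto_0_ennrealI)
  fix e :: real assume e: "0 < e"
  obtain V where V: "open V" "B \<subseteq> V" "emeasure hm (V - B) < ennreal (e / 3)"
    using hm_outer_regular[OF B fin, of "e / 3"] e by auto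
  have [measurable]: "V \<in> sets borel" "B \<in> sets borel" using V B by auto
  have "emeasure hm V = emeasure hm B + emeasure hm (V - B)"
    using V B by (subst plus_emeasure) (auto intro!: arg_cong[where f = "emeasure hm"])
  also have "\<dots> < \<infinity>" using fin order.strict_trans[OF V(3) ennreal_less_top] by (simp add: ennreal_add_less_top)
  finally have "(\<lambda>n. emeasure hm {h. (h + g n \<in> V) \<noteq> (h \<in> V)}) \<longlonglongrightarrow> 0"
    by (rule translation_continuity_open[OF V(1) _ g])
  moreover have "0 < ennreal (e / 3)" using e by simp
  ultimately have "eventually (\<lambda>n. emeasure hm {h. (h + g n \<in> V) \<noteq> (h \<in> V)} < ennreal (e / 3)) sequentially"
    by (rule order_tendstoD)
  then show "eventually (\<lambda>n. emeasure hm {h. (h + g n \<in> B) \<noteq> (h \<in> B)} < ennreal e) sequentially"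
  proof eventually_elim
    case (elim n)
    let ?V = "{h. (h + g n \<in> V) \<noteq> (h \<in> V)}" and ?W = "{h. h + g n \<in> V - B}"
    have "emeasure hm {h. (h + g n \<in> B) \<noteq> (h \<in> B)} \<le> emeasure hm (?V \<union> (V - B) \<union> ?W)"
      by (rule emeasure_mono) (use V(2) in auto)
    also have "\<dots> \<le> emeasure hm ?V + emeasure hm (V - B) + emeasure hm ?W"
      by (intro order_trans[OF emeasure_subadditive] add_mono) auto
    also have "emeasure hm ?W = emeasure hm (V - B)" by (rule hm_translate_Collect) simp
    also have "emeasure hm ?V + emeasure hm (V - B) + emeasure hm (V - B)
        < ennreal (e / 3) + ennreal (e / 3) + ennreal (e / 3)"
      using elim V(3) by (intro add_strict_mono)
    also have "\<dots> = ennreal e" using e by (simp add: ennreal_plus[symmetric] del: ennreal_plus)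
    finally show ?case .
  qed
qed

text \<open>A set of infinite measure is cut down to the ball of radius \<open>2 * r0\<close>, which contains \<open>h + g n - g'\<close> for all
\<open>h \<in> U0\<close> as soon as \<open>g n\<close> is close to \<open>g'\<close>.\<close>

lemma local_translation_continuity:
  fixes g :: "nat \<Rightarrow> 'g"
  assumes B [measurable]: "B \<in> sets borel" and g: "g \<longlonglongrightarrow> g'"
  shows "(\<lambda>n. emeasure hm {h\<in>U0. (h + g n \<in> B) \<noteq> (h + g' \<in> B)}) \<longlonglongrightarrow> 0"
proof -
  \<comment> \<open>Shift by \<open>g'\<close> to reduce to convergence to 0, and cut down to finite measure.\<close>
  define B1 where "B1 = mball 0 (2 * r0) \<inter> {h. h + g' \<in> B}"
  have B1 [measurable]: "B1 \<in> sets borel" unfolding B1_def by measurable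
  have "emeasure hm B1 \<le> emeasure hm (mball 0 (2 * r0))"
    unfolding B1_def by (rule emeasure_mono) auto
  then have fin: "emeasure hm B1 < \<infinity>" using hm_ball by (rule order.strict_trans1)
  have c: "(\<lambda>n. g n + - g') \<longlonglongrightarrow> 0"
    using tendsto_add[OF g tendsto_const[of "- g'"]] by simp
  have "eventually (\<lambda>n. g n + - g' \<in> U0) sequentially"
    using topological_tendstoD[OF c open_mball] r0_pos by simp
  then have ev: "eventually (\<lambda>n. emeasure hm {h\<in>U0. (h + g n \<in> B) \<noteq> (h + g' \<in> B)}
      \<le> emeasure hm {h. (h + (g n + - g') \<in> B1) \<noteq> (h \<in> B1)}) sequentially"
  proof eventually_elim
    case (elim n)
    show ?case
    proof (rule emeasure_mono)
      show "{h\<in>U0. (h + g n \<in> B) \<noteq> (h + g' \<in> B)} \<subseteq> {h. (h + (g n + - g') \<in> B1) \<noteq> (h \<in> B1)}"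
      proof
        fix h assume "h \<in> {h\<in>U0. (h + g n \<in> B) \<noteq> (h + g' \<in> B)}"
        then have h: "h \<in> U0" and ne: "(h + g n \<in> B) \<noteq> (h + g' \<in> B)" by simp_all
        let ?c = "g n + - g'"
        have "d 0 (h + ?c) \<le> d 0 ?c + d ?c (h + ?c)" by (rule triangle) auto
        moreover have "d ?c (h + ?c) = d 0 h" using right_inv[of 0 ?c h] by simp
        ultimately have "h + ?c \<in> mball 0 (2 * r0)" using h elim by simp
        moreover have "h + ?c + g' = h + g n" by (simp add: add.assoc)
        moreover have "h \<in> mball 0 (2 * r0)" using h r0_pos by simp
        ultimately show "h \<in> {h. (h + (g n + - g') \<in> B1) \<noteq> (h \<in> B1)}"
          using ne unfolding B1_def by (simp del: in_mball)
      qed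
    qed measurable
  qed
  show ?thesis
    by (rule tendsto_sandwich[OF _ ev tendsto_const translation_continuity[OF B1 fin c]]) simp
qed

end

section \<open>Continuity of the action in measure\<close>

locale haar_action = haar_group d hm r0 + prob_space M
  for d :: "'g::{topological_group_add, polish_space} \<Rightarrow> 'g \<Rightarrow> real" and hm r0
    and M :: "'x measure" +
  fixes act :: "'g \<Rightarrow> 'x \<Rightarrow> 'x"
  assumes borel: "standard_borel M" and action: "mp_action M act"
begin

lemma act_measurable_pair: "(\<lambda>(g, x). act g x) \<in> measurable (borel \<Otimes>\<^sub>M M) M"
  using action by (simp add: mp_action_def)

lemma act_measurable [measurable (raw)]:
  assumes "f \<in> borel_measurable N" "u \<in> measurable N M"
  shows "(\<lambda>x. act (f x) (u x)) \<in> measurable N M"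
proof -
  have "(\<lambda>x. (f x, u x)) \<in> measurable N (borel \<Otimes>\<^sub>M M)" using assms by simp
  from measurable_compose[OF this act_measurable_pair] show ?thesis by simp
qed

lemma uminus_measurable [measurable (raw)]:
  "f \<in> borel_measurable N \<Longrightarrow> (\<lambda>x. - f x) \<in> borel_measurable N" for f :: "'n \<Rightarrow> 'g"
  by (rule borel_measurable_continuous_on[OF continuous_on_minus[OF continuous_on_id]])

lemma d_measurable [measurable (raw)]:
  assumes "f \<in> borel_measurable N" "u \<in> borel_measurable N"
  shows "(\<lambda>x. d (f x) (u x)) \<in> borel_measurable N"
  by (rule borel_measurable_continuous_Pair[OF assms
      continuous_on_compatible_metric[OF Metric_space_axioms mtopology_eq]])

lemma act_space: "x \<in> space M \<Longrightarrow> act g x \<in> space M"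
  using measurable_space[OF act_measurable_pair, of "(g, x)"] by (simp add: space_pair_measure)

lemma act_0 [simp]: "x \<in> space M \<Longrightarrow> act 0 x = x"
  using action by (simp add: mp_action_def)

lemma act_add: "x \<in> space M \<Longrightarrow> act (g + h) x = act g (act h x)"
  using action by (simp add: mp_action_def)

lemma act_minus_act [simp]: "x \<in> space M \<Longrightarrow> act (- g) (act g x) = x"
  using act_add[of x "- g" g] by simp

lemma act_act_minus [simp]: "x \<in> space M \<Longrightarrow> act g (act (- g) x) = x"
  using act_add[of x g "- g"] by simp

lemma inj_act: "inj_on (act g) (space M)"
  by (rule inj_on_inverseI[of _ "act (- g)"]) simp

lemma act_image_eq: "B \<in> sets M \<Longrightarrow> act g ` B = {x \<in> space M. act (- g) x \<in> B}"
proof safe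
  fix x assume x: "x \<in> space M" "act (- g) x \<in> B"
  then have "x = act g (act (- g) x)" by simp
  then show "x \<in> act g ` B" using x by blast
qed (auto dest!: sets.sets_into_space intro: act_space)

lemma act_image_sets [measurable]: "B \<in> sets M \<Longrightarrow> act g ` B \<in> sets M"
  by (simp add: act_image_eq)

lemma emeasure_act_image: "B \<in> sets M \<Longrightarrow> emeasure M (act g ` B) = emeasure M B"
  using action by (simp add: mp_action_def)

lemma emeasure_act_vimage: "B \<in> sets M \<Longrightarrow> emeasure M {x \<in> space M. act g x \<in> B} = emeasure M B"
  using act_image_eq[of B "- g"] emeasure_act_image[of B "- g"] by simp

text \<open>Let \<open>E n\<close> be the set of points at which membership in \<open>A\<close> changes under \<open>g n\<close>. As the action preserves \<open>M\<close>, the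
measure of \<open>E n\<close> is the average over \<open>h \<in> U0\<close> of the measure of \<open>{x. act (- h) x \<in> E n}\<close>. By
Fubini this is an integral over \<open>x\<close> of the Haar measure of the set of \<open>h \<in> U0\<close> for which \<open>h\<close> and \<open>h - g n\<close> differ
with respect to \<open>{h. act (- h) x \<in> A}\<close>, and this tends to 0 for every \<open>x\<close>.\<close>

lemma act_continuous_at_0:
  fixes g :: "nat \<Rightarrow> 'g"
  assumes A [measurable]: "A \<in> sets M" and g: "g \<longlonglongrightarrow> 0"
  shows "(\<lambda>n. emeasure M {x \<in> space M. (act (g n) x \<in> A) \<noteq> (x \<in> A)}) \<longlonglongrightarrow> 0"
proof -
  interpret hm: sigma_finite_measure hm by (rule sigma_finite_hm)
  interpret P: pair_sigma_finite hm M ..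
  let ?E = "\<lambda>n. {x \<in> space M. (act (g n) x \<in> A) \<noteq> (x \<in> A)}"
  let ?c = "emeasure hm U0"
  have E [measurable]: "?E n \<in> sets M" for n by measurable
  let ?Q = "\<lambda>n. {p \<in> space (hm \<Otimes>\<^sub>M M). fst p \<in> U0 \<and> act (- fst p) (snd p) \<in> ?E n}"
  have Q [measurable]: "?Q n \<in> sets (hm \<Otimes>\<^sub>M M)" for n by measurable
  have "emeasure (hm \<Otimes>\<^sub>M M) (?Q n) = (\<integral>\<^sup>+h. emeasure M (Pair h -` ?Q n) \<partial>hm)" for n
    by (rule emeasure_pair_measure_alt) measurable
  also have "\<dots> n = (\<integral>\<^sup>+h. emeasure M (?E n) * indicator U0 h \<partial>hm)" for n
  proof (rule nn_integral_cong)
    fix h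
    have "Pair h -` ?Q n = (if h \<in> U0 then {x \<in> space M. act (- h) x \<in> ?E n} else {})"
      by (auto simp: space_pair_measure)
    then show "emeasure M (Pair h -` ?Q n) = emeasure M (?E n) * indicator U0 h"
      using emeasure_act_vimage[OF E, of "- h" n] by (simp del: in_mball)
  qed
  also have "\<dots> n = ?c * emeasure M (?E n)" for n by (subst nn_integral_cmult_indicator) (simp_all add: mult.commute)
  finally have 1: "emeasure (hm \<Otimes>\<^sub>M M) (?Q n) = ?c * emeasure M (?E n)" for n .
  have 2: "emeasure (hm \<Otimes>\<^sub>M M) (?Q n) = (\<integral>\<^sup>+x. emeasure hm ((\<lambda>h. (h, x)) -` ?Q n) \<partial>M)" for n
    by (rule P.emeasure_pair_measure_alt2) measurable
  have "(\<lambda>n. \<integral>\<^sup>+x. emeasure hm ((\<lambda>h. (h, x)) -` ?Q n) \<partial>M) \<longlonglongrightarrow> (\<integral>\<^sup>+x. 0 \<partial>M)"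
  proof (rule nn_integral_dominated_convergence[where w = "\<lambda>_. ?c"])
    show "(\<lambda>x. emeasure hm ((\<lambda>h. (h, x)) -` ?Q n)) \<in> borel_measurable M" for n
      by (rule P.measurable_emeasure_Pair2) measurable
    show "AE x in M. (\<lambda>n. emeasure hm ((\<lambda>h. (h, x)) -` ?Q n)) \<longlonglongrightarrow> 0"
    proof (rule AE_I2)
      fix x assume x: "x \<in> space M"
      let ?B = "{h. act (- h) x \<in> A}"
      have B: "?B \<in> sets borel" using x by measurable
      have "(\<lambda>h. (h, x)) -` ?Q n = {h\<in>U0. (h + - g n \<in> ?B) \<noteq> (h + 0 \<in> ?B)}" for n
      proof -
        have "act (- (h + - g n)) x = act (g n) (act (- h) x)" for h
          using act_add[OF x, of "g n" "- h"] by (simp add: minus_add)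
        then show ?thesis using x by (auto simp: space_pair_measure act_space)
      qed
      moreover have "(\<lambda>n. - g n) \<longlonglongrightarrow> 0" using tendsto_minus[OF g] by simp
      ultimately show "(\<lambda>n. emeasure hm ((\<lambda>h. (h, x)) -` ?Q n)) \<longlonglongrightarrow> 0"
        using local_translation_continuity[OF B, of "\<lambda>n. - g n" 0] by simp
    qed
    show "AE x in M. emeasure hm ((\<lambda>h. (h, x)) -` ?Q n) \<le> ?c" for n
      by (intro AE_I2 emeasure_mono) auto
    show "(\<integral>\<^sup>+x. ?c \<partial>M) < \<infinity>" using hm_U0(2) by (simp add: emeasure_space_1)
  qed simp_all
  then have "(\<lambda>n. ?c * emeasure M (?E n)) \<longlonglongrightarrow> 0" using 1 2 by simp
  then have "(\<lambda>n. inverse ?c * (?c * emeasure M (?E n))) \<longlonglongrightarrow> inverse ?c * 0"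
    by (rule ennreal_tendsto_cmult[rotated]) (use hm_U0(1) in \<open>simp add: less_top[symmetric]\<close>)
  moreover have "inverse ?c * ?c = 1"
    using hm_U0 by (metis divide_ennreal_def ennreal_divide_self infinity_ennreal_def less_irrefl mult.commute)
  ultimately show ?thesis by (simp add: mult.assoc[symmetric])
qed

lemma act_continuous:
  fixes g :: "nat \<Rightarrow> 'g"
  assumes A [measurable]: "A \<in> sets M" and g: "g \<longlonglongrightarrow> g'"
  shows "(\<lambda>n. emeasure M {x \<in> space M. (act (g n) x \<in> A) \<noteq> (act g' x \<in> A)}) \<longlonglongrightarrow> 0"
proof -
  have "(\<lambda>n. g n + - g') \<longlonglongrightarrow> 0"
    using tendsto_add[OF g tendsto_const[of "- g'"]] by simp
  note lim = act_continuous_at_0[OF A this]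
  have "emeasure M {x \<in> space M. (act (g n) x \<in> A) \<noteq> (act g' x \<in> A)} =
      emeasure M {x \<in> space M. (act (g n + - g') x \<in> A) \<noteq> (x \<in> A)}" (is "_ = emeasure M ?E") for n
  proof -
    have E: "{x \<in> space M. (act (g n + - g') x \<in> A) \<noteq> (x \<in> A)} \<in> sets M" by measurable
    have "act (g n + - g') (act g' x) = act (g n) x" if "x \<in> space M" for x
      using that act_add[OF act_space[OF that], of "g n" "- g'" g'] by simp
    then have "{x \<in> space M. (act (g n) x \<in> A) \<noteq> (act g' x \<in> A)} =
        {x \<in> space M. act g' x \<in> {x \<in> space M. (act (g n + - g') x \<in> A) \<noteq> (x \<in> A)}}"
      by (auto simp: act_space)
    then show ?thesis using emeasure_act_vimage[OF E, of g'] by simp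
  qed
  then show ?thesis using lim by simp
qed

end

section \<open>Measurable selections\<close>

text \<open>The selection theorem of Kuratowski and Ryll-Nardzewski. Intersect \<open>P x\<close> successively with closed balls of radius
\<open>(1/2) ^ n\<close> around points of a fixed dense sequence, each time taking the first ball that leaves something over. The
centres depend measurably on \<open>x\<close> and converge to a point of \<open>P x\<close>.\<close>

lemma measurable_selection:
  fixes P :: "'x \<Rightarrow> 'g::polish_space set"
  assumes closed: "\<And>x. x \<in> space M \<Longrightarrow> closed (P x)" and ne: "\<And>x. x \<in> space M \<Longrightarrow> P x \<noteq> {}"
    and hit: "\<And>Q. closed Q \<Longrightarrow> {x \<in> space M. P x \<inter> Q \<noteq> {}} \<in> sets M"
  shows "\<exists>f \<in> borel_measurable M. \<forall>x\<in>space M. f x \<in> P x"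
proof -
  obtain D :: "'g set" where D: "countable D" "\<And>X. open X \<Longrightarrow> X \<noteq> {} \<Longrightarrow> \<exists>d\<in>D. d \<in> X"
    using countable_dense_setE by blast
  have "D \<noteq> {}" using D(2)[of UNIV] by auto
  define a where "a = from_nat_into D"
  have dense: "\<exists>m. dist (a m) y < e" if "0 < e" for y e
  proof -
    obtain q where "q \<in> D" "q \<in> ball y e" using D(2)[of "ball y e"] \<open>0 < e\<close> by auto
    then show ?thesis using from_nat_into_surj[OF D(1)] unfolding a_def by (metis dist_commute mem_ball)
  qed
  define B where "B n m = cball (a m) ((1/2) ^ n)" for n m
  \<comment> \<open>\<open>K n x\<close> is the intersection of the balls chosen before stage \<open>n\<close>, and \<open>m n x\<close> the index chosen at stage \<open>n\<close>.\<close>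
  define K where "K = rec_nat (\<lambda>_. UNIV) (\<lambda>n L x. L x \<inter> B n (LEAST m. P x \<inter> (L x \<inter> B n m) \<noteq> {}))"
  define m where "m n x = (LEAST m. P x \<inter> (K n x \<inter> B n m) \<noteq> {})" for n x
  have K0: "K 0 x = UNIV" and KS: "K (Suc n) x = K n x \<inter> B n (m n x)" for n x
    by (simp_all add: K_def m_def)
  have closed_K: "closed (K n x)" for n x
    by (induction n) (simp_all add: K0 KS B_def closed_Int)
  have ne_K: "P x \<inter> K n x \<noteq> {}" if x: "x \<in> space M" for n x
  proof (induction n)
    case 0
    then show ?case using ne[OF x] by (simp add: K0)
  next
    case (Suc n)
    then obtain y where y: "y \<in> P x" "y \<in> K n x" by blast
    obtain k where "dist (a k) y < (1/2) ^ n" using dense[of "(1/2) ^ n" y] by auto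
    then have "P x \<inter> (K n x \<inter> B n k) \<noteq> {}" using y by (auto simp: B_def)
    then have "P x \<inter> (K n x \<inter> B n (m n x)) \<noteq> {}"
      unfolding m_def by (rule LeastI)
    then show ?case by (simp add: KS)
  qed
  have hit_K: "{x \<in> space M. P x \<inter> (K n x \<inter> Q) \<noteq> {}} \<in> sets M" if "closed Q" for n Q
    using that
  proof (induction n arbitrary: Q)
    case 0
    then show ?case using hit[of Q] by (simp add: K0)
  next
    case (Suc n)
    have meas: "Measurable.pred M (\<lambda>x. P x \<inter> (K n x \<inter> Q') \<noteq> {})" if "closed Q'" for Q'
      using Suc.IH[OF that] by (simp add: pred_def)
    have [measurable]: "m n \<in> measurable M (count_space UNIV)"
      unfolding m_def by (intro measurable_Least meas) (simp add: B_def)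
    have "Measurable.pred M (\<lambda>x. \<exists>k. m n x = k \<and> P x \<inter> (K n x \<inter> (B n k \<inter> Q)) \<noteq> {})"
      by (intro pred_intros_countable pred_intros_logic meas closed_Int)
        (simp_all add: B_def Suc.prems)
    then show ?case by (simp add: pred_def KS Int_assoc)
  qed
  have m_meas [measurable]: "m n \<in> measurable M (count_space UNIV)" for n
    unfolding m_def by (intro measurable_Least) (use hit_K in \<open>simp add: pred_def B_def\<close>)
  have "\<exists>l. l \<in> P x \<and> (\<lambda>n. a (m n x)) \<longlonglongrightarrow> l" if x: "x \<in> space M" for x
  proof -
    have "\<forall>n. \<exists>y. y \<in> P x \<inter> K (Suc n) x" using ne_K[OF x] by blast
    then obtain y where y: "\<And>n. y n \<in> P x" "\<And>n. y n \<in> K (Suc n) x" by (metis IntD1 IntD2)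
    have dec: "K (n + k) x \<subseteq> K n x" for n k by (induction k) (auto simp: KS)
    have close: "dist (a (m n x)) (y (n + k)) \<le> (1/2) ^ n" for n k
      using y(2)[of "n + k"] dec[of "Suc n" k] by (auto simp: KS B_def)
    have "dist (y n) (y (n + k)) \<le> 2 * (1/2) ^ n" for n k
      using close[of n 0] close[of n k] dist_triangle[of "y n" "y (n + k)" "a (m n x)"]
      by (simp add: dist_commute)
    then have dy: "dist (y n) (y k) \<le> 2 * (1/2) ^ n" if "n \<le> k" for n k
      using that le_Suc_ex by blast
    have lim0: "(\<lambda>n. 2 * (1/2) ^ n :: real) \<longlonglongrightarrow> 0"
      using tendsto_mult_right_zero[OF LIMSEQ_power_zero[of "1/2 :: real"]] by simp
    have "Cauchy y"
    proof (rule metric_CauchyI)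
      fix e :: real assume "0 < e"
      then have "eventually (\<lambda>n. 2 * (1/2) ^ n < e / 2) sequentially"
        by (intro order_tendstoD[OF lim0]) simp
      then obtain N where N: "2 * (1/2) ^ N < e / 2" by (auto simp: eventually_sequentially)
      have "dist (y i) (y j) < e" if "N \<le> i" "N \<le> j" for i j
        using dy[OF that(1)] dy[OF that(2)] N dist_triangle[of "y i" "y j" "y N"]
        by (simp add: dist_commute)
      then show "\<exists>N. \<forall>i\<ge>N. \<forall>j\<ge>N. dist (y i) (y j) < e" by blast
    qed
    then obtain l where l: "y \<longlonglongrightarrow> l" using Cauchy_convergent convergent_def by blast
    have "l \<in> P x" using closed_sequentially[OF closed[OF x] _ l] y(1) by blast
    moreover have "(\<lambda>n. a (m n x)) \<longlonglongrightarrow> l"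
    proof -
      have "(\<lambda>n. dist (a (m n x)) (y n)) \<longlonglongrightarrow> 0"
      proof (rule tendsto_sandwich[OF _ _ tendsto_const LIMSEQ_power_zero[of "1/2 :: real"]])
        show "eventually (\<lambda>n. dist (a (m n x)) (y n) \<le> (1/2) ^ n) sequentially"
          using close[of _ 0] by simp
      qed simp_all
      from tendsto_add[OF this iffD1[OF tendsto_dist_iff l]]
      have lim: "(\<lambda>n. dist (a (m n x)) (y n) + dist (y n) l) \<longlonglongrightarrow> 0" by simp
      have "(\<lambda>n. dist (a (m n x)) l) \<longlonglongrightarrow> 0"
        by (rule tendsto_sandwich[OF _ _ tendsto_const lim]) (simp_all add: dist_triangle)
      then show ?thesis by (rule iffD2[OF tendsto_dist_iff])
    qed
    ultimately show ?thesis by blast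
  qed
  then obtain f where f: "\<And>x. x \<in> space M \<Longrightarrow> f x \<in> P x \<and> (\<lambda>n. a (m n x)) \<longlonglongrightarrow> f x" by metis
  have "f \<in> borel_measurable M"
    by (rule borel_measurable_LIMSEQ_metric[of "\<lambda>n x. a (m n x)"]) (use f in simp_all)
  then show ?thesis using f by blast
qed

lemma standard_borel_separating:
  assumes "standard_borel M"
  obtains B :: "nat \<Rightarrow> 'x set" where "\<And>i. B i \<in> sets M"
    "\<And>x y. x \<in> space M \<Longrightarrow> y \<in> space M \<Longrightarrow> (\<And>i. x \<in> B i \<longleftrightarrow> y \<in> B i) \<Longrightarrow> x = y"
proof -
  obtain S where S: "completely_metrizable_space S" "second_countable S" "topspace S = space M"
    "sets M = sigma_sets (topspace S) {U. openin S U}"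
    using assms unfolding standard_borel_def by (elim exE conjE)
  obtain \<B> where \<B>: "countable \<B>" "\<forall>V\<in>\<B>. openin S V"
    "\<forall>U x. openin S U \<and> x \<in> U \<longrightarrow> (\<exists>V\<in>\<B>. x \<in> V \<and> V \<subseteq> U)"
    using S(2) unfolding second_countable_def by (elim exE conjE)
  have H: "Hausdorff_space S"
    using S(1) completely_metrizable_imp_metrizable_space metrizable_imp_Hausdorff_space by blast
  define B where "B = from_nat_into (insert {} \<B>)"
  have rng: "range B = insert {} \<B>" unfolding B_def using \<B>(1) by (intro range_from_nat_into) auto
  show thesis
  proof
    show "B i \<in> sets M" for i
    proof -
      have "openin S (B i)" using rng \<B>(2) by (metis insertE openin_empty rangeI)
      then show ?thesis unfolding S(4) by (intro sigma_sets.Basic) simp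
    qed
    fix x y assume xy: "x \<in> space M" "y \<in> space M" and eq: "\<And>i. x \<in> B i \<longleftrightarrow> y \<in> B i"
    show "x = y"
    proof (rule ccontr)
      assume "x \<noteq> y"
      then have "\<exists>U V. openin S U \<and> openin S V \<and> x \<in> U \<and> y \<in> V \<and> disjnt U V"
        using H xy unfolding Hausdorff_space_def S(3) by simp
      then obtain U V where UV: "openin S U" "openin S V" "x \<in> U" "y \<in> V" "disjnt U V"
        by (elim exE conjE)
      obtain W where W: "W \<in> \<B>" "x \<in> W" "W \<subseteq> U" using \<B>(3) UV(1,3) by blast
      then obtain i where "W = B i" using rng by (metis insertI2 rangeE)
      then have "y \<in> W" using eq W by blast
      then show False using W UV by (auto simp: disjnt_def)
    qed
  qed
qed

lemma (in lc_group_metric) sigma_compact: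
  obtains L :: "nat \<Rightarrow> 'g set" where "\<And>n. compact (L n)" "(\<Union>n. L n) = UNIV"
proof -
  let ?F = "{U::'g set. open U \<and> (\<exists>K. compact K \<and> U \<subseteq> K)}"
  have cover: "\<Union>?F = UNIV"
  proof (rule UNIV_eq_I[symmetric])
    fix x :: 'g
    have "\<forall>x::'g. \<exists>U K. open U \<and> compact K \<and> x \<in> U \<and> U \<subseteq> K"
      using lc unfolding locally_compact_space_def by simp
    then show "x \<in> \<Union>?F" by blast
  qed
  obtain F' where F': "F' \<subseteq> ?F" "countable F'" "\<Union>F' = \<Union>?F" by (rule Lindelof[of ?F]) auto
  have "\<forall>U\<in>F'. \<exists>K. compact K \<and> U \<subseteq> K" using F'(1) by blast
  then obtain k where k: "\<And>U. U \<in> F' \<Longrightarrow> compact (k U) \<and> U \<subseteq> k U" by metis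
  have "F' \<noteq> {}" using F'(3) cover by auto
  define L where "L n = k (from_nat_into F' n)" for n
  show thesis
  proof
    show "compact (L n)" for n
      unfolding L_def using k from_nat_into[OF \<open>F' \<noteq> {}\<close>] by blast
    show "(\<Union>n. L n) = UNIV"
    proof (rule UNIV_eq_I[symmetric])
      fix x :: 'g
      have "x \<in> \<Union>F'" unfolding F'(3) cover by simp
      then obtain U where U: "U \<in> F'" "x \<in> U" by (rule UnionE)
      then obtain n where "from_nat_into F' n = U" using from_nat_into_surj[OF F'(2)] by blast
      then show "x \<in> (\<Union>n. L n)" using k[OF U(1)] U(2) by (auto simp: L_def)
    qed
  qed
qed

section \<open>Measurable cocycles\<close>

text \<open>The two sequential conditions and compactness show that a common zero in \<open>K\<close> exists iff for every \<open>n\<close> the first \<open>n\<close>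
functions are simultaneously below \<open>1 / Suc n\<close> at some point of a countable dense subset of \<open>K\<close>. The latter condition is
measurable in \<open>x\<close>.\<close>

lemma sets_zero_in_compact:
  fixes \<delta> :: "nat \<Rightarrow> 'x \<Rightarrow> 'g::polish_space \<Rightarrow> ennreal"
  assumes meas: "\<And>i g. (\<lambda>x. \<delta> i x g) \<in> borel_measurable M"
    and lower: "\<And>i x g g'. x \<in> space M \<Longrightarrow> g \<longlonglongrightarrow> g' \<Longrightarrow> (\<lambda>n. \<delta> i x (g n)) \<longlonglongrightarrow> 0 \<Longrightarrow> \<delta> i x g' = 0"
    and upper: "\<And>i x g g'. x \<in> space M \<Longrightarrow> g \<longlonglongrightarrow> g' \<Longrightarrow> \<delta> i x g' = 0 \<Longrightarrow> (\<lambda>n. \<delta> i x (g n)) \<longlonglongrightarrow> 0"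
    and K: "compact K"
  shows "{x \<in> space M. \<exists>g\<in>K. \<forall>i. \<delta> i x g = 0} \<in> sets M"
proof -
  obtain D where D: "countable D" "D \<subseteq> K" "K \<subseteq> closure D" using separable by blast
  let ?e = "\<lambda>n. ennreal (1 / Suc n)"
  have e0: "?e \<longlonglongrightarrow> 0"
    using tendsto_ennrealI[OF LIMSEQ_Suc[OF lim_const_over_n[of 1]]] by simp
  have "(\<exists>g\<in>K. \<forall>i. \<delta> i x g = 0) \<longleftrightarrow> (\<forall>n. \<exists>g\<in>D. \<forall>i<n. \<delta> i x g < ?e n)" if x: "x \<in> space M" for x
  proof
    assume "\<exists>g\<in>K. \<forall>i. \<delta> i x g = 0"
    then obtain g where g: "g \<in> K" "\<And>i. \<delta> i x g = 0" by blast
    then have "g \<in> closure D" using D(3) by blast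
    then obtain s where s: "\<And>n. s n \<in> D" "s \<longlonglongrightarrow> g" unfolding closure_sequential by blast
    show "\<forall>n. \<exists>g\<in>D. \<forall>i<n. \<delta> i x g < ?e n"
    proof
      fix n
      have "eventually (\<lambda>k. \<forall>i\<in>{..<n}. \<delta> i x (s k) < ?e n) sequentially"
      proof (intro eventually_ball_finite ballI)
        fix i
        show "eventually (\<lambda>k. \<delta> i x (s k) < ?e n) sequentially"
          by (rule order_tendstoD(2)[OF upper[OF x s(2) g(2)]]) simp
      qed simp
      then obtain k where "\<forall>i\<in>{..<n}. \<delta> i x (s k) < ?e n" by (auto simp: eventually_sequentially)
      then show "\<exists>g\<in>D. \<forall>i<n. \<delta> i x g < ?e n" using s(1) by (intro bexI[of _ "s k"]) auto
    qed
  next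
    assume "\<forall>n. \<exists>g\<in>D. \<forall>i<n. \<delta> i x g < ?e n"
    then obtain s where s: "\<And>n. s n \<in> D" "\<And>n i. i < n \<Longrightarrow> \<delta> i x (s n) < ?e n" by metis
    have "\<forall>n. s n \<in> K" using s(1) D(2) by blast
    then obtain g r where g: "g \<in> K" "strict_mono r" "(s \<circ> r) \<longlonglongrightarrow> g"
      using K unfolding compact_def by blast
    have "\<delta> i x g = 0" for i
    proof (rule lower[OF x g(3)])
      have ev: "eventually (\<lambda>n. \<delta> i x ((s \<circ> r) n) \<le> ?e (r n)) sequentially"
        using eventually_gt_at_top[of i]
      proof eventually_elim
        case (elim n)
        then have "i < r n" using seq_suble[OF g(2), of n] by simp
        then show ?case using s(2) by (simp add: less_imp_le)
      qed
      have lim: "(\<lambda>n. ?e (r n)) \<longlonglongrightarrow> 0"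
        using LIMSEQ_subseq_LIMSEQ[OF e0 g(2)] unfolding o_def .
      show "(\<lambda>n. \<delta> i x ((s \<circ> r) n)) \<longlonglongrightarrow> 0"
        by (rule tendsto_sandwich[OF _ ev tendsto_const lim]) simp
    qed
    then show "\<exists>g\<in>K. \<forall>i. \<delta> i x g = 0" using g(1) by blast
  qed
  then have "{x \<in> space M. \<exists>g\<in>K. \<forall>i. \<delta> i x g = 0} =
      {x \<in> space M. \<forall>n. \<exists>g\<in>D. \<forall>i<n. \<delta> i x g < ?e n}" by blast
  also have "\<dots> \<in> sets M"
  proof -
    note [measurable] = meas
    have "Measurable.pred M (\<lambda>x. \<forall>n. \<exists>g\<in>D. \<forall>i\<in>{..<n}. \<delta> i x g < ?e n)"
      using D(1) by (intro pred_intros_countable pred_intros_countable_bounded countable_finite) simp_all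
    then show ?thesis by (simp add: pred_def Ball_def)
  qed
  finally show ?thesis .
qed

context haar_action
begin

text \<open>The set \<open>P x\<close> of solutions \<open>g\<close> of \<open>act g x = T x\<close> need not look closed, since \<open>act\<close> is only Borel. Averaging
repairs this: for a countable separating family \<open>B i\<close>, let \<open>\<delta> i x g\<close> be the Haar measure of the set of
\<open>h \<in> U0\<close> for which \<open>act h\<close> puts exactly one of \<open>act g x\<close> and \<open>T x\<close> in \<open>B i\<close>. It is continuous in \<open>g\<close> by
continuity of translation, and it vanishes for all \<open>i\<close> iff some \<open>act h\<close> identifies \<open>act g x\<close> with \<open>T x\<close>, that is,
iff \<open>g \<in> P x\<close>. So \<open>P x\<close> is closed, and whether it meets a compact set is a measurable condition on \<open>x\<close>.\<close>

lemma ex_measurable_cocycle: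
  assumes T [measurable]: "T \<in> measurable M M"
    and orb: "\<And>x. x \<in> space M \<Longrightarrow> T x \<in> orbit act UNIV x"
  shows "\<exists>f\<in>borel_measurable M. \<forall>x\<in>space M. T x = act (f x) x"
proof -
  interpret hm: sigma_finite_measure hm by (rule sigma_finite_hm)
  obtain B :: "nat \<Rightarrow> 'x set" where B [measurable]: "\<And>i. B i \<in> sets M"
    and sep: "\<And>x y. x \<in> space M \<Longrightarrow> y \<in> space M \<Longrightarrow> (\<And>i. x \<in> B i \<longleftrightarrow> y \<in> B i) \<Longrightarrow> x = y"
    using standard_borel_separating[OF borel] by metis
  define E where "E i x g = {h\<in>U0. (act (h + g) x \<in> B i) \<noteq> (act h (T x) \<in> B i)}" for i x g
  define \<delta> where "\<delta> i x g = emeasure hm (E i x g)" for i x g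
  have Tx: "T x \<in> space M" if "x \<in> space M" for x using measurable_space[OF T that] .
  have E [measurable]: "E i x g \<in> sets borel" if [measurable]: "x \<in> space M" for i x g
    unfolding E_def using Tx[OF that] by measurable
  have meas: "(\<lambda>x. \<delta> i x g) \<in> borel_measurable M" for i g
  proof -
    let ?Q = "{p \<in> space (M \<Otimes>\<^sub>M hm). snd p \<in> U0 \<and>
      (act (snd p + g) (fst p) \<in> B i) \<noteq> (act (snd p) (T (fst p)) \<in> B i)}"
    have "?Q \<in> sets (M \<Otimes>\<^sub>M hm)" by measurable
    then have "(\<lambda>x. emeasure hm (Pair x -` ?Q)) \<in> borel_measurable M"
      by (rule hm.measurable_emeasure_Pair)
    moreover have "emeasure hm (Pair x -` ?Q) = \<delta> i x g" if "x \<in> space M" for x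
    proof -
      have "Pair x -` ?Q = E i x g" using that by (auto simp: E_def space_pair_measure)
      then show ?thesis by (simp only: \<delta>_def)
    qed
    ultimately show ?thesis by (rule measurable_cong[THEN iffD1, rotated])
  qed
  have err: "(\<lambda>n. emeasure hm {h\<in>U0. (act (h + g n) x \<in> B i) \<noteq> (act (h + g') x \<in> B i)}) \<longlonglongrightarrow> 0"
    if x: "x \<in> space M" and g: "g \<longlonglongrightarrow> g'" for i x g g'
  proof -
    have "{h. act h x \<in> B i} \<in> sets borel" using x by measurable
    from local_translation_continuity[OF this g] show ?thesis by simp
  qed
  have Ub: "U0 \<in> sets borel" by simp
  have tri: "\<delta> i x g \<le> \<delta> i x g' + emeasure hm {h\<in>U0. (act (h + g) x \<in> B i) \<noteq> (act (h + g') x \<in> B i)}"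
    (is "_ \<le> _ + emeasure hm ?D")
    "\<delta> i x g \<le> \<delta> i x g' + emeasure hm {h\<in>U0. (act (h + g') x \<in> B i) \<noteq> (act (h + g) x \<in> B i)}"
    if x: "x \<in> space M" for i x g g'
  proof -
    have D: "?D \<in> sets borel" using x by measurable
    have "\<delta> i x g \<le> emeasure hm (E i x g' \<union> ?D)"
      unfolding \<delta>_def by (rule emeasure_mono) (use E[OF x] D in \<open>auto simp: E_def\<close>)
    also have "\<dots> \<le> \<delta> i x g' + emeasure hm ?D"
      unfolding \<delta>_def by (rule emeasure_subadditive) (use E[OF x] D in auto)
    finally show 1: "\<delta> i x g \<le> \<delta> i x g' + emeasure hm ?D" .
    have "?D = {h\<in>U0. (act (h + g') x \<in> B i) \<noteq> (act (h + g) x \<in> B i)}" by auto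
    with 1 show "\<delta> i x g \<le> \<delta> i x g' + emeasure hm {h\<in>U0. (act (h + g') x \<in> B i) \<noteq> (act (h + g) x \<in> B i)}"
      by simp
  qed
  have lower: "\<delta> i x g' = 0" if x: "x \<in> space M" and g: "g \<longlonglongrightarrow> g'" and 0: "(\<lambda>n. \<delta> i x (g n)) \<longlonglongrightarrow> 0"
    for i x g g'
  proof -
    have "(\<lambda>n. \<delta> i x (g n) + emeasure hm {h\<in>U0. (act (h + g n) x \<in> B i) \<noteq> (act (h + g') x \<in> B i)}) \<longlonglongrightarrow> 0"
      using tendsto_add[OF 0 err[OF x g, of i]] by simp
    then have "\<delta> i x g' \<le> 0"
      by (rule LIMSEQ_le_const) (use tri(2)[OF x] in blast)
    then show ?thesis by simp
  qed
  have upper: "(\<lambda>n. \<delta> i x (g n)) \<longlonglongrightarrow> 0" if x: "x \<in> space M" and g: "g \<longlonglongrightarrow> g'" and 0: "\<delta> i x g' = 0"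
    for i x g g'
  proof (rule tendsto_sandwich[OF _ _ tendsto_const err[OF x g, of i]])
    show "eventually (\<lambda>n. \<delta> i x (g n) \<le>
        emeasure hm {h\<in>U0. (act (h + g n) x \<in> B i) \<noteq> (act (h + g') x \<in> B i)}) sequentially"
      using tri(1)[OF x, of i _ g'] by (simp add: 0)
  qed simp
  define P where "P x = {g. act g x = T x}" for x
  have P_iff: "g \<in> P x \<longleftrightarrow> (\<forall>i. \<delta> i x g = 0)" if x: "x \<in> space M" for x g
  proof
    assume "g \<in> P x"
    then have "act (h + g) x = act h (T x)" for h using act_add[OF x] by (simp add: P_def)
    then show "\<forall>i. \<delta> i x g = 0" by (simp add: \<delta>_def E_def)
  next
    assume 0: "\<forall>i. \<delta> i x g = 0"
    then have "E i x g \<in> null_sets hm" for i using E[OF x] by (auto simp: null_sets_def \<delta>_def)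
    then have "(\<Union>i. E i x g) \<in> null_sets hm" by (rule null_sets_UN)
    moreover have "U0 \<notin> null_sets hm" using hm_U0(1) by (auto simp: null_sets_def)
    ultimately have "\<not> U0 \<subseteq> (\<Union>i. E i x g)"
      using null_sets_subset[of "\<Union>i. E i x g" hm U0] by auto
    then obtain h where h: "h \<in> U0" "h \<notin> (\<Union>i. E i x g)" by blast
    have "act (h + g) x = act h (T x)"
      by (rule sep) (use h x Tx in \<open>auto simp: E_def act_space simp del: in_mball\<close>)
    then have "act (- h) (act h (act g x)) = act (- h) (act h (T x))" using act_add[OF x] by simp
    then show "g \<in> P x" using x Tx act_space by (simp add: P_def)
  qed
  have compact_hit: "{x \<in> space M. P x \<inter> K \<noteq> {}} \<in> sets M" if "compact K" for K
  proof -
    have "{x \<in> space M. P x \<inter> K \<noteq> {}} = {x \<in> space M. \<exists>g\<in>K. \<forall>i. \<delta> i x g = 0}"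
      using P_iff by blast
    then show ?thesis using sets_zero_in_compact[of \<delta> M K, OF meas lower upper that] by simp
  qed
  \<comment> \<open>Closed sets are countable unions of compact ones, so hitting a closed set is measurable too.\<close>
  obtain L :: "nat \<Rightarrow> 'g set" where L: "\<And>n. compact (L n)" "(\<Union>n. L n) = UNIV"
    using sigma_compact by metis
  have "\<exists>f\<in>borel_measurable M. \<forall>x\<in>space M. f x \<in> P x"
  proof (rule measurable_selection)
    show "closed (P x)" if x: "x \<in> space M" for x
      unfolding closed_sequential_limits
    proof (intro allI impI)
      fix g l assume g: "(\<forall>n. g n \<in> P x) \<and> g \<longlonglongrightarrow> l"
      then have "\<delta> i x (g n) = 0" for i n using P_iff[OF x] by blast
      then have "\<delta> i x l = 0" for i using lower[OF x, of g l i] g by simp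
      then show "l \<in> P x" using P_iff[OF x] by blast
    qed
    show "P x \<noteq> {}" if "x \<in> space M" for x
      using orb[OF that] by (auto simp: orbit_def P_def)
    show "{x \<in> space M. P x \<inter> Q \<noteq> {}} \<in> sets M" if Q: "closed Q" for Q
    proof -
      have "{x \<in> space M. P x \<inter> Q \<noteq> {}} = (\<Union>n. {x \<in> space M. P x \<inter> (L n \<inter> Q) \<noteq> {}})"
      proof -
        have "P x \<inter> Q = (\<Union>n. P x \<inter> (L n \<inter> Q))" for x using L(2) by auto
        then show ?thesis by auto
      qed
      also have "\<dots> \<in> sets M"
        by (rule sets.countable_UN, rule image_subsetI, rule compact_hit, rule compact_Int_closed[OF L(1) Q])
      finally show ?thesis .
    qed
  qed
  then obtain f where f: "f \<in> borel_measurable M" "\<forall>x\<in>space M. f x \<in> P x" by (rule bexE)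
  have "T x = act (f x) x" if "x \<in> space M" for x
    using f(2) that by (simp add: P_def)
  then show ?thesis using f(1) by (intro bexI[of _ f] ballI)
qed

end

section \<open>Transports and greedy extension\<close>

text \<open>The countable subgroup \<open>\<Gamma>\<close> plays the part of \<open>H\<close>; countability keeps all constructions measurable.\<close>

locale dense_haar_action = haar_action d hm r0 M act
  for d :: "'g::{topological_group_add, polish_space} \<Rightarrow> 'g \<Rightarrow> real" and hm r0
    and M :: "'x measure" and act +
  fixes \<Gamma> :: "'g set"
  assumes countable_\<Gamma>: "countable \<Gamma>" and subgroup_\<Gamma>: "add_subgroup \<Gamma>" and dense_\<Gamma>: "closure \<Gamma> = UNIV"
begin

lemma zero_in_\<Gamma>: "0 \<in> \<Gamma>" and add_in_\<Gamma>: "q \<in> \<Gamma> \<Longrightarrow> q' \<in> \<Gamma> \<Longrightarrow> q + q' \<in> \<Gamma>"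
  and minus_in_\<Gamma>: "q \<in> \<Gamma> \<Longrightarrow> - q \<in> \<Gamma>"
  using subgroup_\<Gamma> by (auto simp: add_subgroup_def)

text \<open>A partial injective map that moves each point by an element of \<open>\<Gamma>\<close>, encoded by its pieces: \<open>P q\<close> is the set of points that are
moved by \<open>q\<close>. In this form the union of an increasing sequence of partial maps is taken piece by piece.\<close>

definition transport :: "('g \<Rightarrow> 'x set) \<Rightarrow> bool" where
  "transport P \<longleftrightarrow> (\<forall>q. P q \<in> sets M) \<and> (\<forall>q. q \<notin> \<Gamma> \<longrightarrow> P q = {}) \<and>
     (\<forall>q q'. q \<noteq> q' \<longrightarrow> P q \<inter> P q' = {}) \<and> (\<forall>q q'. q \<noteq> q' \<longrightarrow> act q ` P q \<inter> act q' ` P q' = {})"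

definition dom :: "('g \<Rightarrow> 'x set) \<Rightarrow> 'x set" where "dom P = (\<Union>q\<in>\<Gamma>. P q)"

definition img :: "('g \<Rightarrow> 'x set) \<Rightarrow> 'x set" where "img P = (\<Union>q\<in>\<Gamma>. act q ` P q)"

lemma transportD:
  assumes "transport P"
  shows "P q \<in> sets M" "q \<notin> \<Gamma> \<Longrightarrow> P q = {}" "x \<in> P q \<Longrightarrow> x \<in> space M" "x \<in> P q \<Longrightarrow> q \<in> \<Gamma>"
    "x \<in> P q \<Longrightarrow> x \<in> P q' \<Longrightarrow> q = q'"
    "x \<in> P q \<Longrightarrow> y \<in> P q' \<Longrightarrow> act q x = act q' y \<Longrightarrow> q = q' \<and> x = y"
proof -
  show s: "P q \<in> sets M" for q using assms by (simp add: transport_def)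
  show "q \<notin> \<Gamma> \<Longrightarrow> P q = {}" using assms by (simp add: transport_def)
  then show "x \<in> P q \<Longrightarrow> q \<in> \<Gamma>" by blast
  show sp: "x \<in> P q \<Longrightarrow> x \<in> space M" for x q using sets.sets_into_space[OF s] by blast
  show "x \<in> P q \<Longrightarrow> x \<in> P q' \<Longrightarrow> q = q'" using assms unfolding transport_def by blast
  assume x: "x \<in> P q" and y: "y \<in> P q'" and eq: "act q x = act q' y"
  have "q = q'"
  proof (rule ccontr)
    assume "q \<noteq> q'"
    then have "act q ` P q \<inter> act q' ` P q' = {}" using assms by (simp add: transport_def)
    then show False using x y eq by blast
  qed
  then show "q = q' \<and> x = y" using inj_onD[OF inj_act _ sp[OF x] sp[OF y], of q] eq by simp
qed

lemma transportI:
  assumes "\<And>q. P q \<in> sets M" "\<And>q. q \<notin> \<Gamma> \<Longrightarrow> P q = {}"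
    "\<And>x q q'. x \<in> P q \<Longrightarrow> x \<in> P q' \<Longrightarrow> q = q'"
    "\<And>x y q q'. x \<in> P q \<Longrightarrow> y \<in> P q' \<Longrightarrow> act q x = act q' y \<Longrightarrow> q = q'"
  shows "transport P"
  unfolding transport_def
proof (intro conjI allI impI)
  fix q q' :: 'g assume ne: "q \<noteq> q'"
  show "P q \<inter> P q' = {}" using assms(3) ne by blast
  show "act q ` P q \<inter> act q' ` P q' = {}"
  proof (rule ccontr)
    assume "act q ` P q \<inter> act q' ` P q' \<noteq> {}"
    then obtain z where "z \<in> act q ` P q" "z \<in> act q' ` P q'" by blast
    then obtain x y where "x \<in> P q" "z = act q x" "y \<in> P q'" "z = act q' y" by (elim imageE)
    then show False using assms(4)[of x q y q'] ne by simp
  qed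
qed (use assms in auto)

lemma dom_sets [measurable]: "transport P \<Longrightarrow> dom P \<in> sets M"
  unfolding dom_def using countable_\<Gamma> transportD(1) by (intro sets.countable_UN') auto

lemma img_sets [measurable]: "transport P \<Longrightarrow> img P \<in> sets M"
  unfolding img_def using countable_\<Gamma> transportD(1) act_image_sets by (intro sets.countable_UN') auto

lemma transport_restrict:
  assumes P: "transport P" and sub: "\<And>q. P' q \<subseteq> P q" and meas: "\<And>q. P' q \<in> sets M"
  shows "transport P'"
proof (rule transportI[OF meas])
  show "q \<notin> \<Gamma> \<Longrightarrow> P' q = {}" for q using transportD(2)[OF P] sub by blast
  show "q = q'" if "x \<in> P' q" "x \<in> P' q'" for x q q'
    using transportD(5)[OF P subsetD[OF sub] subsetD[OF sub]] that .
  show "q = q'" if "x \<in> P' q" "y \<in> P' q'" "act q x = act q' y" for x y q q'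
    using transportD(6)[OF P subsetD[OF sub that(1)] subsetD[OF sub that(2)] that(3)] by blast
qed

text \<open>Each piece is moved by one group element, which preserves \<open>M\<close>, and the images of the pieces are disjoint.\<close>

lemma emeasure_img: "transport P \<Longrightarrow> emeasure M (img P) = emeasure M (dom P)"
proof -
  assume P: "transport P"
  have "emeasure M (img P) = (\<integral>\<^sup>+q. emeasure M (act q ` P q) \<partial>count_space \<Gamma>)"
    unfolding img_def
  proof (rule emeasure_UN_countable[OF _ countable_\<Gamma>])
    show "act q ` P q \<in> sets M" for q using transportD(1)[OF P] by (rule act_image_sets)
    show "disjoint_family_on (\<lambda>q. act q ` P q) \<Gamma>"
      using P by (simp add: transport_def disjoint_family_on_def)
  qed
  also have "\<dots> = (\<integral>\<^sup>+q. emeasure M (P q) \<partial>count_space \<Gamma>)"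
    using transportD(1)[OF P] by (simp add: emeasure_act_image)
  also have "\<dots> = emeasure M (dom P)"
    unfolding dom_def
  proof (rule emeasure_UN_countable[symmetric, OF _ countable_\<Gamma>])
    show "P q \<in> sets M" for q using transportD(1)[OF P] .
    show "disjoint_family_on P \<Gamma>"
      using P by (simp add: transport_def disjoint_family_on_def)
  qed
  finally show ?thesis .
qed

text \<open>The preimage of \<open>B\<close> under the partial map encoded by \<open>P\<close>.\<close>

definition pull :: "('g \<Rightarrow> 'x set) \<Rightarrow> 'x set \<Rightarrow> 'x set" where
  "pull P B = (\<Union>q\<in>\<Gamma>. {x \<in> P q. act q x \<in> B})"

text \<open>The pieces of \<open>P\<close> restricted to the points sent into \<open>B\<close> form a transport with image \<open>B \<inter> img P\<close>.\<close>

lemma pull_measure: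
  assumes P: "transport P" and B [measurable]: "B \<in> sets M"
  shows "pull P B \<in> sets M" "emeasure M (pull P B) = emeasure M (B \<inter> img P)"
proof -
  define P' where "P' q = {x \<in> P q. act q x \<in> B}" for q
  have P': "transport P'"
  proof (rule transport_restrict[OF P])
    show "P' q \<subseteq> P q" for q by (auto simp: P'_def)
    have "P' q = P q \<inter> {x \<in> space M. act q x \<in> B}" for q
      using transportD(3)[OF P] by (auto simp: P'_def)
    then show "P' q \<in> sets M" for q using transportD(1)[OF P] by simp
  qed
  have dom: "dom P' = pull P B" by (simp add: dom_def pull_def P'_def)
  have img: "img P' = B \<inter> img P" by (auto simp: img_def P'_def)
  show "pull P B \<in> sets M" using dom_sets[OF P'] dom by simp
  show "emeasure M (pull P B) = emeasure M (B \<inter> img P)" using emeasure_img[OF P'] dom img by simp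
qed

definition step :: "'g \<Rightarrow> 'x set \<Rightarrow> ('g \<Rightarrow> 'x set) \<Rightarrow> ('g \<Rightarrow> 'x set)" where
  "step q E P = P(q := P q \<union> {x \<in> E - dom P. act q x \<notin> img P})"

lemma transport_step:
  assumes P: "transport P" and q: "q \<in> \<Gamma>" and E [measurable]: "E \<in> sets M"
  shows "transport (step q E P)"
proof (rule transportI)
  let ?N = "{x \<in> E - dom P. act q x \<notin> img P}"
  have "?N = (E - dom P) \<inter> {x \<in> space M. act q x \<notin> img P}" using sets.sets_into_space[OF E] by blast
  also have "\<dots> \<in> sets M" using P by measurable
  finally have N: "?N \<in> sets M" .
  show "step q E P q' \<in> sets M" for q'
    using N transportD(1)[OF P] by (simp add: step_def)
  show "step q E P q' = {}" if "q' \<notin> \<Gamma>" for q'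
    using that q transportD(2)[OF P] by (auto simp: step_def)
  show "p = p'" if "x \<in> step q E P p" "x \<in> step q E P p'" for x p p'
    using that transportD(5)[OF P, of x p p'] transportD(4)[OF P, of x]
    by (auto simp: step_def dom_def split: if_splits)
  show "p = p'" if "x \<in> step q E P p" "y \<in> step q E P p'" "act p x = act p' y" for x y p p'
  proof -
    have *: "act p x \<in> img P" if "x \<in> P p" for p x
      using that transportD(4)[OF P that] by (auto simp: img_def)
    consider "x \<in> P p" "y \<in> P p'" | "x \<in> P p" "y \<in> ?N" "p' = q" | "x \<in> ?N" "p = q" "y \<in> P p'"
      | "p = q" "p' = q"
      using \<open>x \<in> step q E P p\<close> \<open>y \<in> step q E P p'\<close> by (auto simp: step_def split: if_splits)
    then show ?thesis
    proof cases
      case 1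
      then show ?thesis using transportD(6)[OF P] that(3) by blast
    next
      case 2
      then show ?thesis using *[of x p] that(3) by simp
    next
      case 3
      then show ?thesis using *[of y p'] that(3) by simp
    qed simp
  qed
qed

text \<open>Run once through an enumeration of \<open>\<Gamma>\<close>; when \<open>q\<close> is reached, enlarge its piece by all free points of
\<open>E q\<close> whose image under \<open>q\<close> is free. One pass is enough: a pair that is free at the end was free when its \<open>q\<close> was
considered.\<close>

lemma greedy_extension:
  assumes P: "transport P" and E: "\<And>q. E q \<in> sets M"
  obtains P' where "transport P'" "\<And>q. P q \<subseteq> P' q" "\<And>q. P' q - P q \<subseteq> E q"
    "\<And>q x. q \<in> \<Gamma> \<Longrightarrow> x \<in> E q \<Longrightarrow> x \<notin> dom P' \<Longrightarrow> act q x \<in> img P'"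
proof -
  define e where "e = from_nat_into \<Gamma>"
  have e: "e i \<in> \<Gamma>" for i unfolding e_def by (rule from_nat_into) (use zero_in_\<Gamma> in blast)
  define G where "G = rec_nat P (\<lambda>i. step (e i) (E (e i)))"
  have G0: "G 0 = P" and GS: "G (Suc i) = step (e i) (E (e i)) (G i)" for i by (simp_all add: G_def)
  have tr: "transport (G i)" for i
    by (induction i) (simp_all add: G0 GS P transport_step e E)
  have "G i q \<subseteq> G (Suc i) q" for i q by (simp add: GS step_def)
  then have mono: "G i q \<subseteq> G j q" if "i \<le> j" for i j q
    using that by (rule lift_Suc_mono_le)
  have new: "G i q - P q \<subseteq> E q" for i q
  proof (induction i)
    case (Suc i)
    then show ?case by (auto simp: GS step_def)
  qed (simp add: G0)
  define P' where "P' q = (\<Union>i. G i q)" for q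
  have common: "\<exists>k. x \<in> G k q \<and> y \<in> G k q'" if xy: "x \<in> P' q" "y \<in> P' q'" for x y q q'
  proof -
    obtain i j where "x \<in> G i q" "y \<in> G j q'" using xy by (auto simp: P'_def)
    then have "x \<in> G (max i j) q" "y \<in> G (max i j) q'"
      using mono[of i "max i j" q] mono[of j "max i j" q'] by auto
    then show ?thesis by blast
  qed
  show thesis
  proof
    show "transport P'"
    proof (rule transportI)
      show "P' q \<in> sets M" for q unfolding P'_def using transportD(1)[OF tr] by (intro sets.countable_UN) auto
      show "P' q = {}" if "q \<notin> \<Gamma>" for q unfolding P'_def using transportD(2)[OF tr that] by simp
      show "q = q'" if x: "x \<in> P' q" "x \<in> P' q'" for x q q'
        using common[OF x] transportD(5)[OF tr] by blast
      show "q = q'" if x: "x \<in> P' q" "y \<in> P' q'" and eq: "act q x = act q' y" for x y q q'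
        using common[OF x] transportD(6)[OF tr _ _ eq] by blast
    qed
    show "P q \<subseteq> P' q" for q unfolding P'_def using G0 by (metis UN_upper UNIV_I)
    show "P' q - P q \<subseteq> E q" for q unfolding P'_def using new by blast
    fix q x assume q: "q \<in> \<Gamma>" and x: "x \<in> E q" "x \<notin> dom P'"
    obtain i where i: "e i = q" unfolding e_def using from_nat_into_surj[OF countable_\<Gamma> q] by blast
    have sub: "G j q' \<subseteq> P' q'" for j q' by (auto simp: P'_def)
    have "x \<notin> dom (G i)" using x(2) sub unfolding dom_def by blast
    have "act q x \<in> img (G i)"
    proof (rule ccontr)
      assume "act q x \<notin> img (G i)"
      then have "x \<in> G (Suc i) q" using x(1) \<open>x \<notin> dom (G i)\<close> by (simp add: GS step_def i)
      then show False using sub x(2) q unfolding dom_def by blast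
    qed
    then show "act q x \<in> img P'" using sub unfolding img_def by blast
  qed
qed

end

section \<open>Separation of the remainders\<close>

lemma the_inv_into_vimage:
  assumes inj: "inj_on S X" and surj: "S ` X = X" and A: "A \<subseteq> X"
  shows "the_inv_into X S -` A \<inter> X = S ` A"
proof (intro set_eqI iffI)
  fix y assume y: "y \<in> the_inv_into X S -` A \<inter> X"
  then have "y = S (the_inv_into X S y)" using f_the_inv_into_f[OF inj] surj by simp
  then show "y \<in> S ` A" using y by blast
next
  fix y assume "y \<in> S ` A"
  then obtain x where x: "x \<in> A" "y = S x" by blast
  then have "x \<in> X" using A by blast
  then show "y \<in> the_inv_into X S -` A \<inter> X"
    using x the_inv_into_f_f[OF inj] surj by auto
qed

lemma mp_bijectionsD:
  assumes T: "T \<in> mp_bijections M"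
  shows "T \<in> measurable M M" "inj_on T (space M)" "T ` space M = space M"
    "A \<in> sets M \<Longrightarrow> T ` A \<in> sets M" "A \<in> sets M \<Longrightarrow> emeasure M (T ` A) = emeasure M A"
proof -
  show meas: "T \<in> measurable M M" and inj: "inj_on T (space M)" and surj: "T ` space M = space M"
    using T by (auto simp: mp_bijections_def bij_betw_def)
  have inv: "the_inv_into (space M) T \<in> measurable M M" using T by (simp add: mp_bijections_def)
  show im: "T ` A \<in> sets M" if A: "A \<in> sets M" for A
  proof -
    have AM: "A \<subseteq> space M" using sets.sets_into_space[OF A] .
    have "T ` A = the_inv_into (space M) T -` A \<inter> space M"
      by (rule the_inv_into_vimage[OF inj surj AM, symmetric])
    then show ?thesis using measurable_sets[OF inv A] by simp
  qed
  show "emeasure M (T ` A) = emeasure M A" if A: "A \<in> sets M"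
  proof -
    have AM: "A \<subseteq> space M" using sets.sets_into_space[OF A] .
    have "emeasure M (T ` A) = emeasure (distr M M T) (T ` A)" using T by (simp add: mp_bijections_def)
    also have "\<dots> = emeasure M (T -` (T ` A) \<inter> space M)" by (rule emeasure_distr[OF meas im[OF A]])
    also have "T -` (T ` A) \<inter> space M = A" using AM inj by (auto simp: inj_on_def)
    finally show ?thesis .
  qed
qed

lemma (in lc_group_metric) tendsto_if_d_tendsto_0:
  assumes "\<And>n. d a (g n) < 1 / Suc n"
  shows "g \<longlonglongrightarrow> a"
proof (rule topological_tendstoI)
  fix U :: "'g set" assume "open U" "a \<in> U"
  then obtain e where e: "0 < e" "mball a e \<subseteq> U" using mball_in_open by metis
  have "eventually (\<lambda>n. 1 / Suc n < e) sequentially"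
    by (rule order_tendstoD(2)[OF LIMSEQ_Suc[OF lim_const_over_n] e(1)])
  then show "eventually (\<lambda>n. g n \<in> U) sequentially"
  proof eventually_elim
    case (elim n)
    then have "g n \<in> mball a e" using assms[of n] by simp
    then show ?case using e(2) by blast
  qed
qed

context haar_action
begin

text \<open>A robust form of the condition that a short move leads from \<open>z\<close> to \<open>S\<close>: asking for a non-null set of such moves makes it
accessible to Fubini's theorem.\<close>

definition bad :: "real \<Rightarrow> 'x set \<Rightarrow> 'x set" where
  "bad r S = {z \<in> space M. emeasure hm {g \<in> mball 0 r. act g z \<in> S} \<noteq> 0}"

lemma near_hits_borel:
  assumes [measurable]: "z \<in> space M" "S \<in> sets M"
  shows "{g \<in> mball 0 r. act g z \<in> S} \<in> sets borel"
  by measurable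

lemma bad_sets [measurable]: "S \<in> sets M \<Longrightarrow> bad r S \<in> sets M"
proof -
  assume [measurable]: "S \<in> sets M"
  interpret hm: sigma_finite_measure hm by (rule sigma_finite_hm)
  let ?Q = "{p \<in> space (M \<Otimes>\<^sub>M hm). snd p \<in> mball 0 r \<and> act (snd p) (fst p) \<in> S}"
  have "?Q \<in> sets (M \<Otimes>\<^sub>M hm)" by measurable
  then have [measurable]: "(\<lambda>x. emeasure hm (Pair x -` ?Q)) \<in> borel_measurable M"
    by (rule hm.measurable_emeasure_Pair)
  have "Pair x -` ?Q = {g \<in> mball 0 r. act g x \<in> S}" if "x \<in> space M" for x
    using that by (auto simp: space_pair_measure)
  then have "bad r S = {z \<in> space M. emeasure hm (Pair z -` ?Q) \<noteq> 0}"
    unfolding bad_def by (intro Collect_cong conj_cong refl) simp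
  also have "\<dots> \<in> sets M" by measurable
  finally show ?thesis .
qed

text \<open>Let \<open>Z\<close> be the part of \<open>Y \<inter> S\<close> outside the bad set. Fubini shows that for almost every \<open>g\<close> near \<open>0\<close> the set of points of
\<open>Z\<close> that \<open>g\<close> returns to \<open>Z\<close> is null. For \<open>g\<close> close to \<open>0\<close> its measure is close to that of \<open>Z\<close>, so \<open>Z\<close> is null.\<close>

lemma null_bad_imp_null_inter:
  assumes Y [measurable]: "Y \<in> sets M" and S [measurable]: "S \<in> sets M" and s: "0 < s"
    and null: "emeasure M (Y \<inter> bad s S) = 0"
  shows "emeasure M (Y \<inter> S) = 0"
proof -
  interpret hm: sigma_finite_measure hm by (rule sigma_finite_hm)
  interpret P: pair_sigma_finite hm M ..
  \<comment> \<open>Discarding the null bad part leaves points from which almost no small element leads to \<open>S\<close>.\<close>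
  define Z where "Z = Y \<inter> S - bad s S"
  have Z [measurable]: "Z \<in> sets M" unfolding Z_def by measurable
  let ?Q = "{p \<in> space (hm \<Otimes>\<^sub>M M). fst p \<in> mball 0 s \<and> snd p \<in> Z \<and> act (fst p) (snd p) \<in> Z}"
  have Q [measurable]: "?Q \<in> sets (hm \<Otimes>\<^sub>M M)" by measurable
  have "emeasure (hm \<Otimes>\<^sub>M M) ?Q = (\<integral>\<^sup>+x. emeasure hm ((\<lambda>h. (h, x)) -` ?Q) \<partial>M)"
    by (rule P.emeasure_pair_measure_alt2[OF Q])
  also have "\<dots> = (\<integral>\<^sup>+x. 0 \<partial>M)"
  proof (rule nn_integral_cong)
    fix x assume x: "x \<in> space M"
    show "emeasure hm ((\<lambda>h. (h, x)) -` ?Q) = 0"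
    proof (cases "x \<in> Z")
      case True
      then have "emeasure hm {g \<in> mball 0 s. act g x \<in> S} = 0"
        using x by (simp add: Z_def bad_def)
      moreover have "emeasure hm ((\<lambda>h. (h, x)) -` ?Q) \<le> emeasure hm {g \<in> mball 0 s. act g x \<in> S}"
        by (rule emeasure_mono) (use near_hits_borel[OF x S] in \<open>auto simp: Z_def\<close>)
      ultimately show ?thesis by simp
    qed simp
  qed
  finally have "(\<integral>\<^sup>+g. emeasure M (Pair g -` ?Q) \<partial>hm) = 0"
    using emeasure_pair_measure_alt[OF Q] by simp
  then have ae: "AE g in hm. emeasure M (Pair g -` ?Q) = 0"
    by (subst (asm) nn_integral_0_iff_AE) (use measurable_emeasure_Pair[OF Q] in auto)
  have "emeasure M Z = 0"
  proof (rule ccontr)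
    assume "emeasure M Z \<noteq> 0"
    then have pos: "0 < emeasure M Z" by (simp add: zero_less_iff_neq_zero)
    let ?E = "\<lambda>g. {x \<in> space M. (act g x \<in> Z) \<noteq> (x \<in> Z)}"
    have "\<exists>n. \<forall>g\<in>mball 0 (1 / Suc n). emeasure M (?E g) < emeasure M Z"
    proof (rule ccontr)
      assume "\<not> ?thesis"
      then have "\<forall>n. \<exists>g\<in>mball 0 (1 / Suc n). emeasure M Z \<le> emeasure M (?E g)"
        by (simp add: not_less)
      then have "\<forall>n. \<exists>g. g \<in> mball 0 (1 / Suc n) \<and> emeasure M Z \<le> emeasure M (?E g)"
        unfolding Bex_def .
      from choice[OF this] obtain g where g: "\<forall>n. g n \<in> mball 0 (1 / Suc n) \<and> emeasure M Z \<le> emeasure M (?E (g n))"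
        by (rule exE)
      have dg: "d 0 (g n) < 1 / Suc n" for n using g in_mball by blast
      have "(\<lambda>n. emeasure M (?E (g n))) \<longlonglongrightarrow> 0"
        by (rule act_continuous_at_0[OF Z tendsto_if_d_tendsto_0[OF dg]])
      then have "emeasure M Z \<le> 0" by (rule LIMSEQ_le_const) (use g in blast)
      with pos show False by simp
    qed
    then obtain n where n: "\<And>g. g \<in> mball 0 (1 / Suc n) \<Longrightarrow> emeasure M (?E g) < emeasure M Z" by blast
    let ?V = "mball 0 (min s (1 / Suc n))"
    have "emeasure M (Pair g -` ?Q) \<noteq> 0" if g: "g \<in> ?V" for g
    proof
      assume 0: "emeasure M (Pair g -` ?Q) = 0"
      have eq: "Pair g -` ?Q = {x \<in> space M. x \<in> Z \<and> act g x \<in> Z}"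
        using g by (auto simp: space_pair_measure)
      have "emeasure M Z \<le> emeasure M ({x \<in> space M. x \<in> Z \<and> act g x \<in> Z} \<union> ?E g)"
        by (rule emeasure_mono) (use sets.sets_into_space[OF Z] in auto)
      also have "\<dots> \<le> emeasure M {x \<in> space M. x \<in> Z \<and> act g x \<in> Z} + emeasure M (?E g)"
        by (rule emeasure_subadditive) measurable
      also have "\<dots> = emeasure M (?E g)" using 0 eq by simp
      also have "\<dots> < emeasure M Z" by (rule n) (use g in simp)
      finally show False by simp
    qed
    then have "AE g in hm. g \<notin> ?V" using ae by (auto elim!: eventually_mono)
    then have "emeasure hm ?V = 0"
      by (subst (asm) AE_iff_measurable[of ?V]) auto
    moreover have "0 \<in> ?V" using s by simp
    then have "0 < emeasure hm ?V" by (intro hm_open_pos open_mball) blast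
    ultimately show False by simp
  qed
  moreover have "emeasure M (Y \<inter> S) \<le> emeasure M (Z \<union> (Y \<inter> bad s S))"
    by (rule emeasure_mono) (auto simp: Z_def)
  moreover have "emeasure M (Z \<union> (Y \<inter> bad s S)) \<le> emeasure M Z + emeasure M (Y \<inter> bad s S)"
    by (rule emeasure_subadditive) measurable
  ultimately show ?thesis using null by simp
qed

end

context dense_haar_action
begin

text \<open>For \<open>q n \<in> \<Gamma>\<close> converging to \<open>g\<close>, a point of the set in question is moved into \<open>S\<close> by \<open>g\<close> but, from some \<open>n\<close> on, not by
\<open>q n\<close>. By continuity of the action the points where \<open>q n\<close> and \<open>g\<close> disagree in this way have measure tending to 0.\<close>

lemma dense_null_imp_null:
  assumes R [measurable]: "R \<in> sets M" and S [measurable]: "S \<in> sets M"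
    and f [measurable]: "f \<in> borel_measurable M"
    and sep: "\<And>q x. q \<in> \<Gamma> \<Longrightarrow> x \<in> R \<Longrightarrow> d q (f x) < r \<Longrightarrow> act q x \<notin> S"
  shows "emeasure M {x \<in> space M. x \<in> R \<and> d g (f x) < r \<and> act g x \<in> S} = 0" (is "emeasure M ?N = 0")
proof -
  obtain q where q: "\<And>n. q n \<in> \<Gamma>" "q \<longlonglongrightarrow> g"
    using dense_\<Gamma> closure_sequential[of g \<Gamma>] by auto
  let ?E = "\<lambda>n. {x \<in> space M. (act (q n) x \<in> S) \<noteq> (act g x \<in> S)}"
  define F where "F m = (\<Inter>n\<in>{m..}. ?E n)" for m
  have F: "F m \<in> sets M" for m unfolding F_def by (intro sets.countable_INT') auto
  have "emeasure M (F m) = 0" for m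
  proof -
    have "emeasure M (F m) \<le> 0"
    proof (rule LIMSEQ_le_const[OF act_continuous[OF S q(2)]])
      show "\<exists>N. \<forall>n\<ge>N. emeasure M (F m) \<le> emeasure M (?E n)"
      proof (intro exI[of _ m] allI impI emeasure_mono)
        show "F m \<subseteq> ?E n" if "m \<le> n" for n unfolding F_def using that by blast
      qed measurable
    qed
    then show ?thesis by simp
  qed
  then have "F m \<in> null_sets M" for m using F by (simp add: null_sets_def)
  then have "(\<Union>m. F m) \<in> null_sets M" by (rule null_sets_UN)
  moreover have "?N \<subseteq> (\<Union>m. F m)"
  proof
    fix x assume x: "x \<in> ?N"
    then have "g \<in> mball (f x) r" by (simp add: commute)
    then have "eventually (\<lambda>n. q n \<in> mball (f x) r) sequentially"
      by (rule topological_tendstoD[OF q(2) open_mball])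
    then obtain m where m: "\<And>n. m \<le> n \<Longrightarrow> q n \<in> mball (f x) r"
      unfolding eventually_sequentially by blast
    have "x \<in> ?E n" if "m \<le> n" for n
      using sep[OF q(1)[of n], of x] m[OF that] x by (simp add: commute)
    then show "x \<in> (\<Union>m. F m)" unfolding F_def by blast
  qed
  moreover have "?N \<in> sets M" by measurable
  ultimately show ?thesis using null_sets_subset by blast
qed

text \<open>The passage from countably many group elements to almost all of them: integrate \<open>dense_null_imp_null\<close> over \<open>g\<close>
and exchange the order of integration. Substituting \<open>g + f x\<close> for \<open>g\<close> turns group elements near \<open>f x\<close> applied
to \<open>x\<close> into group elements near \<open>0\<close> applied to \<open>T x\<close>.\<close>

lemma null_bad_of_maximal:
  assumes T: "T \<in> mp_bijections M" and f [measurable]: "f \<in> borel_measurable M"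
    and Tf: "\<And>x. x \<in> space M \<Longrightarrow> T x = act (f x) x"
    and R [measurable]: "R \<in> sets M" and S [measurable]: "S \<in> sets M"
    and sep: "\<And>q x. q \<in> \<Gamma> \<Longrightarrow> x \<in> R \<Longrightarrow> d q (f x) < r \<Longrightarrow> act q x \<notin> S"
  shows "emeasure M (T ` R \<inter> bad r S) = 0"
proof -
  interpret hm: sigma_finite_measure hm by (rule sigma_finite_hm)
  interpret P: pair_sigma_finite hm M ..
  let ?Q = "{p \<in> space (hm \<Otimes>\<^sub>M M). snd p \<in> R \<and> d (fst p) (f (snd p)) < r \<and> act (fst p) (snd p) \<in> S}"
  have Q [measurable]: "?Q \<in> sets (hm \<Otimes>\<^sub>M M)" by measurable
  let ?u = "\<lambda>x. emeasure hm ((\<lambda>h. (h, x)) -` ?Q)"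
  have u [measurable]: "?u \<in> borel_measurable M" by (rule P.measurable_emeasure_Pair2[OF Q])
  have "(\<integral>\<^sup>+x. ?u x \<partial>M) = (\<integral>\<^sup>+g. emeasure M (Pair g -` ?Q) \<partial>hm)"
    using P.emeasure_pair_measure_alt2[OF Q] emeasure_pair_measure_alt[OF Q] by simp
  also have "\<dots> = (\<integral>\<^sup>+g. 0 \<partial>hm)"
  proof (rule nn_integral_cong)
    fix g
    have "Pair g -` ?Q = {x \<in> space M. x \<in> R \<and> d g (f x) < r \<and> act g x \<in> S}"
      by (auto simp: space_pair_measure)
    then show "emeasure M (Pair g -` ?Q) = 0" using dense_null_imp_null[OF R S f sep] by simp
  qed
  finally have "emeasure M {x \<in> space M. ?u x \<noteq> 0} = 0"
    using nn_integral_0_iff[OF u] by simp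
  moreover define C where "C = {x \<in> space M. ?u x \<noteq> 0}"
  moreover have C: "C \<in> sets M" unfolding C_def by measurable
  ultimately have TC: "emeasure M (T ` C) = 0" using mp_bijectionsD(5)[OF T C] by simp
  have "T ` R \<inter> bad r S \<subseteq> T ` C"
  proof
    fix z assume "z \<in> T ` R \<inter> bad r S"
    then obtain x where x: "x \<in> R" "z = T x" and z: "z \<in> bad r S" by blast
    have xM: "x \<in> space M" using sets.sets_into_space[OF R] x by blast
    have "(\<lambda>h. (h, x)) -` ?Q = {k. d k (f x) < r \<and> act k x \<in> S}"
      using x xM by (auto simp: space_pair_measure)
    moreover have "{k. d k (f x) < r \<and> act k x \<in> S} \<in> sets borel" using xM by measurable
    ultimately have "?u x = emeasure hm {g. g + f x \<in> {k. d k (f x) < r \<and> act k x \<in> S}}"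
      by (simp only: hm_translate_Collect)
    also have "{g. g + f x \<in> {k. d k (f x) < r \<and> act k x \<in> S}} = {g \<in> mball 0 r. act g z \<in> S}"
      using right_inv[of _ "f x" 0] by (auto simp: x(2) Tf xM act_add commute)
    finally have "?u x \<noteq> 0" using z by (simp only: bad_def mem_Collect_eq simp_thms)
    then show "z \<in> T ` C" using x xM by (simp add: C_def)
  qed
  then have "emeasure M (T ` R \<inter> bad r S) \<le> emeasure M (T ` C)"
    by (rule emeasure_mono) (rule mp_bijectionsD(4)[OF T C])
  then show ?thesis using TC by simp
qed

end

section \<open>Augmenting paths\<close>

context dense_haar_action
begin

definition close :: "('x \<Rightarrow> 'g) \<Rightarrow> real \<Rightarrow> ('g \<Rightarrow> 'x set) \<Rightarrow> bool" where
  "close f r P \<longleftrightarrow> (\<forall>q. \<forall>x\<in>P q. d q (f x) < r)"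

text \<open>One step of an augmenting path: undo the transport, then apply \<open>T\<close>.\<close>

definition retrace :: "('x \<Rightarrow> 'x) \<Rightarrow> ('g \<Rightarrow> 'x set) \<Rightarrow> 'x set \<Rightarrow> 'x set" where
  "retrace T P Y = T ` pull P Y"

lemma retrace_measure:
  assumes "T \<in> mp_bijections M" "transport P" "Y \<in> sets M"
  shows "retrace T P Y \<in> sets M" "emeasure M (retrace T P Y) = emeasure M (Y \<inter> img P)"
  using pull_measure[OF assms(2,3)] mp_bijectionsD(4,5)[OF assms(1)] by (simp_all add: retrace_def)

lemma pull_subset_dom: "pull P Y \<subseteq> dom P"
  by (auto simp: pull_def dom_def)

lemma dom_subset_space: "transport P \<Longrightarrow> dom P \<subseteq> space M"
  by (intro sets.sets_into_space dom_sets)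

lemma retrace_disjoint:
  assumes T: "T \<in> mp_bijections M" and P: "transport P" and "Y \<inter> Y' = {}"
  shows "retrace T P Y \<inter> retrace T P Y' = {}"
proof -
  have "pull P Y \<inter> pull P Y' = {}"
  proof (rule ccontr)
    assume "pull P Y \<inter> pull P Y' \<noteq> {}"
    then obtain x where "x \<in> pull P Y" "x \<in> pull P Y'" by blast
    then obtain q q' where "x \<in> P q" "act q x \<in> Y" "x \<in> P q'" "act q' x \<in> Y'"
      unfolding pull_def by blast
    then show False using transportD(5)[OF P, of x q q'] assms(3) by blast
  qed
  moreover have "pull P Y \<subseteq> space M" "pull P Y' \<subseteq> space M"
    using pull_subset_dom dom_subset_space[OF P] by blast+
  ultimately show ?thesis
    unfolding retrace_def using inj_on_image_Int[OF mp_bijectionsD(2)[OF T], of "pull P Y" "pull P Y'"] by simp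
qed

text \<open>If \<open>P\<close> sends \<open>x\<close> to \<open>y = act q x\<close>, then \<open>T x = act w y\<close> with \<open>w = f x - q\<close> of length less than \<open>r\<close>. Right translation by \<open>w\<close>
preserves Haar measure, so elements of length less than \<open>s\<close> that carry \<open>T x\<close> into \<open>S\<close> give as many elements of
length less than \<open>s + r\<close> that carry \<open>y\<close> into \<open>S\<close>.\<close>

lemma retrace_bad:
  assumes P: "transport P" and close: "close f r P"
    and Tf: "\<And>x. x \<in> space M \<Longrightarrow> T x = act (f x) x" and S: "S \<in> sets M"
  shows "retrace T P Y \<inter> bad s S \<subseteq> retrace T P (Y \<inter> bad (s + r) S)"
proof
  fix z assume z: "z \<in> retrace T P Y \<inter> bad s S"
  then obtain q x where x: "x \<in> P q" "act q x \<in> Y" "z = T x"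
    unfolding retrace_def pull_def by blast
  have xM: "x \<in> space M" and q: "q \<in> \<Gamma>" using transportD(3,4)[OF P x(1)] by auto
  define y where "y = act q x"
  define w where "w = f x + - q"
  have yM: "y \<in> space M" unfolding y_def using xM by (rule act_space)
  have z_eq: "act g z = act (g + w) y" for g
  proof -
    have "act (g + w) y = act (g + w + q) x" unfolding y_def using act_add[OF xM, of "g + w" q] by simp
    also have "g + w + q = g + f x" by (simp add: w_def add.assoc)
    also have "act (g + f x) x = act g z" using act_add[OF xM] Tf[OF xM] x(3) by simp
    finally show ?thesis by simp
  qed
  have "d 0 w = d q (f x)" using right_inv[of 0 q w] by (simp add: w_def add.assoc)
  then have dw: "d 0 w < r" using close x(1) unfolding close_def by simp
  let ?A = "{k \<in> mball 0 (s + r). act k y \<in> S}"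
  have A: "?A \<in> sets borel" by (rule near_hits_borel[OF yM S])
  have sub: "{g \<in> mball 0 s. act g z \<in> S} \<subseteq> {g. g + w \<in> ?A}"
  proof
    fix g assume g: "g \<in> {g \<in> mball 0 s. act g z \<in> S}"
    have "d 0 (g + w) \<le> d 0 w + d w (g + w)" by (rule triangle) auto
    moreover have "d w (g + w) = d 0 g" using right_inv[of 0 w g] by simp
    ultimately show "g \<in> {g. g + w \<in> ?A}" using g dw z_eq by simp
  qed
  have "emeasure hm {g \<in> mball 0 s. act g z \<in> S} \<le> emeasure hm {g. g + w \<in> ?A}"
    by (rule emeasure_mono[OF sub]) (use translate_vimage_borel[OF A] in simp)
  also have "\<dots> = emeasure hm ?A" by (rule hm_translate_Collect[OF A])
  finally have le: "emeasure hm {g \<in> mball 0 s. act g z \<in> S} \<le> emeasure hm ?A" .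
  have "emeasure hm {g \<in> mball 0 s. act g z \<in> S} \<noteq> 0" using z unfolding bad_def by blast
  then have "emeasure hm ?A \<noteq> 0" using le by (metis le_zero_eq)
  then have "y \<in> bad (s + r) S" unfolding bad_def using yM by blast
  then have "x \<in> pull P (Y \<inter> bad (s + r) S)" using x q unfolding pull_def y_def by blast
  then show "z \<in> retrace T P (Y \<inter> bad (s + r) S)" unfolding retrace_def using x(3) by blast
qed

lemma measure_img: "transport P \<Longrightarrow> measure M (img P) = measure M (dom P)"
  using emeasure_img by (simp add: measure_def)

lemma dom_mono: "(\<And>q. P q \<subseteq> P' q) \<Longrightarrow> dom P \<subseteq> dom P'"
  unfolding dom_def by blast

lemma img_mono: "(\<And>q. P q \<subseteq> P' q) \<Longrightarrow> img P \<subseteq> img P'"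
  unfolding img_def by blast

text \<open>The augmenting path argument. \<open>X k\<close> is the set of points visited at time \<open>k\<close> by the paths that start in \<open>T ` (space M - dom P')\<close>.
It is separated from the points outside \<open>img P'\<close> at scale \<open>(n - k) * r\<close> (\<open>far\<close>), so up to time \<open>n\<close> the paths lose
mass only in \<open>img P' - img P\<close> (\<open>mass\<close>). The sets \<open>X k\<close> are disjoint because \<open>retrace T P\<close> is injective and
\<open>X 0\<close> lies outside its range (\<open>disj\<close>).\<close>

lemma remainder_bound:
  fixes n :: nat and r :: real
  assumes T: "T \<in> mp_bijections M" and f: "f \<in> borel_measurable M"
    and Tf: "\<And>x. x \<in> space M \<Longrightarrow> T x = act (f x) x"
    and P: "transport P" "close f r P" and P': "transport P'" and sub: "\<And>q. P q \<subseteq> P' q"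
    and maximal: "\<And>q x. q \<in> \<Gamma> \<Longrightarrow> x \<in> space M \<Longrightarrow> d q (f x) < n * r \<Longrightarrow> x \<notin> dom P' \<Longrightarrow> act q x \<in> img P'"
    and r: "0 < r"
  shows "(real n + 1) * (1 - measure M (dom P') - real n * (measure M (dom P') - measure M (dom P))) \<le> 1"
proof -
  let ?R = "space M - dom P'" and ?S = "space M - img P'"
  have R: "?R \<in> sets M" and S: "?S \<in> sets M" using dom_sets[OF P'] img_sets[OF P'] by auto
  define X where "X k = (retrace T P ^^ k) (T ` ?R)" for k
  have X0: "X 0 = T ` ?R" and XS: "X (Suc k) = retrace T P (X k)" for k by (simp_all add: X_def)
  have X: "X k \<in> sets M" for k
    by (induction k) (simp_all add: X0 XS mp_bijectionsD(4)[OF T R] retrace_measure(1)[OF T P(1)])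
  have far: "emeasure M (X k \<inter> bad ((real n - k) * r) ?S) = 0" for k
  proof (induction k)
    case 0
    have "emeasure M (T ` ?R \<inter> bad (n * r) ?S) = 0"
    proof (rule null_bad_of_maximal[OF T f Tf R S])
      show "act q x \<notin> ?S" if "q \<in> \<Gamma>" "x \<in> ?R" "d q (f x) < n * r" for q x
        using maximal[OF that(1) _ that(3)] that(2) by blast
    qed
    then show ?case by (simp add: X0)
  next
    case (Suc k)
    let ?t = "(real n - Suc k) * r"
    have t: "?t + r = (real n - k) * r" by (simp add: algebra_simps)
    have Xb: "X k \<inter> bad (?t + r) ?S \<in> sets M" using X S by auto
    have "emeasure M (X (Suc k) \<inter> bad ?t ?S) \<le> emeasure M (retrace T P (X k \<inter> bad (?t + r) ?S))"
      unfolding XS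
      by (rule emeasure_mono[OF retrace_bad[OF P Tf S] retrace_measure(1)[OF T P(1) Xb]])
    also have "\<dots> = emeasure M (X k \<inter> bad (?t + r) ?S \<inter> img P)"
      by (rule retrace_measure(2)[OF T P(1) Xb])
    also have "\<dots> \<le> emeasure M (X k \<inter> bad (?t + r) ?S)" by (rule emeasure_mono[OF _ Xb]) blast
    also have "\<dots> = 0" using Suc unfolding t .
    finally show ?case by simp
  qed
  define \<rho> where "\<rho> = 1 - measure M (dom P')"
  define \<delta> where "\<delta> = measure M (dom P') - measure M (dom P)"
  have \<delta>: "\<delta> = measure M (img P' - img P)" "0 \<le> \<delta>"
  proof -
    show "\<delta> = measure M (img P' - img P)"
      unfolding \<delta>_def measure_img[OF P(1), symmetric] measure_img[OF P', symmetric]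
      by (rule finite_measure_Diff[symmetric, OF img_sets[OF P'] img_sets[OF P(1)] img_mono[OF sub]])
    then show "0 \<le> \<delta>" by simp
  qed
  have mass: "\<rho> - k * \<delta> \<le> measure M (X k)" if "k \<le> n" for k
    using that
  proof (induction k)
    case 0
    have "measure M (X 0) = measure M ?R"
      unfolding X0 measure_def mp_bijectionsD(5)[OF T R] ..
    also have "\<dots> = \<rho>" unfolding \<rho>_def by (rule prob_compl[OF dom_sets[OF P']])
    finally show ?case by simp
  next
    case (Suc k)
    have "emeasure M (X k \<inter> ?S) = 0"
      by (rule null_bad_imp_null_inter[OF X S _ far[of k]]) (use Suc.prems r in simp)
    then have null: "measure M (X k \<inter> ?S) = 0" by (simp add: measure_def)
    have "measure M (X k) \<le> measure M ((X k \<inter> img P) \<union> (img P' - img P) \<union> (X k \<inter> ?S))"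
      by (rule finite_measure_mono)
        (use X sets.sets_into_space[OF X] S img_sets[OF P(1)] img_sets[OF P'] in auto)
    also have "\<dots> \<le> measure M ((X k \<inter> img P) \<union> (img P' - img P)) + measure M (X k \<inter> ?S)"
      by (rule measure_Un_le) (use X S img_sets[OF P(1)] img_sets[OF P'] in auto)
    also have "\<dots> \<le> measure M (X k \<inter> img P) + measure M (img P' - img P) + measure M (X k \<inter> ?S)"
      by (intro add_right_mono measure_Un_le)
        (use X img_sets[OF P(1)] img_sets[OF P'] in auto)
    also have "measure M (X k \<inter> img P) = measure M (X (Suc k))"
      unfolding XS measure_def retrace_measure(2)[OF T P(1) X] ..
    finally have "measure M (X k) \<le> measure M (X (Suc k)) + \<delta>" using null \<delta>(1) by simp
    moreover have "\<rho> - k * \<delta> \<le> measure M (X k)" using Suc by simp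
    ultimately show ?case by (simp add: algebra_simps)
  qed
  have disj: "X i \<inter> X (i + Suc j) = {}" for i j
  proof (induction i)
    case 0
    have "?R \<inter> pull P (X j) = {}" using pull_subset_dom[of P "X j"] dom_mono[of P P', OF sub] by blast
    moreover have "pull P (X j) \<subseteq> space M" using pull_subset_dom dom_subset_space[OF P(1)] by blast
    moreover have "T ` (?R \<inter> pull P (X j)) = T ` ?R \<inter> T ` pull P (X j)"
      by (rule inj_on_image_Int[OF mp_bijectionsD(2)[OF T] _ calculation(2)]) blast
    ultimately show ?case by (simp add: X0 XS retrace_def)
  next
    case (Suc i)
    then show ?case using retrace_disjoint[OF T P(1)] by (simp add: XS)
  qed
  have "disjoint_family_on X {..n}"
    unfolding disjoint_family_on_def
  proof (intro ballI impI)
    fix i j :: nat assume "i \<noteq> j"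
    then show "X i \<inter> X j = {}"
    proof (cases rule: linorder_cases[of i j])
      case less
      then obtain k where "j = i + Suc k" using less_imp_Suc_add by auto
      then show ?thesis using disj by simp
    next
      case greater
      then obtain k where "i = j + Suc k" using less_imp_Suc_add by auto
      then show ?thesis using disj[of j k] by (simp add: Int_commute)
    qed simp
  qed
  then have "(\<Sum>k\<le>n. measure M (X k)) = measure M (\<Union>k\<le>n. X k)"
    using X by (intro finite_measure_finite_Union[symmetric]) auto
  also have "\<dots> \<le> 1" by (rule prob_le_1)
  finally have "(\<Sum>k\<le>n. measure M (X k)) \<le> 1" .
  moreover have "(\<Sum>k\<le>n. \<rho> - n * \<delta>) \<le> (\<Sum>k\<le>n. measure M (X k))"
  proof (rule sum_mono)
    fix k assume k: "k \<in> {..n}"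
    then have "k * \<delta> \<le> n * \<delta>" using \<delta>(2) by (intro mult_right_mono) auto
    then show "\<rho> - n * \<delta> \<le> measure M (X k)" using mass[of k] k by simp
  qed
  ultimately show ?thesis by (simp add: \<rho>_def \<delta>_def algebra_simps)
qed

lemma transport_empty: "transport (\<lambda>_. {})" "close f r (\<lambda>_. {})"
  by (auto simp: transport_def close_def)

text \<open>Let \<open>\<sigma> r\<close> be the supremum of the measures of the domains of transports of radius \<open>r\<close>, and \<open>L\<close> its infimum over
\<open>r > 0\<close>. For any given \<open>n\<close> and \<open>\<delta> > 0\<close>, a small \<open>t\<close> admits a transport of radius \<open>t / n\<close> and a greedy extension of
radius \<open>t\<close> whose domains both have measure within \<open>\<delta>\<close> of \<open>L\<close>; \<open>remainder_bound\<close> then excludes \<open>L < 1\<close>.\<close>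

lemma ex_close_transport:
  assumes T: "T \<in> mp_bijections M" and f [measurable]: "f \<in> borel_measurable M"
    and Tf: "\<And>x. x \<in> space M \<Longrightarrow> T x = act (f x) x"
    and r: "0 < r" and e: "0 < e"
  shows "\<exists>P. transport P \<and> close f r P \<and> 1 - e < measure M (dom P)"
proof -
  let ?C = "\<lambda>r. {P. transport P \<and> close f r P}"
  define \<sigma> where "\<sigma> r = (SUP P\<in>?C r. measure M (dom P))" for r
  define L where "L = (INF r\<in>{0<..}. \<sigma> r)"
  have bdd: "bdd_above ((\<lambda>P. measure M (dom P)) ` ?C r)" for r
    by (rule bdd_aboveI[of _ 1]) (auto intro: prob_le_1)
  have ne: "?C r \<noteq> {}" for r using transport_empty by blast
  have \<sigma>_ge: "measure M (dom P) \<le> \<sigma> r" if "transport P" "close f r P" for P r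
    unfolding \<sigma>_def by (rule cSUP_upper[OF _ bdd]) (use that in simp)
  have \<sigma>0: "0 \<le> \<sigma> r" for r
    using \<sigma>_ge[OF transport_empty] measure_nonneg order_trans by blast
  have bdd': "bdd_below (\<sigma> ` {0<..})" by (rule bdd_belowI[of _ 0]) (use \<sigma>0 in auto)
  have L_le: "L \<le> \<sigma> r" if "0 < r" for r
    unfolding L_def by (rule cINF_lower[OF bdd']) (use that in simp)
  have key: "(real n + 1) * (1 - L - \<delta> - n * (2 * \<delta>)) \<le> 1" if n: "0 < n" and \<delta>: "0 < \<delta>" for n :: nat and \<delta> :: real
  proof -
    have "L < L + \<delta>" using \<delta> by simp
    then obtain t where t: "0 < t" "\<sigma> t < L + \<delta>"
      unfolding L_def using cINF_less_iff[OF _ bdd', of "L + \<delta>"] by (auto simp: L_def)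
    have tn: "0 < t / n" using t n by simp
    then have "\<sigma> (t / n) - \<delta> < \<sigma> (t / n)" using \<delta> by simp
    then obtain P where P: "transport P" "close f (t / n) P" "\<sigma> (t / n) - \<delta> < measure M (dom P)"
      unfolding \<sigma>_def[of "t / n"] using less_cSUP_iff[OF ne bdd] by auto
    define E where "E q = {x \<in> space M. d q (f x) < t}" for q
    have E: "E q \<in> sets M" for q unfolding E_def by measurable
    obtain P' where P': "transport P'" "\<And>q. P q \<subseteq> P' q" "\<And>q. P' q - P q \<subseteq> E q"
      "\<And>q x. q \<in> \<Gamma> \<Longrightarrow> x \<in> E q \<Longrightarrow> x \<notin> dom P' \<Longrightarrow> act q x \<in> img P'"
      using greedy_extension[of P E, OF P(1) E] by metis
    have "t / n \<le> t" using t n by (simp add: divide_le_eq)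
    have cl: "close f t P'"
      unfolding close_def
    proof (intro allI ballI)
      fix q x assume x: "x \<in> P' q"
      show "d q (f x) < t"
      proof (cases "x \<in> P q")
        case True
        then have "d q (f x) < t / n" using P(2) by (simp add: close_def)
        then show ?thesis using \<open>t / n \<le> t\<close> by simp
      next
        case False
        then have "x \<in> E q" using P'(3)[of q] x by blast
        then show ?thesis by (simp add: E_def)
      qed
    qed
    have up: "measure M (dom P') < L + \<delta>" using \<sigma>_ge[OF P'(1) cl] t(2) by linarith
    have low: "L - \<delta> < measure M (dom P)" using L_le[OF tn] P(3) by linarith
    have b: "(real n + 1) * (1 - measure M (dom P') - n * (measure M (dom P') - measure M (dom P))) \<le> 1"
    proof (rule remainder_bound[OF T f Tf P(1,2) P'(1,2) _ tn])
      show "act q x \<in> img P'" if "q \<in> \<Gamma>" "x \<in> space M" "d q (f x) < n * (t / n)" "x \<notin> dom P'" for q x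
        using P'(4)[OF that(1) _ that(4)] that(2,3) n by (simp add: E_def)
    qed
    have "n * (measure M (dom P') - measure M (dom P)) \<le> n * (2 * \<delta>)"
      using up low by (intro mult_left_mono) auto
    then have "1 - L - \<delta> - n * (2 * \<delta>) \<le> 1 - measure M (dom P') - n * (measure M (dom P') - measure M (dom P))"
      using up by linarith
    then have "(real n + 1) * (1 - L - \<delta> - n * (2 * \<delta>)) \<le>
        (real n + 1) * (1 - measure M (dom P') - n * (measure M (dom P') - measure M (dom P)))"
      by (intro mult_left_mono) auto
    then show ?thesis using b by (rule order_trans)
  qed
  have "1 \<le> L"
  proof (rule ccontr)
    assume "\<not> 1 \<le> L"
    define \<eta> where "\<eta> = 1 - L"
    have \<eta>: "0 < \<eta>" using \<open>\<not> 1 \<le> L\<close> by (simp add: \<eta>_def)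
    obtain n :: nat where n: "2 / \<eta> < n" using reals_Archimedean2 by blast
    then have n0: "0 < n" using \<eta> by (metis divide_pos_pos of_nat_0_less_iff order.strict_trans zero_less_numeral)
    \<comment> \<open>\<open>\<delta>\<close> leaves half of \<open>\<eta>\<close> in the bound, and \<open>n > 2 / \<eta>\<close> makes \<open>n + 1\<close> such halves exceed 1.\<close>
    define \<delta> where "\<delta> = \<eta> / (2 * (1 + 2 * n))"
    have \<delta>: "0 < \<delta>" using \<eta> by (simp add: \<delta>_def)
    have "\<delta> * (1 + 2 * n) = \<eta> / 2" by (simp add: \<delta>_def field_simps)
    then have eq: "1 - L - \<delta> - n * (2 * \<delta>) = \<eta> / 2" by (simp add: \<eta>_def algebra_simps)
    have "(real n + 1) * (\<eta> / 2) \<le> 1" using key[OF n0 \<delta>] unfolding eq .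
    moreover have "2 < real n * \<eta>" using n \<eta> by (simp add: divide_less_eq)
    ultimately show False using \<eta> by (simp add: algebra_simps)
  qed
  then have "1 \<le> \<sigma> r" using L_le[OF r] by linarith
  then have "1 - e < \<sigma> r" using e by linarith
  then show ?thesis unfolding \<sigma>_def using less_cSUP_iff[OF ne bdd] by auto
qed

end

section \<open>Completion to a measure-preserving bijection\<close>

context dense_haar_action
begin

text \<open>Measurability of the map and of its inverse comes from the pieces: each is moved by a single group element, and
there are countably many.\<close>

lemma mp_bijection_of_total_transport:
  assumes Q: "transport Q" and dom: "dom Q = space M" and img: "img Q = space M"
  shows "\<exists>h\<in>borel_measurable M. (\<forall>q. \<forall>x\<in>Q q. h x = q) \<and> (\<forall>x\<in>space M. h x \<in> \<Gamma>) \<and>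
    (\<lambda>x. act (h x) x) \<in> mp_bijections M"
proof -
  define h where "h x = (THE q. x \<in> Q q)" for x
  define S where "S x = act (h x) x" for x
  have h_eq: "h x = q" if "x \<in> Q q" for x q
    unfolding h_def using that transportD(5)[OF Q] by blast
  have h_in: "x \<in> Q (h x)" "h x \<in> \<Gamma>" if x: "x \<in> space M" for x
  proof -
    have "x \<in> dom Q" using x dom by simp
    then obtain q where q: "q \<in> \<Gamma>" "x \<in> Q q" unfolding dom_def by blast
    then show "x \<in> Q (h x)" "h x \<in> \<Gamma>" using h_eq[of x q] by simp_all
  qed
  have h [measurable]: "h \<in> borel_measurable M"
  proof (rule measurableI)
    fix A :: "'g set"
    have "h -` A \<inter> space M = (\<Union>q\<in>\<Gamma> \<inter> A. Q q)"
    proof (intro set_eqI iffI)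
      fix x assume "x \<in> h -` A \<inter> space M"
      then show "x \<in> (\<Union>q\<in>\<Gamma> \<inter> A. Q q)" using h_in[of x] by blast
    next
      fix x assume "x \<in> (\<Union>q\<in>\<Gamma> \<inter> A. Q q)"
      then obtain q where "q \<in> A" "x \<in> Q q" by blast
      then show "x \<in> h -` A \<inter> space M" using h_eq transportD(3)[OF Q] by blast
    qed
    also have "\<dots> \<in> sets M" using countable_\<Gamma> transportD(1)[OF Q] by (intro sets.countable_UN') auto
    finally show "h -` A \<inter> space M \<in> sets M" .
  qed simp
  have S [measurable]: "S \<in> measurable M M" unfolding S_def by measurable
  have inj: "inj_on S (space M)"
  proof (rule inj_onI)
    fix x y assume "x \<in> space M" "y \<in> space M" "S x = S y"
    then show "x = y" using transportD(6)[OF Q h_in(1) h_in(1), of x y] by (simp add: S_def)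
  qed
  have image: "S ` A = img (\<lambda>q. Q q \<inter> A)" if "A \<subseteq> space M" for A
  proof (intro set_eqI iffI)
    fix y assume "y \<in> S ` A"
    then obtain x where x: "x \<in> A" "y = S x" by blast
    then have "x \<in> Q (h x) \<inter> A" "h x \<in> \<Gamma>" using h_in[of x] \<open>A \<subseteq> space M\<close> by auto
    then show "y \<in> img (\<lambda>q. Q q \<inter> A)" unfolding img_def x(2) S_def by blast
  next
    fix y assume "y \<in> img (\<lambda>q. Q q \<inter> A)"
    then obtain q x where x: "x \<in> Q q" "x \<in> A" "y = act q x" unfolding img_def by blast
    then have "y = S x" using h_eq[of x q] by (simp add: S_def)
    then show "y \<in> S ` A" using x(2) by blast
  qed
  have surj: "S ` space M = space M"
  proof -
    have "Q q \<inter> space M = Q q" for q using transportD(3)[OF Q] by blast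
    then show ?thesis using image[of "space M"] img by simp
  qed
  have image_sets: "S ` A \<in> sets M" if A: "A \<in> sets M" for A
  proof -
    have "transport (\<lambda>q. Q q \<inter> A)" by (rule transport_restrict[OF Q]) (use A transportD(1)[OF Q] in auto)
    then show ?thesis using image[OF sets.sets_into_space[OF A]] img_sets by simp
  qed
  have "the_inv_into (space M) S \<in> measurable M M"
  proof (rule measurableI)
    show "the_inv_into (space M) S y \<in> space M" if "y \<in> space M" for y
      by (rule the_inv_into_into[OF inj]) (use that surj in auto)
    fix A assume A: "A \<in> sets M"
    have "the_inv_into (space M) S -` A \<inter> space M = S ` A"
      by (rule the_inv_into_vimage[OF inj surj sets.sets_into_space[OF A]])
    then show "the_inv_into (space M) S -` A \<inter> space M \<in> sets M" using image_sets[OF A] by simp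
  qed
  moreover have "distr M M S = M"
  proof (rule measure_eqI)
    fix A assume "A \<in> sets (distr M M S)"
    then have A: "A \<in> sets M" by simp
    have "S -` A \<inter> space M = pull Q A"
    proof (intro set_eqI iffI)
      fix x assume "x \<in> S -` A \<inter> space M"
      then show "x \<in> pull Q A" using h_in[of x] unfolding pull_def S_def by blast
    next
      fix x assume "x \<in> pull Q A"
      then obtain q where "x \<in> Q q" "act q x \<in> A" unfolding pull_def by blast
      then show "x \<in> S -` A \<inter> space M" using h_eq[of x q] transportD(3)[OF Q] by (simp add: S_def)
    qed
    then have "emeasure (distr M M S) A = emeasure M (A \<inter> img Q)"
      using A pull_measure(2)[OF Q A] by (simp add: emeasure_distr)
    then show "emeasure (distr M M S) A = emeasure M A"
      using sets.sets_into_space[OF A] img by (simp add: Int_absorb2)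
  qed simp
  ultimately have "(\<lambda>x. act (h x) x) \<in> mp_bijections M"
    using S inj surj unfolding mp_bijections_def bij_betw_def S_def by simp
  then show ?thesis using h h_eq h_in(2) by (intro bexI[of _ h]) simp_all
qed

definition saturation :: "'x set \<Rightarrow> 'x set" where
  "saturation A = (\<Union>q\<in>\<Gamma>. act q ` A)"

lemma saturation_sets: "A \<in> sets M \<Longrightarrow> saturation A \<in> sets M"
  unfolding saturation_def using countable_\<Gamma> act_image_sets by (intro sets.countable_UN') auto

lemma subset_saturation: "A \<subseteq> space M \<Longrightarrow> A \<subseteq> saturation A"
proof
  fix x assume "A \<subseteq> space M" "x \<in> A"
  then have "x = act 0 x" by auto
  then show "x \<in> saturation A" unfolding saturation_def using zero_in_\<Gamma> \<open>x \<in> A\<close> by blast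
qed

lemma act_saturation:
  assumes A: "A \<subseteq> space M" and q: "q \<in> \<Gamma>" and x: "x \<in> saturation A"
  shows "act q x \<in> saturation A"
proof -
  obtain p y where y: "p \<in> \<Gamma>" "y \<in> A" "x = act p y" using x unfolding saturation_def by blast
  then have "act q x = act (q + p) y" using act_add[of y q p] A by auto
  then show ?thesis unfolding saturation_def using y add_in_\<Gamma>[OF q y(1)] by blast
qed

lemma act_saturation_iff:
  assumes A: "A \<subseteq> space M" and q: "q \<in> \<Gamma>" and x: "x \<in> space M"
  shows "act q x \<in> saturation A \<longleftrightarrow> x \<in> saturation A"
  using act_saturation[OF A q, of x] act_saturation[OF A minus_in_\<Gamma>[OF q], of "act q x"] x by auto

lemma null_saturation: "A \<in> null_sets M \<Longrightarrow> saturation A \<in> null_sets M"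
  unfolding saturation_def
proof (rule null_sets_UN'[OF countable_\<Gamma>])
  fix q assume "A \<in> null_sets M"
  then show "act q ` A \<in> null_sets M" 
    using act_image_sets[of A q] emeasure_act_image[of A q] by (auto simp: null_sets_def)
qed

text \<open>This is where finiteness of the measure is used. Let \<open>Y\<close> be the \<open>\<Gamma>\<close>-saturation of the complement of \<open>dom P\<close>. Maximality puts
\<open>Y\<close> inside \<open>img P\<close>, and \<open>P\<close> respects \<open>Y\<close>, so \<open>P\<close> maps \<open>dom P \<inter> Y\<close> onto \<open>Y\<close> and both have the same measure.\<close>

lemma null_remainder_of_maximal:
  assumes P: "transport P"
    and maximal: "\<And>q x. q \<in> \<Gamma> \<Longrightarrow> x \<in> space M \<Longrightarrow> x \<notin> dom P \<Longrightarrow> act q x \<in> img P"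
  shows "space M - dom P \<in> null_sets M" "space M - img P \<in> null_sets M"
proof -
  let ?R = "space M - dom P"
  have R: "?R \<in> sets M" using dom_sets[OF P] by simp
  define Y where "Y = saturation ?R"
  have Y: "Y \<in> sets M" unfolding Y_def by (rule saturation_sets[OF R])
  have inv: "act q x \<in> Y \<longleftrightarrow> x \<in> Y" if "q \<in> \<Gamma>" "x \<in> space M" for q x
    unfolding Y_def by (rule act_saturation_iff) (use that in auto)
  have Y_img: "Y \<subseteq> img P" unfolding Y_def saturation_def using maximal by blast
  let ?P = "\<lambda>q. P q \<inter> Y"
  have PY: "transport ?P" by (rule transport_restrict[OF P]) (use transportD(1)[OF P] Y in auto)
  have domY: "dom ?P = dom P \<inter> Y" unfolding dom_def by blast
  have imgY: "img ?P = Y"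
  proof (intro set_eqI iffI)
    fix y assume "y \<in> img ?P"
    then obtain q x where "q \<in> \<Gamma>" "x \<in> P q" "x \<in> Y" "y = act q x" unfolding img_def by blast
    then show "y \<in> Y" using inv transportD(3)[OF P] by blast
  next
    fix y assume y: "y \<in> Y"
    then have "y \<in> img P" using Y_img by blast
    then obtain q x where x: "q \<in> \<Gamma>" "x \<in> P q" "y = act q x" unfolding img_def by blast
    then have "x \<in> Y" using inv[OF x(1) transportD(3)[OF P x(2)]] y by simp
    then show "y \<in> img ?P" unfolding img_def using x by blast
  qed
  have "?R \<subseteq> Y" unfolding Y_def by (rule subset_saturation) blast
  then have "measure M (?R \<union> (dom P \<inter> Y)) \<le> measure M Y"
    by (intro finite_measure_mono Y) auto
  moreover have "measure M (?R \<union> (dom P \<inter> Y)) = measure M ?R + measure M (dom P \<inter> Y)"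
    by (rule finite_measure_Union) (use R dom_sets[OF P] Y in auto)
  moreover have "measure M (dom P \<inter> Y) = measure M Y"
    using measure_img[OF PY] unfolding imgY domY by simp
  ultimately have R0: "measure M ?R = 0" using measure_nonneg[of M ?R] by linarith
  then show "?R \<in> null_sets M" using R by (simp add: null_sets_def emeasure_eq_measure)
  have "measure M (space M - img P) = measure M ?R"
    using prob_compl[OF dom_sets[OF P]] prob_compl[OF img_sets[OF P]] measure_img[OF P] by simp
  then show "space M - img P \<in> null_sets M"
    using R0 img_sets[OF P] by (simp add: null_sets_def emeasure_eq_measure)
qed

text \<open>Extend \<open>P\<close> greedily without any condition on the distance. What remains is null; replace the map by the identity on the
saturation \<open>Z\<close> of the remainder, which is null and invariant, to get an everywhere defined bijection.\<close>

lemma ex_mp_bijection_extending: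
  assumes P: "transport P"
  shows "\<exists>h\<in>borel_measurable M. \<exists>N\<in>null_sets M. (\<forall>x\<in>space M. h x \<in> \<Gamma>) \<and>
    (\<lambda>x. act (h x) x) \<in> mp_bijections M \<and> (\<forall>q. \<forall>x\<in>P q. x \<notin> N \<longrightarrow> h x = q)"
proof -
  obtain P' where P': "transport P'" "\<And>q. P q \<subseteq> P' q"
    "\<And>q x. q \<in> \<Gamma> \<Longrightarrow> x \<in> space M \<Longrightarrow> x \<notin> dom P' \<Longrightarrow> act q x \<in> img P'"
    using greedy_extension[OF P, of "\<lambda>_. space M"] by (metis sets.top)
  define W where "W = (space M - dom P') \<union> (space M - img P')"
  have W: "W \<in> null_sets M" "W \<subseteq> space M"
    unfolding W_def using null_remainder_of_maximal[OF P'(1,3)] by (auto intro: null_sets.Un)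
  define Z where "Z = saturation W"
  have Z: "Z \<in> null_sets M" unfolding Z_def by (rule null_saturation[OF W(1)])
  have Zs: "Z \<in> sets M" using Z by auto
  have ZM: "Z \<subseteq> space M" by (rule sets.sets_into_space[OF Zs])
  have WZ: "W \<subseteq> Z" unfolding Z_def by (rule subset_saturation[OF W(2)])
  have inv: "act q x \<in> Z \<longleftrightarrow> x \<in> Z" if "q \<in> \<Gamma>" "x \<in> space M" for q x
    unfolding Z_def by (rule act_saturation_iff[OF W(2) that])
  \<comment> \<open>On \<open>Z\<close> the map becomes the identity, that is, the move by the neutral element.\<close>
  define Q where "Q q = (P' q - Z) \<union> (if q = 0 then Z else {})" for q
  have Q: "transport Q"
  proof (rule transportI)
    show "Q q \<in> sets M" for q unfolding Q_def using transportD(1)[OF P'(1)] Zs by auto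
    show "Q q = {}" if "q \<notin> \<Gamma>" for q
      unfolding Q_def using transportD(2)[OF P'(1) that] that zero_in_\<Gamma> by auto
    show "q = q'" if "x \<in> Q q" "x \<in> Q q'" for x q q'
      using that transportD(5)[OF P'(1), of x q q'] unfolding Q_def by (auto split: if_splits)
    show "q = q'" if x: "x \<in> Q q" and y: "y \<in> Q q'" and eq: "act q x = act q' y" for x y q q'
    proof -
      have *: "act p v \<in> Z \<longleftrightarrow> v \<in> Z" if "v \<in> Q p" for v p
      proof (cases "v \<in> Z")
        case True
        then have "p = 0" "v \<in> space M" using that ZM by (auto simp: Q_def split: if_splits)
        then show ?thesis by simp
      next
        case False
        then have "v \<in> P' p" using that by (auto simp: Q_def split: if_splits)
        then show ?thesis using inv transportD(3,4)[OF P'(1)] by blast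
      qed
      show ?thesis
      proof (cases "x \<in> Z")
        case True
        then have "y \<in> Z" using *[OF x] *[OF y] eq by simp
        then show ?thesis using True x y by (auto simp: Q_def split: if_splits)
      next
        case False
        then have "y \<notin> Z" using *[OF x] *[OF y] eq by simp
        then have "x \<in> P' q" "y \<in> P' q'" using False x y by (auto simp: Q_def split: if_splits)
        then show ?thesis using transportD(6)[OF P'(1) _ _ eq] by blast
      qed
    qed
  qed
  have dom: "dom Q = space M"
  proof (rule antisym[OF dom_subset_space[OF Q]], rule subsetI)
    fix x assume x: "x \<in> space M"
    show "x \<in> dom Q"
    proof (cases "x \<in> Z")
      case True
      then have "x \<in> Q 0" by (simp add: Q_def)
      then show ?thesis unfolding dom_def using zero_in_\<Gamma> by blast
    next
      case False
      then have "x \<in> dom P'" using WZ x unfolding W_def by blast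
      then obtain q where "q \<in> \<Gamma>" "x \<in> P' q" unfolding dom_def by blast
      then show ?thesis unfolding dom_def Q_def using False by blast
    qed
  qed
  have img: "img Q = space M"
  proof (rule antisym[OF sets.sets_into_space[OF img_sets[OF Q]]], rule subsetI)
    fix y assume y: "y \<in> space M"
    show "y \<in> img Q"
    proof (cases "y \<in> Z")
      case True
      then have "y \<in> Q 0" "act 0 y = y" using y by (simp_all add: Q_def)
      then show ?thesis unfolding img_def using zero_in_\<Gamma> by (metis UN_I imageI)
    next
      case False
      then have "y \<in> img P'" using WZ y unfolding W_def by blast
      then obtain q x where x: "q \<in> \<Gamma>" "x \<in> P' q" "y = act q x" unfolding img_def by blast
      then have "x \<notin> Z" using inv[OF x(1) transportD(3)[OF P'(1) x(2)]] False by simp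
      then have "x \<in> Q q" using x(2) by (simp add: Q_def)
      then show ?thesis unfolding img_def using x by blast
    qed
  qed
  obtain h where h: "h \<in> borel_measurable M" "\<forall>q. \<forall>x\<in>Q q. h x = q"
    "\<forall>x\<in>space M. h x \<in> \<Gamma>" "(\<lambda>x. act (h x) x) \<in> mp_bijections M"
    using mp_bijection_of_total_transport[OF Q dom img] by (elim bexE conjE)
  have "x \<in> Q q" if "x \<in> P q" "x \<notin> Z" for q x
    using that subsetD[OF P'(2)] by (simp add: Q_def)
  then have "\<forall>q. \<forall>x\<in>P q. x \<notin> Z \<longrightarrow> h x = q" using h(2) by simp
  then show ?thesis using h Z by (intro bexI[of _ h] bexI[of _ Z] conjI)
qed

lemma ex_mp_bijection_near:
  assumes T: "T \<in> mp_bijections M" and f [measurable]: "f \<in> borel_measurable M"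
    and Tf: "\<And>x. x \<in> space M \<Longrightarrow> T x = act (f x) x"
    and B: "\<And>g h. d g h \<le> B" and e: "0 < e"
  shows "\<exists>h\<in>borel_measurable M. (\<forall>x\<in>space M. h x \<in> \<Gamma>) \<and>
    (\<lambda>x. act (h x) x) \<in> mp_bijections M \<and> (\<integral>x. d (f x) (h x) \<partial>M) < e"
proof -
  have B0: "0 \<le> B" using B[of 0 0] by simp
  \<comment> \<open>Outside \<open>dom P\<close> the distance is only known to be at most \<open>B\<close>; \<open>B + 1\<close> avoids division by 0.\<close>
  define \<epsilon> where "\<epsilon> = e / (2 * (B + 1))"
  have \<epsilon>: "0 < \<epsilon>" using e B0 by (simp add: \<epsilon>_def)
  obtain P where P: "transport P" "close f (e / 2) P" "1 - \<epsilon> < measure M (dom P)"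
    using ex_close_transport[OF T f Tf _ \<epsilon>, of "e / 2"] e by auto
  obtain h N where h [measurable]: "h \<in> borel_measurable M" and h\<Gamma>: "\<forall>x\<in>space M. h x \<in> \<Gamma>"
    and S: "(\<lambda>x. act (h x) x) \<in> mp_bijections M" and N: "N \<in> null_sets M"
    and hP: "\<forall>q. \<forall>x\<in>P q. x \<notin> N \<longrightarrow> h x = q"
    using ex_mp_bijection_extending[OF P(1)] by (elim bexE conjE)
  have D [measurable]: "dom P \<in> sets M" by (rule dom_sets[OF P(1)])
  have AE_le: "AE x in M. d (f x) (h x) \<le> e / 2 + B * indicator (space M - dom P) x"
    using AE_not_in[OF N] AE_space
  proof eventually_elim
    case (elim x)
    show ?case
    proof (cases "x \<in> dom P")
      case True
      then obtain q where q: "x \<in> P q" unfolding dom_def by blast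
      then have "d q (f x) < e / 2" using P(2) unfolding close_def by blast
      moreover have "h x = q" using hP q elim(1) by simp
      ultimately show ?thesis using True by (simp add: commute)
    next
      case False
      then show ?thesis using elim(2) B[of "f x" "h x"] e by simp
    qed
  qed
  have "(\<integral>x. d (f x) (h x) \<partial>M) \<le> (\<integral>x. e / 2 + B * indicator (space M - dom P) x \<partial>M)"
  proof (rule integral_mono_AE[OF _ _ AE_le])
    show "integrable M (\<lambda>x. d (f x) (h x))"
      by (rule integrable_const_bound[where B = B]) (use B in auto)
    show "integrable M (\<lambda>x. e / 2 + B * indicator (space M - dom P) x)"
      by (intro Bochner_Integration.integrable_add integrable_mult_right integrable_real_indicator)
        (auto simp: emeasure_eq_measure)
  qed
  also have "\<dots> = e / 2 + B * measure M (space M - dom P)"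
    by (subst Bochner_Integration.integral_add) (auto simp: prob_space emeasure_eq_measure)
  also have "measure M (space M - dom P) = 1 - measure M (dom P)" by (rule prob_compl[OF D])
  also have "e / 2 + B * (1 - measure M (dom P)) \<le> e / 2 + B * \<epsilon>"
    using P(3) B0 by (intro add_left_mono mult_left_mono) auto
  also have "\<dots> < e"
  proof -
    have "B * \<epsilon> < (B + 1) * \<epsilon>" using \<epsilon> by simp
    also have "\<dots> = e / 2" using B0 by (simp add: \<epsilon>_def field_simps)
    finally show ?thesis by simp
  qed
  finally have "(\<integral>x. d (f x) (h x) \<partial>M) < e" .
  then show ?thesis using h h\<Gamma> S by (intro bexI[of _ h] conjI)
qed

end

section \<open>Density of the orbit full group\<close>

text \<open>The subgroup generated by a countable dense subset of \<open>H\<close>, as the set of sums of words.\<close>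

lemma ex_countable_dense_subgroup:
  fixes H :: "'g::{topological_group_add, polish_space} set"
  assumes H: "add_subgroup H" and dense: "closure H = UNIV"
  shows "\<exists>\<Gamma>. countable \<Gamma> \<and> \<Gamma> \<subseteq> H \<and> add_subgroup \<Gamma> \<and> closure \<Gamma> = UNIV"
proof -
  obtain D where D: "countable D" "D \<subseteq> H" "H \<subseteq> closure D" using separable[of H] by blast
  define A where "A = D \<union> uminus ` D"
  define \<Gamma> where "\<Gamma> = sum_list ` lists A"
  have A_minus: "- a \<in> A" if "a \<in> A" for a using that unfolding A_def by auto
  have AH: "A \<subseteq> H" unfolding A_def using D(2) H by (auto simp: add_subgroup_def)
  have "countable \<Gamma>" unfolding \<Gamma>_def A_def using D(1) by (intro countable_image countable_lists) simp
  moreover have "\<Gamma> \<subseteq> H"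
  proof -
    have "sum_list xs \<in> H" if "xs \<in> lists A" for xs
      using that
    proof induction
      case Nil
      then show ?case using H by (simp add: add_subgroup_def)
    next
      case (Cons a xs)
      then show ?case using H AH by (simp add: add_subgroup_def subset_iff)
    qed
    then show ?thesis unfolding \<Gamma>_def by blast
  qed
  moreover have "add_subgroup \<Gamma>"
    unfolding add_subgroup_def
  proof (intro conjI ballI)
    have "sum_list [] \<in> \<Gamma>" unfolding \<Gamma>_def by (rule imageI) simp
    then show "0 \<in> \<Gamma>" by simp
    show "g + h \<in> \<Gamma>" if g: "g \<in> \<Gamma>" and h: "h \<in> \<Gamma>" for g h
    proof -
      obtain xs ys where "xs \<in> lists A" "g = sum_list xs" "ys \<in> lists A" "h = sum_list ys"
        using g h unfolding \<Gamma>_def by blast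
      then have "g + h = sum_list (xs @ ys)" "xs @ ys \<in> lists A" by simp_all
      then show ?thesis unfolding \<Gamma>_def by blast
    qed
    show "- g \<in> \<Gamma>" if g: "g \<in> \<Gamma>" for g
    proof -
      have neg: "- sum_list xs = sum_list (map uminus (rev xs))" for xs :: "'g list"
        by (induction xs) (simp_all add: minus_add)
      obtain xs where "xs \<in> lists A" "g = sum_list xs" using g unfolding \<Gamma>_def by blast
      then have "- g = sum_list (map uminus (rev xs))" "map uminus (rev xs) \<in> lists A"
        using neg A_minus by (auto simp: in_lists_conv_set)
      then show ?thesis unfolding \<Gamma>_def by blast
    qed
  qed
  moreover have "D \<subseteq> \<Gamma>"
  proof
    fix x assume "x \<in> D"
    then have "x = sum_list [x]" "[x] \<in> lists A" by (simp_all add: A_def)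
    then show "x \<in> \<Gamma>" unfolding \<Gamma>_def by blast
  qed
  then have "H \<subseteq> closure \<Gamma>" using D(3) closure_mono by blast
  then have "closure H \<subseteq> closure \<Gamma>" by (simp add: closure_minimal)
  then have "closure \<Gamma> = UNIV" using dense by blast
  ultimately show ?thesis by blast
qed

lemma L0_class:
  assumes "f \<in> measurable M N"
  shows "ae_rel M N `` {f} \<in> L0 M N" "f \<in> ae_rel M N `` {f}"
proof -
  show "ae_rel M N `` {f} \<in> L0 M N" unfolding L0_def by (rule quotientI[OF assms])
  show "f \<in> ae_rel M N `` {f}" using assms by (simp add: ae_rel_def)
qed

lemma L0_eq_class:
  assumes "C \<in> L0 M N" "f \<in> C"
  shows "C = ae_rel M N `` {f}"
proof -
  obtain g where g: "C = ae_rel M N `` {g}" using assms(1) unfolding L0_def by (rule quotientE)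
  then have "(g, f) \<in> ae_rel M N" using assms(2) by simp
  then show ?thesis using equiv_class_eq[OF equiv_ae_rel] g by simp
qed

text \<open>Compatibility of the pointwise description of a map with its class, used to move between representatives and elements of
$\mathrm L^0$.\<close>

lemma orbit_map_class:
  assumes f: "f \<in> borel_measurable M" and T: "T \<in> measurable M M"
    and Tf: "\<And>x. x \<in> space M \<Longrightarrow> T x = act (f x) x"
  shows "orbit_map M act (ae_rel M borel `` {f}) = ae_rel M M `` {T}"
proof (intro set_eqI iffI)
  fix T' assume "T' \<in> orbit_map M act (ae_rel M borel `` {f})"
  then obtain f' where T': "T' \<in> measurable M M" and f': "(f, f') \<in> ae_rel M borel"
    and ae: "AE x in M. T' x = act (f' x) x"
    unfolding orbit_map_def by blast
  have "AE x in M. f x = f' x" using f' by (simp add: ae_rel_def)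
  then have "AE x in M. T x = T' x" using ae AE_space
  proof eventually_elim
    case (elim x)
    then show ?case using Tf by simp
  qed
  then show "T' \<in> ae_rel M M `` {T}" using T T' by (simp add: ae_rel_def)
next
  fix T' assume "T' \<in> ae_rel M M `` {T}"
  then have T': "T' \<in> measurable M M" and ae: "AE x in M. T x = T' x" by (simp_all add: ae_rel_def)
  have "AE x in M. T' x = act (f x) x" using ae AE_space
  proof eventually_elim
    case (elim x)
    then show ?case using Tf by simp
  qed
  then show "T' \<in> orbit_map M act (ae_rel M borel `` {f})"
    unfolding orbit_map_def using T' L0_class(2)[OF f] by blast
qed

lemma mp_bijection_class_in_full_group:
  assumes T: "T \<in> mp_bijections M" and orb: "\<And>x. x \<in> space M \<Longrightarrow> T x \<in> orbit act H x"
  shows "ae_rel M M `` {T} \<in> full_group M act H"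
proof -
  have "T \<in> measurable M M" using T by (simp add: mp_bijections_def)
  note cl = L0_class[OF this]
  show ?thesis unfolding full_group_def Aut_def using cl T orb by blast
qed

theorem theorem1:
  fixes M :: "'x measure"
    and act :: "'g::{topological_group_add, polish_space} \<Rightarrow> 'x \<Rightarrow> 'x"
    and H :: "'g set"
    and d :: "'g \<Rightarrow> 'g \<Rightarrow> real"
  assumes "locally_compact_space (euclidean :: 'g topology)"
    and "standard_probability_space M"
    and "mp_action M act"
    and "add_subgroup H" and "closure H = UNIV"
    and "Metric_space UNIV d" and "Metric_space.mtopology UNIV d = euclidean"
    and "\<And>g h k. d (g + k) (h + k) = d g h" and "\<exists>B. \<forall>g h. d g h \<le> B"
  shows "(conv_in_measure_topology M act d) closure_of (full_group M act H) = full_group M act UNIV"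
proof
  let ?X = "conv_in_measure_topology M act d"
  show "?X closure_of (full_group M act H) \<subseteq> full_group M act UNIV"
    using closure_of_subset_topspace[of ?X] unfolding topspace_conv_in_measure_topology .
  have prob: "prob_space M" and borel: "standard_borel M"
    using assms(2) by (simp_all add: standard_probability_space_def)
  obtain B where B: "\<And>g h. d g h \<le> B" using assms(9) by blast
  have lcg: "lc_group_metric d"
    using assms(1,6,7,8) by (intro lc_group_metric.intro lc_group_metric_axioms.intro)
  obtain hm r0 where haar: "haar_group d hm r0" using lc_group_metric.ex_haar_group[OF lcg] by blast
  obtain \<Gamma> where \<Gamma>: "countable \<Gamma>" "\<Gamma> \<subseteq> H" "add_subgroup \<Gamma>" "closure \<Gamma> = UNIV"
    using ex_countable_dense_subgroup[OF assms(4,5)] by blast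
  interpret dense_haar_action d hm r0 M act \<Gamma>
    using haar prob borel assms(3) \<Gamma>(1,3,4)
    by (intro dense_haar_action.intro haar_action.intro haar_action_axioms.intro
        dense_haar_action_axioms.intro)
  interpret L: Metric_space "L0 M borel" "L0_dist M d"
    by (rule Metric_space_L0_dist[OF prob assms(6,7) B])
  note dist_eq = L0_dist_eq[OF continuous_on_compatible_metric[OF assms(6,7)]]
  show "full_group M act UNIV \<subseteq> ?X closure_of (full_group M act H)"
  proof
    fix C assume C: "C \<in> full_group M act UNIV"
    then obtain T where T: "C \<in> L0 M M" "T \<in> C" "T \<in> mp_bijections M"
      "\<forall>x\<in>space M. T x \<in> orbit act UNIV x"
      unfolding full_group_def Aut_def by blast
    obtain f where f: "f \<in> borel_measurable M" and Tf: "\<forall>x\<in>space M. T x = act (f x) x"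
      using ex_measurable_cocycle[OF mp_bijectionsD(1)[OF T(3)]] T(4) by blast
    let ?D = "ae_rel M borel `` {f}"
    have D: "orbit_map M act ?D = C"
      using orbit_map_class[OF f mp_bijectionsD(1)[OF T(3)]] Tf L0_eq_class[OF T(1,2)] by simp
    have DL: "?D \<in> full_group_lift M act"
      unfolding full_group_lift_def using L0_class(1)[OF f] D C by simp
    show "C \<in> ?X closure_of (full_group M act H)"
      unfolding in_closure_of topspace_conv_in_measure_topology
    proof (intro conjI allI impI)
      fix U assume U: "C \<in> U \<and> openin ?X U"
      let ?Y = "subtopology (L0_topology M d) (full_group_lift M act)"
      have "openin ?Y {E \<in> topspace ?Y. orbit_map M act E \<in> U}"
        using U unfolding conv_in_measure_topology_def openin_quotient_topology by blast
      then obtain V where V: "openin (L0_topology M d) V"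
        "{E \<in> topspace ?Y. orbit_map M act E \<in> U} = V \<inter> full_group_lift M act"
        unfolding openin_subtopology by blast
      have topY: "E \<in> topspace ?Y \<longleftrightarrow> E \<in> full_group_lift M act" for E
        by (auto simp: L0_topology_def full_group_lift_def)
      have "?D \<in> {E \<in> topspace ?Y. orbit_map M act E \<in> U}" using D DL U topY by simp
      then have "?D \<in> V" using V(2) by blast
      then obtain e where e: "0 < e" "L.mball ?D e \<subseteq> V"
        using V(1) unfolding L0_topology_def L.openin_mtopology by blast
      obtain h where h: "h \<in> borel_measurable M" "\<forall>x\<in>space M. h x \<in> \<Gamma>"
        "(\<lambda>x. act (h x) x) \<in> mp_bijections M" "(\<integral>x. d (f x) (h x) \<partial>M) < e"
        using ex_mp_bijection_near[OF T(3) f _ B e(1)] Tf by blast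
      let ?S = "\<lambda>x. act (h x) x"
      let ?E = "ae_rel M borel `` {h}"
      have E: "orbit_map M act ?E = ae_rel M M `` {?S}"
        by (rule orbit_map_class[OF h(1) mp_bijectionsD(1)[OF h(3)]]) simp
      have EH: "orbit_map M act ?E \<in> full_group M act H"
        unfolding E by (rule mp_bijection_class_in_full_group[OF h(3)])
          (use h(2) \<Gamma>(2) in \<open>auto simp: orbit_def\<close>)
      have "orbit_map M act ?E \<in> full_group M act UNIV"
        unfolding E by (rule mp_bijection_class_in_full_group[OF h(3)]) (auto simp: orbit_def)
      then have EL: "?E \<in> full_group_lift M act"
        unfolding full_group_lift_def using L0_class(1)[OF h(1)] by simp
      have "L0_dist M d ?D ?E = (\<integral>x. d (f x) (h x) \<partial>M)"
        by (rule dist_eq[OF L0_class(1)[OF f] L0_class(1)[OF h(1)] L0_class(2)[OF f] L0_class(2)[OF h(1)]])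
      then have "?E \<in> L.mball ?D e"
        using h(4) L0_class(1)[OF f] L0_class(1)[OF h(1)] by simp
      then have "?E \<in> {E \<in> topspace ?Y. orbit_map M act E \<in> U}" using e(2) EL V(2) by blast
      then show "\<exists>y. y \<in> full_group M act H \<and> y \<in> U" using EH by blast
    qed (rule C)
  qed
qed

end
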